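(* Let $(D_A\subseteq A)$ be a nondegenerate $C^*$-subalgebra, where $D_A$ is abelian. Then $$\dim_{\mathrm{diag}}(D_A\subseteq A)=\dim_{\mathrm{diag}}(D_A\subseteq A;\,\mathbb{C}),$$ where the left-hand side is the diagonal dimension of Li–Liao–Winter and the right-hand side is the generalised diagonal dimension with respect to $\mathbb{C}$.
   Context: Order zero maps. All $C^*$-algebras are concrete, i.e. faithfully represented on some Hilbert space. A completely positive map $\phi:A\to B$ between $C^*$-algebras has order zero if $\phi(a)\phi(a')=0$ for all positive $a,a'\in A$ with $aa'=0$. By the Winter–Zacharias theorem, with $C=C^*(\phi(A))$, there are a positive $h\in\mathcal{M}(C)\cap C'$ with $\|h\|=\|\phi\|$ and a $*$-homomorphism $\pi:A\to\mathcal{M}(C)\cap\{h\}'$ with $\phi(a)=h\pi(a)$ for all $a\in A$ ($h=\phi(1_A)$ if $A$ is unital); such a $\pi$ is called a supporting $*$-homomorphism of $\phi$. Normalisers. For a $C^*$-subalgebra $D\subseteq A$, $\mathcal{N}_A(D)=\{a\in A: aDa^*\subseteq D,\ a^*Da\subseteq D\}$. The inclusion is nondegenerate if $D$ contains an approximate unit for $A$. Diagonal dimension. Let $D_A\subseteq A$ be a $C^*$-subalgebra with $D_A$ abelian. Write $\dim_{\mathrm{diag}}(D_A\subseteq A)\le d$ if for any finite $\mathcal{F}\subseteq A$ and $\varepsilon>0$ there exist a finite-dimensional $C^*$-algebra $F=F^{(0)}\oplus\dots\oplus F^{(d)}$ with a maximal abelian $*$-subalgebra $D_F=D^{(0)}\oplus\dots\oplus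 D^{(d)}$ and completely positive maps $A\xrightarrow{\psi}F\xrightarrow{\phi}A$ such that: (1) $\psi$ is contractive; (2) $\|\phi\circ\psi(a)-a\|<\varepsilon$ for every $a\in\mathcal{F}$; (3) $\phi^{(i)}:=\phi|_{F^{(i)}}$ is a contractive order zero map for each $i\in\{0,\dots,d\}$; (4) $\psi(D_A)\subseteq D_F$; (5) $\phi^{(i)}(\mathcal{N}_{F^{(i)}}(D^{(i)}))\subseteq\mathcal{N}_A(D_A)$. The diagonal dimension is the least such $d$ ($\infty$ if none exists). Generalised diagonal dimension. Fix a $C^*$-algebra $B$ and a nondegenerate $C^*$-subalgebra $D_A\subseteq A$. Write $\dim_{\mathrm{diag}}(D_A\subseteq A;\,B)\le d$ if for any finite $\mathcal{F}\subseteq A$ and $\varepsilon>0$ there exist a finite-dimensional $C^*$-algebra $F=F^{(0)}\oplus\dots\oplus F^{(d)}$ with canonical diagonal (the diagonal matrices) $D_F=D^{(0)}\oplus\dots\oplus D^{(d)}$ and completely positive maps $A\xrightarrow{\psi}F\otimes B\xrightarrow{\phi}A$ such that: (1) $\psi$ is contractive; (2) $\|\phi\circ\psi(a)-a\|<\varepsilon$ for every $a\in\mathcal{F}$; (3) $\phi^{(i)}:=\phi|_{F^{(i)}\otimes B}$ is a contractive order zero map for each $i\in\{0,\dots,d\}$; (4) $\psi(D_A)\subseteq D_F\otimes B$; (5) $\phi^{(i)}(D^{(i)}\otimes B)\subseteq\mathcal{N}_A(D_A)$, and $\phi^{(i)}(v\otimes B)\subseteq\mathcal{N}_A(D_A)$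 for each matrix unit $v\in F^{(i)}$ with respect to $D^{(i)}$ (i.e. $vv^*$ and $v^*v$ are minimal projections of $D^{(i)}$); (6) for each $i$, if $\pi^{(i)}$ is a supporting $*$-homomorphism of $\phi^{(i)}$ and $\{u_\lambda\}_\lambda$ is an approximate unit of $B$, then the strong operator limit of $\pi^{(i)}(v\otimes u_\lambda)$ over $\lambda$ lies in the commutant $(D_A)'$, for each minimal projection $v\in D^{(i)}$. $\dim_{\mathrm{diag}}(D_A\subseteq A;\,B)$ is the least such $d$ ($\infty$ if none exists). *)

theory Defs
  imports "HOL-Analysis.Analysis" "HOL-Library.Extended_Nat"
begin

class chilbert_space = real_inner + complete_space +
  fixes scaleC :: "complex \<Rightarrow> 'a \<Rightarrow> 'a"  (infixr \<open>*\<^sub>C\<close> 75)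
    and cinner :: "'a \<Rightarrow> 'a \<Rightarrow> complex"
  assumes scaleC_add_right: "c *\<^sub>C (x + y) = c *\<^sub>C x + c *\<^sub>C y"
    and scaleC_add_left: "(c + d) *\<^sub>C x = c *\<^sub>C x + d *\<^sub>C x"
    and scaleC_scaleC: "c *\<^sub>C d *\<^sub>C x = (c * d) *\<^sub>C x"
    and scaleC_of_real: "complex_of_real r *\<^sub>C x = r *\<^sub>R x"
    and cinner_commute: "cinner x y = cnj (cinner y x)"
    and cinner_add_left: "cinner (x + y) z = cinner x z + cinner y z"
    and cinner_scaleC_left: "cinner (c *\<^sub>C x) y = c * cinner x y"
    and Re_cinner: "Re (cinner x y) = inner x y"

lemma cinner_self: "cinner x x = complex_of_real ((norm x)\<^sup>2)" for x :: "'a::chilbert_space"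
proof -
  have "Im (cinner x x) = 0"
    using arg_cong[OF cinner_commute[of x x], of Im] by simp
  then show ?thesis
    by (simp add: complex_eq_iff Re_cinner power2_norm_eq_inner)
qed

lemma cinner_scaleC_right: "cinner x (c *\<^sub>C y) = cnj c * cinner x y" for x :: "'a::chilbert_space"
proof -
  have "cinner x (c *\<^sub>C y) = cnj (c * cinner y x)"
    by (subst cinner_commute) (simp only: cinner_scaleC_left)
  also have "\<dots> = cnj c * cinner x y"
    by (subst (2) cinner_commute) (simp only: complex_cnj_mult)
  finally show ?thesis .
qed

lemma norm_scaleC: "norm (c *\<^sub>C x) = cmod c * norm x" for x :: "'a::chilbert_space"
proof -
  have "complex_of_real ((norm (c *\<^sub>C x))\<^sup>2) = (c * cnj c) * cinner x x"
    by (simp only: cinner_self[symmetric] cinner_scaleC_left cinner_scaleC_right mult.assoc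
        mult.left_commute)
  also have "\<dots> = complex_of_real ((cmod c * norm x)\<^sup>2)"
    by (simp only: cinner_self complex_norm_square[symmetric] of_real_power of_real_mult
        power_mult_distrib)
  finally show ?thesis
    by (simp only: of_real_eq_iff) (simp add: power2_eq_imp_eq)
qed

lemma scaleC_scaleR_commute: "c *\<^sub>C r *\<^sub>R x = r *\<^sub>R c *\<^sub>C x" for x :: "'a::chilbert_space"
  by (simp only: scaleC_of_real[symmetric] scaleC_scaleC mult.commute)

lemma bounded_linear_scaleC: "bounded_linear (\<lambda>x::'a::chilbert_space. c *\<^sub>C x)"
  by (rule bounded_linear_intro[where K = "cmod c"])
    (simp_all add: scaleC_add_right scaleC_scaleR_commute norm_scaleC mult.commute)

lemma norm_cinner_le: "cmod (cinner x y) \<le> norm x * norm y" for x :: "'a::chilbert_space"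
proof (cases "cinner x y = 0")
  case False
  define z where "z = cinner x y"
  define c where "c = cnj z / cmod z"
  have z: "z \<noteq> 0" using False z_def by simp
  have "cinner (c *\<^sub>C x) y = complex_of_real (cmod z)"
    unfolding cinner_scaleC_left c_def z_def[symmetric]
    using z by (simp add: field_simps complex_norm_square[symmetric] power2_eq_square)
  then have "cmod z = inner (c *\<^sub>C x) y"
    by (simp add: Re_cinner[symmetric])
  also have "\<dots> \<le> norm (c *\<^sub>C x) * norm y" by (rule norm_cauchy_schwarz)
  also have "norm (c *\<^sub>C x) = norm x"
    using z by (simp add: norm_scaleC c_def norm_divide)
  finally show ?thesis by (simp add: z_def)
qed simp

instantiation complex :: chilbert_space
begin
definition scaleC_complex :: "complex \<Rightarrow> complex \<Rightarrow> complex" where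
  "scaleC_complex c z = c * z"
definition cinner_complex :: "complex \<Rightarrow> complex \<Rightarrow> complex" where
  "cinner_complex z w = z * cnj w"
instance
  by standard (simp_all add: scaleC_complex_def cinner_complex_def inner_complex_def
      algebra_simps scaleR_conv_of_real)
end

typedef (overloaded) 'k ell2 =
  "{f :: nat \<Rightarrow> 'k::real_normed_vector. summable (\<lambda>n. (norm (f n))\<^sup>2)}"
  morphisms ell2_nth Abs_ell2
  by (rule exI[of _ "\<lambda>_. 0"]) simp

setup_lifting type_definition_ell2

lemma ell2_nth_summable: "summable (\<lambda>n. (norm (ell2_nth f n))\<^sup>2)"
  using ell2_nth by auto

lemma ell2_summable_add:
  fixes f g :: "nat \<Rightarrow> 'k::real_normed_vector"
  assumes "summable (\<lambda>n. (norm (f n))\<^sup>2)" "summable (\<lambda>n. (norm (g n))\<^sup>2)"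
  shows "summable (\<lambda>n. (norm (f n + g n))\<^sup>2)"
proof (rule summable_comparison_test'[where N = 0])
  show "summable (\<lambda>n. 2 * (norm (f n))\<^sup>2 + 2 * (norm (g n))\<^sup>2)"
    using assms by (intro summable_add summable_mult)
  fix n
  have "(norm (f n + g n))\<^sup>2 \<le> (norm (f n) + norm (g n))\<^sup>2"
    by (simp add: norm_triangle_ineq power_mono)
  also have "\<dots> \<le> 2 * (norm (f n))\<^sup>2 + 2 * (norm (g n))\<^sup>2"
    using sum_squares_bound[of "norm (f n)" "norm (g n)"] by (simp add: power2_sum)
  finally show "norm ((norm (f n + g n))\<^sup>2) \<le> 2 * (norm (f n))\<^sup>2 + 2 * (norm (g n))\<^sup>2"
    by simp
qed

lemma ell2_summable_prod:
  fixes f g :: "'k::real_normed_vector ell2"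
  shows "summable (\<lambda>n. norm (ell2_nth f n) * norm (ell2_nth g n))"
proof (rule summable_comparison_test'[where N = 0])
  show "summable (\<lambda>n. (norm (ell2_nth f n))\<^sup>2 + (norm (ell2_nth g n))\<^sup>2)"
    by (intro summable_add ell2_nth_summable)
  fix n
  show "norm (norm (ell2_nth f n) * norm (ell2_nth g n))
      \<le> (norm (ell2_nth f n))\<^sup>2 + (norm (ell2_nth g n))\<^sup>2"
    using sum_squares_bound[of "norm (ell2_nth f n)" "norm (ell2_nth g n)"]
      mult_nonneg_nonneg[OF norm_ge_zero norm_ge_zero, of "ell2_nth f n" "ell2_nth g n"]
    unfolding real_norm_def abs_mult abs_norm_cancel by linarith
qed

lemma ell2_summable_inner:
  fixes f g :: "'k::real_inner ell2"
  shows "summable (\<lambda>n. inner (ell2_nth f n) (ell2_nth g n))"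
  by (rule summable_comparison_test'[where N = 0, OF ell2_summable_prod[of f g]])
    (simp add: Cauchy_Schwarz_ineq2)

lemma ell2_summable_cinner:
  fixes f g :: "'k::chilbert_space ell2"
  shows "summable (\<lambda>n. cinner (ell2_nth f n) (ell2_nth g n))"
  by (rule summable_comparison_test'[where N = 0, OF ell2_summable_prod[of f g]])
    (simp add: norm_cinner_le)

instantiation ell2 :: (real_inner) real_inner
begin
lift_definition zero_ell2 :: "'a ell2" is "\<lambda>_. 0" by simp
lift_definition plus_ell2 :: "'a ell2 \<Rightarrow> 'a ell2 \<Rightarrow> 'a ell2" is "\<lambda>f g n. f n + g n"
  by (rule ell2_summable_add)
lift_definition uminus_ell2 :: "'a ell2 \<Rightarrow> 'a ell2" is "\<lambda>f n. - f n" by simp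
lift_definition minus_ell2 :: "'a ell2 \<Rightarrow> 'a ell2 \<Rightarrow> 'a ell2" is "\<lambda>f g n. f n - g n"
  using ell2_summable_add[of _ "\<lambda>n. - g n" for g] by fastforce
lift_definition scaleR_ell2 :: "real \<Rightarrow> 'a ell2 \<Rightarrow> 'a ell2" is "\<lambda>r f n. r *\<^sub>R f n"
  by (simp add: power_mult_distrib summable_mult)
definition inner_ell2 :: "'a ell2 \<Rightarrow> 'a ell2 \<Rightarrow> real" where
  "inner_ell2 f g = (\<Sum>n. inner (ell2_nth f n) (ell2_nth g n))"
definition norm_ell2 :: "'a ell2 \<Rightarrow> real" where
  "norm_ell2 f = sqrt (inner f f)"
definition dist_ell2 :: "'a ell2 \<Rightarrow> 'a ell2 \<Rightarrow> real" where
  "dist_ell2 f g = norm (f - g)"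
definition sgn_ell2 :: "'a ell2 \<Rightarrow> 'a ell2" where
  "sgn_ell2 f = inverse (norm f) *\<^sub>R f"
definition uniformity_ell2 :: "('a ell2 \<times> 'a ell2) filter" where
  "uniformity_ell2 = (INF e\<in>{0<..}. principal {(x, y). dist x y < e})"
definition open_ell2 :: "'a ell2 set \<Rightarrow> bool" where
  "open_ell2 U \<longleftrightarrow> (\<forall>x\<in>U. \<forall>\<^sub>F (x', y) in uniformity. x' = x \<longrightarrow> y \<in> U)"

instance
proof
  fix x y z :: "'a ell2" and r s :: real and U :: "'a ell2 set"
  show "x + y + z = x + (y + z)" "x + y = y + x" "0 + x = x" "- x + x = 0" "x - y = x + - y"
    by (transfer, simp add: algebra_simps)+
  show "r *\<^sub>R (x + y) = r *\<^sub>R x + r *\<^sub>R y" "(r + s) *\<^sub>R x = r *\<^sub>R x + s *\<^sub>R x"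
    "r *\<^sub>R s *\<^sub>R x = (r * s) *\<^sub>R x" "1 *\<^sub>R x = x"
    by (transfer, simp add: algebra_simps)+
  show "dist x y = norm (x - y)" by (rule dist_ell2_def)
  show "sgn x = inverse (norm x) *\<^sub>R x" by (rule sgn_ell2_def)
  show "(uniformity :: ('a ell2 \<times> 'a ell2) filter)
      = (INF e\<in>{0<..}. principal {(x, y). dist x y < e})"
    by (rule uniformity_ell2_def)
  show "open U = (\<forall>x\<in>U. \<forall>\<^sub>F (x', y) in uniformity. x' = x \<longrightarrow> y \<in> U)" by (rule open_ell2_def)
  show "inner x y = inner y x" by (simp add: inner_ell2_def inner_commute)
  show "inner (x + y) z = inner x z + inner y z"
    unfolding inner_ell2_def suminf_add[OF ell2_summable_inner ell2_summable_inner]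
    by (simp add: plus_ell2.rep_eq inner_add_left)
  show "inner (r *\<^sub>R x) y = r * inner x y"
    unfolding inner_ell2_def suminf_mult[OF ell2_summable_inner, symmetric]
    by (simp add: scaleR_ell2.rep_eq)
  show "0 \<le> inner x x"
    unfolding inner_ell2_def by (rule suminf_nonneg[OF ell2_summable_inner]) simp
  show "inner x x = 0 \<longleftrightarrow> x = 0"
    unfolding inner_ell2_def using suminf_eq_zero_iff[OF ell2_summable_inner[of x x]]
    by (simp add: ell2_nth_inject[symmetric] zero_ell2.rep_eq fun_eq_iff)
  show "norm x = sqrt (inner x x)" by (rule norm_ell2_def)
qed
end

lemma ell2_norm_sq: "(norm f)\<^sup>2 = (\<Sum>n. (norm (ell2_nth f n))\<^sup>2)"
  for f :: "'k::real_inner ell2"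
  by (simp add: power2_norm_eq_inner inner_ell2_def)

lemma ell2_norm_nth_le: "norm (ell2_nth f n) \<le> norm f" for f :: "'k::real_inner ell2"
proof -
  have "(norm (ell2_nth f n))\<^sup>2 = (\<Sum>k\<in>{n}. (norm (ell2_nth f k))\<^sup>2)" by simp
  also have "\<dots> \<le> (norm f)\<^sup>2"
    unfolding ell2_norm_sq by (rule sum_le_suminf[OF ell2_nth_summable]) auto
  finally show ?thesis by (rule power2_le_imp_le) simp
qed

instance ell2 :: ("{real_inner, complete_space}") complete_space
proof
  fix X :: "nat \<Rightarrow> 'a ell2"
  assume X: "Cauchy X"
  have "Cauchy (\<lambda>m. ell2_nth (X m) k)" for k
  proof (rule metric_CauchyI)
    fix e :: real assume "0 < e"
    then obtain M where M: "\<forall>m\<ge>M. \<forall>n\<ge>M. dist (X m) (X n) < e"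
      using metric_CauchyD[OF X] by blast
    have "dist (ell2_nth (X m) k) (ell2_nth (X n) k) < e" if "m \<ge> M" "n \<ge> M" for m n
      using ell2_norm_nth_le[of "X m - X n" k] M[rule_format, OF that]
      unfolding dist_norm minus_ell2.rep_eq by (rule le_less_trans)
    then show "\<exists>M. \<forall>m\<ge>M. \<forall>n\<ge>M. dist (ell2_nth (X m) k) (ell2_nth (X n) k) < e" by blast
  qed
  then have "\<forall>k. \<exists>l. (\<lambda>m. ell2_nth (X m) k) \<longlonglongrightarrow> l"
    by (simp add: Cauchy_convergent_iff convergent_def)
  then obtain g where g: "\<And>k. (\<lambda>m. ell2_nth (X m) k) \<longlonglongrightarrow> g k" by metis
  have part: "(\<Sum>k<K. (norm (ell2_nth (X m) k - g k))\<^sup>2) \<le> e\<^sup>2"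
    if M: "\<forall>m\<ge>M. \<forall>n\<ge>M. dist (X m) (X n) < e" and "m \<ge> M" for M m K and e :: real
  proof (rule LIMSEQ_le_const2)
    show "(\<lambda>n. \<Sum>k<K. (norm (ell2_nth (X m) k - ell2_nth (X n) k))\<^sup>2)
        \<longlonglongrightarrow> (\<Sum>k<K. (norm (ell2_nth (X m) k - g k))\<^sup>2)"
      by (intro tendsto_sum tendsto_power tendsto_norm tendsto_diff tendsto_const g)
    have "(\<Sum>k<K. (norm (ell2_nth (X m) k - ell2_nth (X n) k))\<^sup>2) \<le> e\<^sup>2" if "n \<ge> M" for n
    proof -
      have "(\<Sum>k<K. (norm (ell2_nth (X m - X n) k))\<^sup>2) \<le> (norm (X m - X n))\<^sup>2"
        unfolding ell2_norm_sq by (rule sum_le_suminf[OF ell2_nth_summable]) auto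
      also have "\<dots> \<le> e\<^sup>2"
        using M[rule_format, OF \<open>m \<ge> M\<close> that]
        by (intro power_mono) (simp_all add: dist_norm)
      finally show ?thesis by (simp add: minus_ell2.rep_eq)
    qed
    then show "\<exists>N. \<forall>n\<ge>N. (\<Sum>k<K. (norm (ell2_nth (X m) k - ell2_nth (X n) k))\<^sup>2) \<le> e\<^sup>2" by blast
  qed
  have diff: "summable (\<lambda>k. (norm (ell2_nth (X m) k - g k))\<^sup>2)"
    if M: "\<forall>m\<ge>M. \<forall>n\<ge>M. dist (X m) (X n) < e" and "m \<ge> M" for M m and e :: real
    by (rule summableI_nonneg_bounded[where x = "e\<^sup>2", OF _ part[OF that]]) simp
  obtain M where M: "\<forall>m\<ge>M. \<forall>n\<ge>M. dist (X m) (X n) < 1"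
    using metric_CauchyD[OF X zero_less_one] by blast
  have "summable (\<lambda>k. (norm (ell2_nth (X M) k + (g k - ell2_nth (X M) k)))\<^sup>2)"
    using diff[OF M order_refl]
    by (intro ell2_summable_add ell2_nth_summable) (simp only: norm_minus_commute)
  then have gs: "summable (\<lambda>k. (norm (g k))\<^sup>2)" by simp
  have "X \<longlonglongrightarrow> Abs_ell2 g"
  proof (rule metric_LIMSEQ_I)
    fix r :: real assume "0 < r"
    then obtain M where M: "\<forall>m\<ge>M. \<forall>n\<ge>M. dist (X m) (X n) < r / 2"
      using metric_CauchyD[OF X half_gt_zero] by blast
    have "dist (X m) (Abs_ell2 g) < r" if "m \<ge> M" for m
    proof -
      have nth: "ell2_nth (Abs_ell2 g) = g"
        by (rule Abs_ell2_inverse) (simp add: gs)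
      have "(norm (X m - Abs_ell2 g))\<^sup>2 \<le> (r / 2)\<^sup>2"
        unfolding ell2_norm_sq minus_ell2.rep_eq nth
        by (rule suminf_le_const[OF diff[OF M that] part[OF M that]])
      then have "norm (X m - Abs_ell2 g) \<le> r / 2"
        by (rule power2_le_imp_le) (use \<open>0 < r\<close> in simp)
      then show ?thesis using \<open>0 < r\<close> by (simp add: dist_norm)
    qed
    then show "\<exists>no. \<forall>n\<ge>no. dist (X n) (Abs_ell2 g) < r" by blast
  qed
  then show "convergent X" by (rule convergentI)
qed

instantiation ell2 :: (chilbert_space) chilbert_space
begin
lift_definition scaleC_ell2 :: "complex \<Rightarrow> 'a ell2 \<Rightarrow> 'a ell2" is "\<lambda>c f n. c *\<^sub>C f n"
  by (simp add: norm_scaleC power_mult_distrib summable_mult)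
definition cinner_ell2 :: "'a ell2 \<Rightarrow> 'a ell2 \<Rightarrow> complex" where
  "cinner_ell2 f g = (\<Sum>n. cinner (ell2_nth f n) (ell2_nth g n))"

instance
proof
  fix x y z :: "'a ell2" and c d :: complex and r :: real
  show "c *\<^sub>C (x + y) = c *\<^sub>C x + c *\<^sub>C y"
    by transfer (simp add: scaleC_add_right)
  show "(c + d) *\<^sub>C x = c *\<^sub>C x + d *\<^sub>C x"
    by transfer (simp add: scaleC_add_left)
  show "c *\<^sub>C d *\<^sub>C x = (c * d) *\<^sub>C x"
    by transfer (simp add: scaleC_scaleC)
  show "complex_of_real r *\<^sub>C x = r *\<^sub>R x"
    by transfer (simp add: scaleC_of_real)
  have "cnj (cinner y x) = (\<Sum>n. cnj (cinner (ell2_nth y n) (ell2_nth x n)))"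
    unfolding cinner_ell2_def
    by (rule bounded_linear.suminf[OF bounded_linear_cnj ell2_summable_cinner])
  also have "(\<lambda>n. cnj (cinner (ell2_nth y n) (ell2_nth x n)))
      = (\<lambda>n. cinner (ell2_nth x n) (ell2_nth y n))"
    by (rule ext) (rule cinner_commute[symmetric])
  finally show "cinner x y = cnj (cinner y x)"
    by (simp only: cinner_ell2_def)
  show "cinner (x + y) z = cinner x z + cinner y z"
    unfolding cinner_ell2_def suminf_add[OF ell2_summable_cinner ell2_summable_cinner]
    by (simp add: plus_ell2.rep_eq cinner_add_left)
  show "cinner (c *\<^sub>C x) y = c * cinner x y"
    unfolding cinner_ell2_def suminf_mult[OF ell2_summable_cinner, symmetric]
    by (simp add: scaleC_ell2.rep_eq cinner_scaleC_left)
  show "Re (cinner x y) = inner x y"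
    unfolding cinner_ell2_def inner_ell2_def Re_suminf[OF ell2_summable_cinner]
    by (simp add: Re_cinner)
qed
end

type_synonym 'h op = "'h \<Rightarrow>\<^sub>L 'h"

text \<open>Members of the type \<^typ>\<open>'h op\<close> are only real-linear, so \<open>B(H)\<close> is the following subset;
  its norm is the operator norm and its product is composition.\<close>

definition bops :: "'h::chilbert_space op set" where
  "bops = {T. \<forall>c \<xi>. blinfun_apply T (c *\<^sub>C \<xi>) = c *\<^sub>C blinfun_apply T \<xi>}"

lift_definition op_scale :: "complex \<Rightarrow> 'h::chilbert_space op \<Rightarrow> 'h op"
  is "\<lambda>c T \<xi>. c *\<^sub>C T \<xi>"
  by (rule bounded_linear_compose[OF bounded_linear_scaleC])

definition adj :: "'h::chilbert_space op \<Rightarrow> 'h op" where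
  "adj T = (THE S. \<forall>\<xi> \<eta>. cinner (blinfun_apply T \<xi>) \<eta> = cinner \<xi> (blinfun_apply S \<eta>))"

definition pos_op :: "'h::chilbert_space op \<Rightarrow> bool" where
  "pos_op T \<longleftrightarrow> T \<in> bops \<and> (\<forall>\<xi>. cinner (blinfun_apply T \<xi>) \<xi> \<in> \<real>\<^sub>\<ge>\<^sub>0)"

definition star_algebra :: "'h::chilbert_space op set \<Rightarrow> bool" where
  "star_algebra A \<longleftrightarrow> A \<subseteq> bops \<and> 0 \<in> A \<and>
    (\<forall>a\<in>A. \<forall>b\<in>A. a + b \<in> A \<and> a o\<^sub>L b \<in> A) \<and>
    (\<forall>a\<in>A. adj a \<in> A \<and> (\<forall>c. op_scale c a \<in> A))"

definition cstar_algebra :: "'h::chilbert_space op set \<Rightarrow> bool" where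
  "cstar_algebra A \<longleftrightarrow> star_algebra A \<and> closed A"

definition abelian :: "'h::chilbert_space op set \<Rightarrow> bool" where
  "abelian A \<longleftrightarrow> (\<forall>a\<in>A. \<forall>b\<in>A. a o\<^sub>L b = b o\<^sub>L a)"

definition cstar_generated :: "'h::chilbert_space op set \<Rightarrow> 'h op set" where
  "cstar_generated S = \<Inter>{C. cstar_algebra C \<and> S \<subseteq> C}"

definition commutant :: "'h::chilbert_space op set \<Rightarrow> 'h op set" where
  "commutant S = {T \<in> bops. \<forall>s\<in>S. T o\<^sub>L s = s o\<^sub>L T}"

text \<open>The multiplier algebra of \<open>C\<close>, represented on the essential subspace \<open>[CH]\<close> of \<open>C\<close>, where
  \<open>C\<close> is nondegenerate, and extended by zero to \<open>H\<close>. The last condition says that \<open>T\<close> vanishes on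
  the orthogonal complement of \<open>[CH]\<close>, which is the common kernel of \<open>C\<close>.\<close>

definition multipliers :: "'h::chilbert_space op set \<Rightarrow> 'h op set" where
  "multipliers C = {T \<in> bops. (\<forall>c\<in>C. T o\<^sub>L c \<in> C \<and> c o\<^sub>L T \<in> C) \<and>
    (\<forall>\<xi>. (\<forall>c\<in>C. blinfun_apply c \<xi> = 0) \<longrightarrow> blinfun_apply T \<xi> = 0)}"

definition normalisers :: "'h::chilbert_space op set \<Rightarrow> 'h op set \<Rightarrow> 'h op set" where
  "normalisers A D = {a \<in> A. \<forall>x\<in>D. a o\<^sub>L x o\<^sub>L adj a \<in> D \<and> adj a o\<^sub>L x o\<^sub>L a \<in> D}"

text \<open>An approximate unit is given by the filter of tails of a net of positive contractions;
  limits along a net depend on this filter only.\<close>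

definition approx_unit :: "'h::chilbert_space op filter \<Rightarrow> 'h op set \<Rightarrow> bool" where
  "approx_unit U A \<longleftrightarrow> U \<noteq> bot \<and>
    (\<forall>\<^sub>F u in U. u \<in> A \<and> pos_op u \<and> norm u \<le> 1) \<and>
    (\<forall>a\<in>A. ((\<lambda>u. u o\<^sub>L a) \<longlongrightarrow> a) U \<and> ((\<lambda>u. a o\<^sub>L u) \<longlongrightarrow> a) U)"

definition nondegenerate :: "'h::chilbert_space op set \<Rightarrow> 'h op set \<Rightarrow> bool" where
  "nondegenerate D A \<longleftrightarrow> (\<exists>U. approx_unit U A \<and> (\<forall>\<^sub>F u in U. u \<in> D))"

definition complex_alg :: "complex op set" where
  "complex_alg = range blinfun_mult_right"

definition op_linear_on ::
  "'h::chilbert_space op set \<Rightarrow> ('h op \<Rightarrow> 'k::chilbert_space op) \<Rightarrow> bool" where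
  "op_linear_on A \<phi> \<longleftrightarrow>
    (\<forall>a\<in>A. \<forall>b\<in>A. \<phi> (a + b) = \<phi> a + \<phi> b) \<and> (\<forall>a\<in>A. \<forall>c. \<phi> (op_scale c a) = op_scale c (\<phi> a))"

text \<open>Positivity of the matrix \<open>(a i j)\<close>, \<open>i, j < n\<close>, as an operator on \<open>H\<^sup>n\<close>.\<close>

definition pos_matrix :: "nat \<Rightarrow> (nat \<Rightarrow> nat \<Rightarrow> 'h::chilbert_space op) \<Rightarrow> bool" where
  "pos_matrix n a \<longleftrightarrow>
    (\<forall>\<xi>. (\<Sum>i<n. \<Sum>j<n. cinner (blinfun_apply (a i j) (\<xi> j)) (\<xi> i)) \<in> \<real>\<^sub>\<ge>\<^sub>0)"

definition cp_map ::
  "'h::chilbert_space op set \<Rightarrow> 'k::chilbert_space op set \<Rightarrow> ('h op \<Rightarrow> 'k op) \<Rightarrow> bool" where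
  "cp_map A B \<phi> \<longleftrightarrow> \<phi> ` A \<subseteq> B \<and> op_linear_on A \<phi> \<and>
    (\<forall>n a. (\<forall>i<n. \<forall>j<n. a i j \<in> A) \<and> pos_matrix n a \<longrightarrow> pos_matrix n (\<lambda>i j. \<phi> (a i j)))"

definition contractive_on ::
  "'h::chilbert_space op set \<Rightarrow> ('h op \<Rightarrow> 'k::chilbert_space op) \<Rightarrow> bool" where
  "contractive_on A \<phi> \<longleftrightarrow> (\<forall>a\<in>A. norm (\<phi> a) \<le> norm a)"

definition map_norm ::
  "'h::chilbert_space op set \<Rightarrow> ('h op \<Rightarrow> 'k::chilbert_space op) \<Rightarrow> real" where
  "map_norm A \<phi> = (SUP a\<in>{a \<in> A. norm a \<le> 1}. norm (\<phi> a))"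

definition order_zero ::
  "'h::chilbert_space op set \<Rightarrow> 'k::chilbert_space op set \<Rightarrow> ('h op \<Rightarrow> 'k op) \<Rightarrow> bool" where
  "order_zero A B \<phi> \<longleftrightarrow> cp_map A B \<phi> \<and>
    (\<forall>a\<in>A. \<forall>a'\<in>A. pos_op a \<and> pos_op a' \<and> a o\<^sub>L a' = 0 \<longrightarrow> \<phi> a o\<^sub>L \<phi> a' = 0)"

definition star_hom ::
  "'h::chilbert_space op set \<Rightarrow> 'k::chilbert_space op set \<Rightarrow> ('h op \<Rightarrow> 'k op) \<Rightarrow> bool" where
  "star_hom A B \<pi> \<longleftrightarrow> \<pi> ` A \<subseteq> B \<and> op_linear_on A \<pi> \<and>
    (\<forall>a\<in>A. \<forall>b\<in>A. \<pi> (a o\<^sub>L b) = \<pi> a o\<^sub>L \<pi> b) \<and> (\<forall>a\<in>A. \<pi> (adj a) = adj (\<pi> a))"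

definition supporting_hom ::
  "'h::chilbert_space op set \<Rightarrow> ('h op \<Rightarrow> 'k::chilbert_space op) \<Rightarrow> ('h op \<Rightarrow> 'k op) \<Rightarrow> bool" where
  "supporting_hom A \<phi> \<pi> \<longleftrightarrow> (\<exists>h C. C = cstar_generated (\<phi> ` A) \<and>
    h \<in> multipliers C \<inter> commutant C \<and> pos_op h \<and> norm h = map_norm A \<phi> \<and>
    (\<forall>e\<in>A. (\<forall>a\<in>A. e o\<^sub>L a = a \<and> a o\<^sub>L e = a) \<longrightarrow> h = \<phi> e) \<and>
    star_hom A (multipliers C \<inter> commutant {h}) \<pi> \<and> (\<forall>a\<in>A. \<phi> a = h o\<^sub>L \<pi> a))"

text \<open>The real span and the complex span of a set have finite dimension simultaneously.\<close>

definition finite_dim :: "'h::chilbert_space op set \<Rightarrow> bool" where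
  "finite_dim F \<longleftrightarrow> (\<exists>S. finite S \<and> F \<subseteq> span S)"

definition masa :: "'h::chilbert_space op set \<Rightarrow> 'h op set \<Rightarrow> bool" where
  "masa D F \<longleftrightarrow> star_algebra D \<and> abelian D \<and> D \<subseteq> F \<and>
    (\<forall>D'. star_algebra D' \<and> abelian D' \<and> D \<subseteq> D' \<and> D' \<subseteq> F \<longrightarrow> D' = D)"

text \<open>\<open>F 0 \<oplus> \<dots> \<oplus> F d\<close> is the sum of pairwise orthogonal algebras of operators on one Hilbert space.\<close>

definition orthogonal_algs :: "nat \<Rightarrow> (nat \<Rightarrow> 'h::chilbert_space op set) \<Rightarrow> bool" where
  "orthogonal_algs d F \<longleftrightarrow>
    (\<forall>i\<le>d. \<forall>j\<le>d. i \<noteq> j \<longrightarrow> (\<forall>x\<in>F i. \<forall>y\<in>F j. x o\<^sub>L y = 0))"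

definition dsum :: "nat \<Rightarrow> (nat \<Rightarrow> 'h::chilbert_space op set) \<Rightarrow> 'h op set" where
  "dsum d F = {(\<Sum>i\<le>d. x i) | x. \<forall>i\<le>d. x i \<in> F i}"

definition projection :: "'h::chilbert_space op \<Rightarrow> bool" where
  "projection p \<longleftrightarrow> p \<in> bops \<and> adj p = p \<and> p o\<^sub>L p = p"

definition min_projection :: "'h::chilbert_space op set \<Rightarrow> 'h op \<Rightarrow> bool" where
  "min_projection D p \<longleftrightarrow> p \<in> D \<and> projection p \<and> p \<noteq> 0 \<and>
    (\<forall>q\<in>D. projection q \<and> q o\<^sub>L p = q \<longrightarrow> q = 0 \<or> q = p)"

definition matrix_unit :: "'h::chilbert_space op set \<Rightarrow> 'h op set \<Rightarrow> 'h op \<Rightarrow> bool" where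
  "matrix_unit F D v \<longleftrightarrow> v \<in> F \<and> min_projection D (v o\<^sub>L adj v) \<and> min_projection D (adj v o\<^sub>L v)"

definition ell2_basis :: "nat \<Rightarrow> complex ell2" where
  "ell2_basis n = Abs_ell2 (\<lambda>k. if k = n then 1 else 0)"

text \<open>For an equivalence relation \<open>E\<close> on a finite set \<open>X\<close> of natural numbers, \<open>block_alg E\<close> is the
  direct sum, over the equivalence classes \<open>K\<close> of \<open>E\<close>, of the full matrix algebras on the basis vectors
  indexed by \<open>K\<close>, and \<open>block_alg (Id_on X)\<close> is its subalgebra of diagonal matrices. Every
  finite-dimensional C*-algebra together with its canonical diagonal is isomorphic to one of this form.\<close>

definition block_alg :: "(nat \<times> nat) set \<Rightarrow> complex ell2 op set" where
  "block_alg E = {x \<in> bops. \<forall>r s. (r, s) \<notin> E \<longrightarrow> ell2_nth (blinfun_apply x (ell2_basis s)) r = 0}"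

text \<open>\<^typ>\<open>'k ell2\<close> is the Hilbert space tensor product of \<^typ>\<open>complex ell2\<close> and \<^typ>\<open>'k\<close>.\<close>

definition tensor_vec :: "complex ell2 \<Rightarrow> 'k::chilbert_space \<Rightarrow> 'k ell2" where
  "tensor_vec \<xi> \<eta> = Abs_ell2 (\<lambda>n. ell2_nth \<xi> n *\<^sub>C \<eta>)"

definition tensor_op :: "complex ell2 op \<Rightarrow> 'k::chilbert_space op \<Rightarrow> 'k ell2 op" where
  "tensor_op x b = (THE T. T \<in> bops \<and>
    (\<forall>\<xi> \<eta>. blinfun_apply T (tensor_vec \<xi> \<eta>) = tensor_vec (blinfun_apply x \<xi>) (blinfun_apply b \<eta>)))"

text \<open>For complex subspaces \<open>F\<close> and \<open>B\<close> the real span below is a complex subspace.\<close>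

definition tensor_alg ::
  "complex ell2 op set \<Rightarrow> 'k::chilbert_space op set \<Rightarrow> 'k ell2 op set" where
  "tensor_alg F B = closure (span {tensor_op x b | x b. x \<in> F \<and> b \<in> B})"

text \<open>Every finite-dimensional C*-algebra has a faithful representation on \<^typ>\<open>complex ell2\<close>.\<close>

definition diag_dim_le :: "'h::chilbert_space op set \<Rightarrow> 'h op set \<Rightarrow> nat \<Rightarrow> bool" where
  "diag_dim_le D A d \<longleftrightarrow> (\<forall>\<F> \<epsilon>. finite \<F> \<and> \<F> \<subseteq> A \<and> 0 < \<epsilon> \<longrightarrow>
    (\<exists>(F :: nat \<Rightarrow> complex ell2 op set) (DF :: nat \<Rightarrow> complex ell2 op set) \<psi> \<phi>.
      (\<forall>i\<le>d. cstar_algebra (F i) \<and> finite_dim (F i)) \<and> orthogonal_algs d F \<and>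
      (\<forall>i\<le>d. star_algebra (DF i) \<and> DF i \<subseteq> F i) \<and> masa (dsum d DF) (dsum d F) \<and>
      cp_map A (dsum d F) \<psi> \<and> cp_map (dsum d F) A \<phi> \<and>
      contractive_on A \<psi> \<and>
      (\<forall>a\<in>\<F>. norm (\<phi> (\<psi> a) - a) < \<epsilon>) \<and>
      (\<forall>i\<le>d. contractive_on (F i) \<phi> \<and> order_zero (F i) A \<phi>) \<and>
      \<psi> ` D \<subseteq> dsum d DF \<and>
      (\<forall>i\<le>d. \<phi> ` normalisers (F i) (DF i) \<subseteq> normalisers A D)))"

definition diag_dim :: "'h::chilbert_space op set \<Rightarrow> 'h op set \<Rightarrow> enat" where
  "diag_dim D A = Inf {enat d | d. diag_dim_le D A d}"

definition gen_diag_dim_le ::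
  "'h::chilbert_space op set \<Rightarrow> 'h op set \<Rightarrow> 'k::chilbert_space op set \<Rightarrow> nat \<Rightarrow> bool" where
  "gen_diag_dim_le D A B d \<longleftrightarrow> (\<forall>\<F> \<epsilon>. finite \<F> \<and> \<F> \<subseteq> A \<and> 0 < \<epsilon> \<longrightarrow>
    (\<exists>X E F DF \<psi> \<phi>.
      (\<forall>i\<le>d. finite (X i) \<and> equiv (X i) (E i) \<and>
        F i = block_alg (E i) \<and> DF i = block_alg (Id_on (X i))) \<and>
      (\<forall>i\<le>d. \<forall>j\<le>d. i \<noteq> j \<longrightarrow> X i \<inter> X j = {}) \<and>
      cp_map A (tensor_alg (dsum d F) B) \<psi> \<and> cp_map (tensor_alg (dsum d F) B) A \<phi> \<and>
      contractive_on A \<psi> \<and>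
      (\<forall>a\<in>\<F>. norm (\<phi> (\<psi> a) - a) < \<epsilon>) \<and>
      (\<forall>i\<le>d. contractive_on (tensor_alg (F i) B) \<phi> \<and> order_zero (tensor_alg (F i) B) A \<phi>) \<and>
      \<psi> ` D \<subseteq> tensor_alg (dsum d DF) B \<and>
      (\<forall>i\<le>d. \<phi> ` tensor_alg (DF i) B \<subseteq> normalisers A D \<and>
        (\<forall>v. matrix_unit (F i) (DF i) v \<longrightarrow> (\<forall>b\<in>B. \<phi> (tensor_op v b) \<in> normalisers A D))) \<and>
      (\<forall>i\<le>d. \<forall>\<pi> U v.
        supporting_hom (tensor_alg (F i) B) \<phi> \<pi> \<and> approx_unit U B \<and> min_projection (DF i) v \<longrightarrow>
        (\<exists>T\<in>commutant D. \<forall>\<xi>.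
          ((\<lambda>u. blinfun_apply (\<pi> (tensor_op v u)) \<xi>) \<longlongrightarrow> blinfun_apply T \<xi>) U))))"

definition gen_diag_dim ::
  "'h::chilbert_space op set \<Rightarrow> 'h op set \<Rightarrow> 'k::chilbert_space op set \<Rightarrow> enat" where
  "gen_diag_dim D A B = Inf {enat d | d. gen_diag_dim_le D A B d}"

end

theory Submission
  imports Defs
begin

text \<open>
  Over the complex numbers the tensor factor disappears: \<open>F \<otimes> \<complex>\<close> is \<open>F\<close>, and \<open>v \<otimes> c\<close> is \<open>c v\<close>
  (\<open>tensor_alg_complex\<close>, \<open>tensor_op_complex\<close>). Two differences between the dimensions remain. One
  uses arbitrary pairs of a finite-dimensional algebra and a maximal abelian subalgebra where the other
  uses block diagonal matrices and diagonal matrices; and one asks that \<open>\<phi>\<close> preserve all normalisers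
  where the other asks it only for matrix units, together with the condition that the supporting
  homomorphism \<open>\<pi>\<close> send the minimal diagonal projections into the commutant of \<open>D\<close>. For each \<open>d\<close>,
  approximations of the two kinds can be converted into each other.

  From matrix units to normalisers: a normaliser of the diagonal matrices has at most one nonzero entry in
  each row and column (\<open>normaliser_diagonal_row\<close>), so it is a combination of matrix units \<open>v\<close> with
  pairwise orthogonal sources and ranges. In \<open>\<phi> n x (\<phi> n)\<^sup>*\<close> the cross terms \<open>\<phi> v x (\<phi> w)\<^sup>*\<close> contain
  the factor \<open>\<pi> p x \<pi> q\<close> with orthogonal minimal projections \<open>p\<close>, \<open>q\<close>; as \<open>\<pi> p\<close> commutes with \<open>x\<close>,
  they vanish (\<open>orthogonal_supports\<close>), and the remaining terms lie in \<open>D\<close>. This argument needs one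
  supporting homomorphism to exist. For algebras spanned by projections it is constructed from the
  observation that an order zero map on a unital algebra preserves all zero products
  (\<open>zero_product\<close>). Idempotents can therefore be moved from one factor to the other in \<open>\<phi> x \<phi> y\<close>, which gives \<open>\<phi> a \<phi> b = h \<phi> (a b)\<close> with
  \<open>h = \<phi> 1\<close>; then \<open>\<pi> a = \<phi> a h\<^sup>-\<^sup>1\<close> makes sense by Douglas' factorisation lemma
  (\<open>supporting_hom_exists\<close>).

  From normalisers to matrix units: a pair \<open>M \<subseteq> G\<close> with \<open>M\<close> maximal abelian is isomorphic to diagonal
  matrices inside block diagonal matrices, by a unital map that is completely positive in both directions
  (locale \<open>matrix_model\<close>), so the approximation can be transported. The commutation condition is automatic:
  for a minimal diagonal projection \<open>p\<close>, nondegeneracy and the normaliser condition put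
  \<open>k = \<phi> p (\<phi> p)\<^sup>*\<close> into the abelian algebra \<open>D\<close>, hence \<open>k\<close> commutes with \<open>D\<close>, and so does its support
  projection, which is \<open>\<pi> p\<close> (\<open>supporting_hom_commutes\<close>).
\<close>

section \<open>Composition of operators\<close>

lemmas oL_add_left = bounded_bilinear.add_left[OF bounded_bilinear_blinfun_compose]
  and oL_add_right = bounded_bilinear.add_right[OF bounded_bilinear_blinfun_compose]
  and oL_diff_left = bounded_bilinear.diff_left[OF bounded_bilinear_blinfun_compose]
  and oL_diff_right = bounded_bilinear.diff_right[OF bounded_bilinear_blinfun_compose]
  and oL_sum_left = bounded_bilinear.sum_left[OF bounded_bilinear_blinfun_compose]
  and oL_sum_right = bounded_bilinear.sum_right[OF bounded_bilinear_blinfun_compose]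
  and tendsto_oL = bounded_bilinear.tendsto[OF bounded_bilinear_blinfun_compose]

lemma oL_assoc: "(a o\<^sub>L b) o\<^sub>L c = a o\<^sub>L (b o\<^sub>L c)"
  by (rule blinfun_eqI) simp

section \<open>Inner products\<close>

lemma cinner_add_right: "cinner x (y + z) = cinner x y + cinner x z" for x :: "'a::chilbert_space"
  by (metis cinner_commute cinner_add_left complex_cnj_add)

lemma scaleC_zero_left [simp]: "0 *\<^sub>C x = 0" for x :: "'a::chilbert_space"
  using scaleC_of_real[of 0 x] by simp

lemma scaleC_one [simp]: "1 *\<^sub>C x = x" for x :: "'a::chilbert_space"
  using scaleC_of_real[of 1 x] by simp

lemma scaleC_zero_right [simp]: "c *\<^sub>C 0 = 0" for c
  using bounded_linear_scaleC linear_0 bounded_linear.linear by blast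

lemma scaleC_minus_left: "(- c) *\<^sub>C x = - (c *\<^sub>C x)" for x :: "'a::chilbert_space"
  using scaleC_add_left[of "-c" c x] by (simp add: eq_neg_iff_add_eq_0)

lemma scaleC_minus1: "(-1) *\<^sub>C x = - x" for x :: "'a::chilbert_space"
  by (simp add: scaleC_minus_left)

lemma scaleC_diff_right: "c *\<^sub>C (x - y) = c *\<^sub>C x - c *\<^sub>C y" for x :: "'a::chilbert_space"
  by (rule linear_diff[OF bounded_linear.linear[OF bounded_linear_scaleC]])

lemma cinner_zero_left [simp]: "cinner 0 x = 0" for x :: "'a::chilbert_space"
  using cinner_scaleC_left[of 0 0 x] by simp

lemma cinner_zero_right [simp]: "cinner x 0 = 0" for x :: "'a::chilbert_space"
  using cinner_scaleC_right[of x 0 0] by simp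

lemma cinner_minus_left [simp]: "cinner (- x) y = - cinner x y" for x :: "'a::chilbert_space"
  using cinner_scaleC_left[of "-1" x y] by (simp add: scaleC_minus1)

lemma cinner_minus_right [simp]: "cinner x (- y) = - cinner x y" for x :: "'a::chilbert_space"
  using cinner_scaleC_right[of x "-1" y] by (simp add: scaleC_minus1)

lemma cinner_diff_left: "cinner (x - y) z = cinner x z - cinner y z" for x :: "'a::chilbert_space"
  using cinner_add_left[of x "- y" z] by simp

lemma cinner_diff_right: "cinner x (y - z) = cinner x y - cinner x z" for x :: "'a::chilbert_space"
  using cinner_add_right[of x y "- z"] by simp

lemma cinner_scaleR_left: "cinner (r *\<^sub>R x) y = of_real r * cinner x y" for x :: "'a::chilbert_space"
  by (metis scaleC_of_real cinner_scaleC_left)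

lemma cinner_scaleR_right: "cinner x (r *\<^sub>R y) = of_real r * cinner x y" for x :: "'a::chilbert_space"
  by (metis scaleC_of_real cinner_scaleC_right complex_cnj_complex_of_real)

lemma cinner_sum_left: "cinner (\<Sum>i\<in>I. f i) y = (\<Sum>i\<in>I. cinner (f i) (y :: 'a::chilbert_space))"
  by (induction I rule: infinite_finite_induct) (simp_all add: cinner_add_left)

lemma cinner_sum_right: "cinner y (\<Sum>i\<in>I. f i) = (\<Sum>i\<in>I. cinner (y :: 'a::chilbert_space) (f i))"
  by (induction I rule: infinite_finite_induct) (simp_all add: cinner_add_right)

lemma cinner_eq_zero_iff [simp]: "cinner x x = 0 \<longleftrightarrow> x = 0" for x :: "'a::chilbert_space"
  by (simp add: cinner_self)

lemma bounded_bilinear_cinner: "bounded_bilinear (cinner :: 'a::chilbert_space \<Rightarrow> 'a \<Rightarrow> complex)"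
  by (rule bounded_bilinear.intro)
    (auto simp: cinner_add_left cinner_add_right cinner_scaleR_left cinner_scaleR_right
      scaleR_conv_of_real intro!: exI[of _ 1] norm_cinner_le)

lemma cinner_extI:
  fixes x y :: "'a::chilbert_space"
  assumes "\<And>z. cinner z x = cinner z y"
  shows "x = y"
proof -
  have "cinner (x - y) (x - y) = 0"
    using assms by (simp add: cinner_diff_right)
  then show ?thesis by simp
qed

lemma op_eqI:
  assumes "\<And>\<xi> \<eta>. cinner \<xi> (blinfun_apply S \<eta>) = cinner \<xi> (blinfun_apply T \<eta> :: 'a::chilbert_space)"
  shows "S = T"
  by (rule blinfun_eqI, rule cinner_extI, rule assms)

lemma nonneg_Reals_complex_iff: "z \<in> \<real>\<^sub>\<ge>\<^sub>0 \<longleftrightarrow> 0 \<le> Re z \<and> Im z = 0" for z :: complex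
  by (auto simp: complex_nonneg_Reals_iff)

lemma cinner_self_nonneg: "cinner x x \<in> \<real>\<^sub>\<ge>\<^sub>0" for x :: "'a::chilbert_space"
  by (simp add: cinner_self)

lemma subspace_closure:
  assumes "subspace (V :: 'a::real_normed_vector set)"
  shows "subspace (closure V)"
  unfolding subspace_def
proof (intro conjI ballI allI)
  show "0 \<in> closure V" using closure_subset subspace_0[OF assms] by blast
next
  fix x y assume "x \<in> closure V" "y \<in> closure V"
  then obtain u v where "\<forall>n. u n \<in> V" "u \<longlonglongrightarrow> x" "\<forall>n. v n \<in> V" "v \<longlonglongrightarrow> y"
    unfolding closure_sequential by blast
  then have "\<forall>n. u n + v n \<in> V" "(\<lambda>n. u n + v n) \<longlonglongrightarrow> x + y"
    by (auto intro: tendsto_add subspace_add[OF assms])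
  then show "x + y \<in> closure V"
    unfolding closure_sequential by (intro exI[of _ "\<lambda>n. u n + v n"] conjI)
next
  fix r x assume "x \<in> closure V"
  then obtain u where "\<forall>n. u n \<in> V" "u \<longlonglongrightarrow> x"
    unfolding closure_sequential by blast
  then have "\<forall>n. r *\<^sub>R u n \<in> V" "(\<lambda>n. r *\<^sub>R u n) \<longlonglongrightarrow> r *\<^sub>R x"
    by (auto intro: tendsto_intros subspace_scale[OF assms])
  then show "r *\<^sub>R x \<in> closure V"
    unfolding closure_sequential by (intro exI[of _ "\<lambda>n. r *\<^sub>R u n"] conjI)
qed

section \<open>Riesz representation and adjoints\<close>

text \<open>The minimising sequences of \<open>\<parallel>x\<parallel>\<^sup>2 / 2 - f x\<close> on a subspace are Cauchy by the parallelogram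
  law, so completeness of the ambient space gives a representing vector in the closure, even if the
  subspace itself is not closed. Applied to the range of an operator this replaces orthogonal
  projections.\<close>

lemma riesz_on_subspace:
  fixes f :: "'a::{real_inner, complete_space} \<Rightarrow> real"
  assumes V: "subspace V"
    and add: "\<And>x y. x \<in> V \<Longrightarrow> y \<in> V \<Longrightarrow> f (x + y) = f x + f y"
    and scale: "\<And>r x. x \<in> V \<Longrightarrow> f (r *\<^sub>R x) = r * f x"
    and bound: "\<And>x. x \<in> V \<Longrightarrow> \<bar>f x\<bar> \<le> M * norm x"
  obtains y where "y \<in> closure V" "\<And>x. x \<in> V \<Longrightarrow> f x = inner x y"
proof -
  define J where "J x = (norm x)\<^sup>2 / 2 - f x" for x
  define m where "m = (INF x\<in>V. J x)"
  have V0: "0 \<in> V" using V by (rule subspace_0)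
  have J_lower: "- (M\<^sup>2 / 2) \<le> J x" if "x \<in> V" for x
  proof -
    have "f x \<le> M * norm x" using bound[OF that] by simp
    moreover have "0 \<le> (norm x - M)\<^sup>2" by simp
    ultimately show ?thesis by (simp add: J_def power2_diff) (simp add: algebra_simps)
  qed
  have bdd: "bdd_below (J ` V)"
    by (rule bdd_belowI2[OF J_lower])
  have m_le: "m \<le> J x" if "x \<in> V" for x
    unfolding m_def by (rule cINF_lower[OF bdd that])
  have "\<exists>x\<in>V. J x < m + 1 / Suc n" for n
  proof -
    have "m < m + 1 / Suc n" by simp
    then show ?thesis
      unfolding m_def using cINF_less_iff[of V J, OF _ bdd] V0 by blast
  qed
  then obtain u where u: "\<And>n. u n \<in> V" "\<And>n. J (u n) < m + 1 / Suc n" by metis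
  have mid: "(norm (x - y))\<^sup>2 \<le> 4 * (J x + J y - 2 * m)" if "x \<in> V" "y \<in> V" for x y
  proof -
    have "(1/2) *\<^sub>R (x + y) \<in> V" using that V by (simp add: subspace_add subspace_scale)
    then have "m \<le> J ((1/2) *\<^sub>R (x + y))" by (rule m_le)
    also have "\<dots> = (norm (x + y))\<^sup>2 / 8 - (f x + f y) / 2"
      using that V by (simp add: J_def add scale subspace_add power_divide)
    finally have "8 * m \<le> (norm (x + y))\<^sup>2 - 4 * (f x + f y)" by linarith
    moreover have "(norm (x + y))\<^sup>2 = 2 * (norm x)\<^sup>2 + 2 * (norm y)\<^sup>2 - (norm (x - y))\<^sup>2"
      by (simp add: power2_norm_eq_inner inner_add inner_diff inner_commute)
    ultimately show ?thesis
      by (simp add: J_def)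
  qed
  have "Cauchy u"
  proof (rule metric_CauchyI)
    fix e :: real assume e: "0 < e"
    obtain N where N: "8 / Suc N < e\<^sup>2"
    proof -
      obtain N where "inverse (real (Suc N)) < e\<^sup>2 / 8"
        using reals_Archimedean[of "e\<^sup>2 / 8"] e by auto
      then show ?thesis using that[of N] by (simp add: field_simps)
    qed
    have "dist (u i) (u j) < e" if "i \<ge> N" "j \<ge> N" for i j
    proof -
      have "1 / Suc i \<le> 1 / Suc N" "1 / Suc j \<le> 1 / Suc N"
        using that by (simp_all add: frac_le)
      then have "J (u i) + J (u j) - 2 * m < 2 / Suc N"
        using u(2)[of i] u(2)[of j] by simp
      then have "(norm (u i - u j))\<^sup>2 < e\<^sup>2"
        using mid[OF u(1)[of i] u(1)[of j]] N by simp
      then show ?thesis using e by (simp add: dist_norm power_less_imp_less_base)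
    qed
    then show "\<exists>N. \<forall>i\<ge>N. \<forall>j\<ge>N. dist (u i) (u j) < e" by blast
  qed
  then obtain y where y: "u \<longlonglongrightarrow> y"
    using Cauchy_convergent convergent_def by blast
  have "y \<in> closure V"
    using y u(1) closure_sequential by blast
  moreover have "f x = inner x y" if x: "x \<in> V" for x
  proof -
    \<comment> \<open>Vary the minimising sequence in the direction \<open>x\<close>.\<close>
    have var: "t * (f x - inner (u n) x) \<le> t\<^sup>2 * (norm x)\<^sup>2 / 2 + 1 / Suc n" for t n
    proof -
      have "m \<le> J (u n + t *\<^sub>R x)" using u(1) x V by (intro m_le subspace_add subspace_scale)
      also have "\<dots> = J (u n) + t * inner (u n) x + t\<^sup>2 * (norm x)\<^sup>2 / 2 - t * f x"
      proof -
        have "(norm (u n + t *\<^sub>R x))\<^sup>2 = (norm (u n))\<^sup>2 + 2 * (t * inner (u n) x) + t\<^sup>2 * (norm x)\<^sup>2"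
          unfolding power2_norm_eq_inner
          by (simp add: inner_add inner_commute power2_eq_square algebra_simps)
        then show ?thesis
          using u(1) x V by (simp add: J_def add scale subspace_scale add_divide_distrib)
      qed
      finally show ?thesis using u(2)[of n] by (simp add: algebra_simps)
    qed
    have lim: "t * (f x - inner y x) \<le> t\<^sup>2 * (norm x)\<^sup>2 / 2 + 0" for t
    proof (rule LIMSEQ_le)
      show "(\<lambda>n. t * (f x - inner (u n) x)) \<longlonglongrightarrow> t * (f x - inner y x)"
        by (intro tendsto_intros y)
      show "(\<lambda>n. t\<^sup>2 * (norm x)\<^sup>2 / 2 + 1 / Suc n) \<longlonglongrightarrow> t\<^sup>2 * (norm x)\<^sup>2 / 2 + 0"
        by (intro tendsto_intros LIMSEQ_Suc[OF lim_1_over_n])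
    qed (use var in blast)
    define w where "w = f x - inner y x"
    have "w = 0"
    proof (rule ccontr)
      assume "w \<noteq> 0"
      have xx: "0 < (norm x)\<^sup>2"
        using lim[of 1] lim[of "-1"] \<open>w \<noteq> 0\<close> by (cases "x = 0") (auto simp: w_def)
      define N where "N = (norm x)\<^sup>2"
      have "w / N * w \<le> (w / N)\<^sup>2 * N / 2"
        using lim[of "w / N"] by (simp add: w_def N_def)
      also have "\<dots> = w / N * w / 2"
        using xx by (simp add: N_def[symmetric] power2_eq_square)
      finally have "w / N * w \<le> w / N * w / 2" .
      moreover have "0 < w / N * w"
        using xx \<open>w \<noteq> 0\<close> by (simp add: N_def[symmetric] zero_less_divide_iff power2_eq_square[symmetric])
      moreover have "\<not> z \<le> z / 2" if "0 < z" for z :: real using that by simp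
      ultimately show False by blast
    qed
    then show ?thesis by (simp add: w_def inner_commute)
  qed
  ultimately show ?thesis by (rule that)
qed

lemma cinner_eq_inner: "cinner x y = Complex (inner x y) (inner ((-\<i>) *\<^sub>C x) y)"
  for x :: "'a::chilbert_space"
proof -
  have "Re (cinner ((-\<i>) *\<^sub>C x) y) = Im (cinner x y)"
    by (simp only: cinner_scaleC_left) simp
  then show ?thesis by (simp add: complex_eq_iff Re_cinner)
qed

lemma bops_scaleC: "T \<in> bops \<Longrightarrow> blinfun_apply T (c *\<^sub>C x) = c *\<^sub>C blinfun_apply T x"
  by (simp add: bops_def)

lemma op_scale_apply [simp]: "blinfun_apply (op_scale c T) x = c *\<^sub>C blinfun_apply T x"
  by transfer simp

text \<open>The imaginary part of a sesquilinear form is its real part at \<open>-\<i> \<xi>\<close>, so for complex linear maps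
  an identity of real inner products is an identity of complex ones.\<close>

lemma cinner_eqI_real:
  fixes f :: "'a::chilbert_space \<Rightarrow> 'b::chilbert_space"
  assumes "\<And>c \<xi>. f (c *\<^sub>C \<xi>) = c *\<^sub>C f \<xi>" "\<And>c \<xi>. g (c *\<^sub>C \<xi>) = c *\<^sub>C g \<xi>"
    and "\<And>\<xi>. inner (f \<xi>) \<eta> = inner (g \<xi>) \<zeta>"
  shows "cinner (f \<xi>) \<eta> = cinner (g \<xi>) (\<zeta> :: 'c::chilbert_space)"
  using assms by (simp only: cinner_eq_inner assms(1,2)[symmetric])

lemma blinfun_of_linear:
  fixes f :: "'a::real_normed_vector \<Rightarrow> 'b::real_normed_vector"
  assumes "\<And>x y. f (x + y) = f x + f y" "\<And>r x. f (r *\<^sub>R x) = r *\<^sub>R f x"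
    "\<And>x. norm (f x) \<le> M * norm x"
  obtains T where "\<And>x. blinfun_apply T x = f x"
proof -
  have "bounded_linear f"
    using assms by (intro bounded_linear_intro[where K = M]) (simp_all add: mult.commute)
  then show ?thesis using that[of "Blinfun f"] by (simp add: bounded_linear_Blinfun_apply)
qed

text \<open>Douglas' factorisation lemma. The adjoint of the factor is constructed first: for each \<open>\<eta>\<close> the
  functional \<open>h \<xi> \<mapsto> \<langle>T \<xi>, \<eta>\<rangle>\<close> on the range of \<open>h\<close> is bounded, hence represented by a unique vector of
  the closed range. The case \<open>h = id\<close> is the existence of adjoints.\<close>

lemma douglas_adjoint_factor:
  fixes h T :: "'h::chilbert_space op"
  assumes T: "T \<in> bops" and h: "h \<in> bops"
    and bound: "\<And>\<xi>. norm (blinfun_apply T \<xi>) \<le> M * norm (blinfun_apply h \<xi>)"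
  shows "\<exists>S\<in>bops.
    (\<forall>\<xi> \<eta>. cinner (blinfun_apply T \<xi>) \<eta> = cinner (blinfun_apply h \<xi>) (blinfun_apply S \<eta>)) \<and>
    (\<forall>\<eta>. blinfun_apply S \<eta> \<in> closure (range (blinfun_apply h)))"
proof -
  define R where "R = range (blinfun_apply h)"
  have R: "subspace R"
    unfolding R_def by (intro linear_subspace_image subspace_UNIV bounded_linear.linear
        blinfun.bounded_linear_right)
  have M: "norm (blinfun_apply T \<xi>) \<le> \<bar>M\<bar> * norm (blinfun_apply h \<xi>)" for \<xi>
    by (rule order_trans[OF bound]) (simp add: mult_right_mono)
  have ex: "\<exists>y\<in>closure R. \<forall>\<xi>. inner (blinfun_apply T \<xi>) \<eta> = inner (blinfun_apply h \<xi>) y" for \<eta>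
  proof -
    define g where "g x = (SOME \<xi>. blinfun_apply h \<xi> = x)" for x
    have hg: "blinfun_apply h (g x) = x" if "x \<in> R" for x
      using that unfolding g_def R_def by (metis (mono_tags) rangeE someI)
    have Teq: "blinfun_apply T \<xi> = blinfun_apply T \<xi>'" if "blinfun_apply h \<xi> = blinfun_apply h \<xi>'" for \<xi> \<xi>'
      using M[of "\<xi> - \<xi>'"] that by (simp add: blinfun.diff_right)
    define f where "f x = inner (blinfun_apply T (g x)) \<eta>" for x
    have f: "f (blinfun_apply h \<xi>) = inner (blinfun_apply T \<xi>) \<eta>" for \<xi>
      unfolding f_def using Teq[OF hg[of "blinfun_apply h \<xi>"]] by (simp add: R_def)
    obtain y where "y \<in> closure R" "\<And>x. x \<in> R \<Longrightarrow> f x = inner x y"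
    proof (rule riesz_on_subspace[OF R, of f "\<bar>M\<bar> * norm \<eta>"])
      fix x y assume "x \<in> R" "y \<in> R"
      then obtain \<xi> \<xi>' where "x = blinfun_apply h \<xi>" "y = blinfun_apply h \<xi>'" by (auto simp: R_def)
      then show "f (x + y) = f x + f y"
        by (simp add: f blinfun.add_right[symmetric]) (simp add: f blinfun.add_right inner_add_left)
    next
      fix r x assume "x \<in> R"
      then obtain \<xi> where "x = blinfun_apply h \<xi>" by (auto simp: R_def)
      then show "f (r *\<^sub>R x) = r * f x"
        by (simp add: f blinfun.scaleR_right[symmetric]) (simp add: f blinfun.scaleR_right)
    next
      fix x assume "x \<in> R"
      then obtain \<xi> where x: "x = blinfun_apply h \<xi>" by (auto simp: R_def)
      have "\<bar>f x\<bar> \<le> norm (blinfun_apply T \<xi>) * norm \<eta>"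
        unfolding x f by (rule Cauchy_Schwarz_ineq2)
      also have "\<dots> \<le> (\<bar>M\<bar> * norm x) * norm \<eta>"
        unfolding x by (intro mult_right_mono M) simp
      finally show "\<bar>f x\<bar> \<le> \<bar>M\<bar> * norm \<eta> * norm x" by (simp add: ac_simps)
    qed (rule that)
    then show ?thesis using f by (metis R_def rangeI)
  qed
  then obtain S where S: "\<And>\<eta>. S \<eta> \<in> closure R"
    "\<And>\<xi> \<eta>. inner (blinfun_apply T \<xi>) \<eta> = inner (blinfun_apply h \<xi>) (S \<eta>)" by metis
  have S_c: "cinner (blinfun_apply T \<xi>) \<eta> = cinner (blinfun_apply h \<xi>) (S \<eta>)" for \<xi> \<eta>
    by (rule cinner_eqI_real) (simp_all add: bops_scaleC T h S(2))
  have cR: "subspace (closure R)"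
    using R by (rule subspace_closure)
  have uniq: "y = z" if "y \<in> closure R" "z \<in> closure R"
    "\<And>\<xi>. cinner (blinfun_apply h \<xi>) y = cinner (blinfun_apply h \<xi>) z" for y z
  proof -
    have "y - z \<in> closure R" using cR that by (simp add: subspace_diff)
    then obtain x where x: "\<And>n. x n \<in> R" "x \<longlonglongrightarrow> y - z"
      unfolding closure_sequential by blast
    have "(\<lambda>n. cinner (x n) (y - z)) \<longlonglongrightarrow> cinner (y - z) (y - z)"
      by (intro bounded_bilinear.tendsto[OF bounded_bilinear_cinner] x(2) tendsto_const)
    moreover have "cinner (x n) (y - z) = 0" for n
      using x(1)[of n] that(3) by (auto simp: R_def cinner_diff_right)
    ultimately have "cinner (y - z) (y - z) = 0"
      by (simp add: LIMSEQ_const_iff)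
    then show ?thesis by simp
  qed
  have scaleC_closure: "c *\<^sub>C y \<in> closure R" if y: "y \<in> closure R" for c y
  proof -
    have R_scale: "c *\<^sub>C x \<in> R" if "x \<in> R" for x
      using that by (auto simp: R_def bops_scaleC[OF h, symmetric])
    obtain u where "\<forall>n. u n \<in> R" "u \<longlonglongrightarrow> y"
      using y unfolding closure_sequential by blast
    then have "\<forall>n. c *\<^sub>C u n \<in> R" "(\<lambda>n. c *\<^sub>C u n) \<longlonglongrightarrow> c *\<^sub>C y"
      by (auto intro: R_scale bounded_linear.tendsto[OF bounded_linear_scaleC])
    then show ?thesis
      unfolding closure_sequential by (intro exI[of _ "\<lambda>n. c *\<^sub>C u n"] conjI)
  qed
  have S_add: "S (x + y) = S x + S y" for x y
    by (rule uniq) (auto simp: S(1) subspace_add[OF cR] cinner_add_right S_c[symmetric])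
  have S_scale: "S (c *\<^sub>C x) = c *\<^sub>C S x" for c x
    by (rule uniq) (auto simp: S(1) scaleC_closure cinner_scaleC_right S_c[symmetric])
  have S_bound: "norm (S x) \<le> \<bar>M\<bar> * norm x" for x
  proof -
    have est: "inner y (S x) \<le> \<bar>M\<bar> * norm y * norm x" if yR: "y \<in> R" for y
    proof -
      obtain \<xi> where y: "y = blinfun_apply h \<xi>" using yR by (auto simp: R_def)
      have "inner y (S x) = inner (blinfun_apply T \<xi>) x" by (simp add: y S(2))
      also have "\<dots> \<le> norm (blinfun_apply T \<xi>) * norm x" by (rule norm_cauchy_schwarz)
      also have "\<dots> \<le> (\<bar>M\<bar> * norm y) * norm x"
        unfolding y by (intro mult_right_mono M) simp
      finally show ?thesis .
    qed
    obtain y where y: "\<And>n. y n \<in> R" "y \<longlonglongrightarrow> S x"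
      using S(1)[of x] unfolding closure_sequential by blast
    have "inner (S x) (S x) \<le> \<bar>M\<bar> * norm (S x) * norm x"
      by (rule LIMSEQ_le[of "\<lambda>n. inner (y n) (S x)" _ "\<lambda>n. \<bar>M\<bar> * norm (y n) * norm x"])
        (auto intro!: tendsto_intros y(2) est y(1))
    then have "norm (S x) * norm (S x) \<le> (\<bar>M\<bar> * norm x) * norm (S x)"
      by (simp add: power2_norm_eq_inner[symmetric] power2_eq_square ac_simps)
    then show ?thesis
      by (cases "S x = 0") (simp_all add: mult_le_cancel_right)
  qed
  obtain S' where S': "\<And>x. blinfun_apply S' x = S x"
  proof (rule blinfun_of_linear[of S])
    show "S (r *\<^sub>R x) = r *\<^sub>R S x" for r x
      by (simp only: scaleC_of_real[symmetric] S_scale)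
  qed (use S_add S_bound in auto)
  show ?thesis
  proof (intro bexI[of _ S'] conjI allI)
    show "S' \<in> bops" by (simp add: bops_def S' S_scale)
    show "cinner (blinfun_apply T \<xi>) \<eta> = cinner (blinfun_apply h \<xi>) (blinfun_apply S' \<eta>)" for \<xi> \<eta>
      by (simp add: S' S_c)
    show "blinfun_apply S' \<eta> \<in> closure (range (blinfun_apply h))" for \<eta>
      using S(1)[of \<eta>] by (simp add: S' R_def)
  qed
qed

lemma id_bops [simp]: "id_blinfun \<in> bops"
  by (simp add: bops_def)

lemma adj_works:
  assumes "T \<in> bops"
  shows "adj T \<in> bops" and cinner_adj_right: "cinner (blinfun_apply T \<xi>) \<eta> = cinner \<xi> (blinfun_apply (adj T) \<eta>)"
proof -
  have "norm (blinfun_apply T \<xi>) \<le> norm T * norm (blinfun_apply id_blinfun \<xi>)" for \<xi>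
    by (simp add: norm_blinfun)
  note bound = this
  obtain S where "S \<in> bops"
    "\<forall>\<xi> \<eta>. cinner (blinfun_apply T \<xi>) \<eta> = cinner (blinfun_apply id_blinfun \<xi>) (blinfun_apply S \<eta>)"
    using douglas_adjoint_factor[OF assms id_bops bound] by metis
  then have S: "S \<in> bops" "\<And>\<xi> \<eta>. cinner (blinfun_apply T \<xi>) \<eta> = cinner \<xi> (blinfun_apply S \<eta>)"
    by simp_all
  have "adj T = S"
    unfolding adj_def
  proof (rule the_equality)
    fix S' assume "\<forall>\<xi> \<eta>. cinner (blinfun_apply T \<xi>) \<eta> = cinner \<xi> (blinfun_apply S' \<eta>)"
    then show "S' = S" using S(2) by (metis op_eqI)
  qed (use S in blast)
  with S show "adj T \<in> bops" "cinner (blinfun_apply T \<xi>) \<eta> = cinner \<xi> (blinfun_apply (adj T) \<eta>)"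
    by auto
qed

lemmas adj_bops [simp] = adj_works(1)

lemma adjI:
  assumes "\<And>\<xi> \<eta>. cinner (blinfun_apply T \<xi>) \<eta> = cinner \<xi> (blinfun_apply S \<eta>)"
  shows "adj T = S"
  unfolding adj_def
proof (rule the_equality)
  fix S' assume "\<forall>\<xi> \<eta>. cinner (blinfun_apply T \<xi>) \<eta> = cinner \<xi> (blinfun_apply S' \<eta>)"
  then show "S' = S" using assms by (metis op_eqI)
qed (use assms in blast)

lemma cinner_adj_left:
  assumes "T \<in> bops"
  shows "cinner (blinfun_apply (adj T) \<xi>) \<eta> = cinner \<xi> (blinfun_apply T \<eta>)"
  by (metis cinner_adj_right[OF assms] cinner_commute)

lemma bops_zero [simp]: "0 \<in> bops" by (simp add: bops_def)
lemma bops_add [simp]: "S \<in> bops \<Longrightarrow> T \<in> bops \<Longrightarrow> S + T \<in> bops"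
  by (simp add: bops_def blinfun.add_left scaleC_add_right)
lemma bops_diff [simp]: "S \<in> bops \<Longrightarrow> T \<in> bops \<Longrightarrow> S - T \<in> bops"
  by (simp add: bops_def blinfun.diff_left scaleC_diff_right)
lemma bops_comp [simp]: "S \<in> bops \<Longrightarrow> T \<in> bops \<Longrightarrow> S o\<^sub>L T \<in> bops"
  by (simp add: bops_def)
lemma bops_scale [simp]: "T \<in> bops \<Longrightarrow> op_scale c T \<in> bops"
  by (simp add: bops_def scaleC_scaleC mult.commute)
lemma bops_sum [simp]: "(\<And>i. i \<in> I \<Longrightarrow> f i \<in> bops) \<Longrightarrow> (\<Sum>i\<in>I. f i) \<in> bops"
  by (induction I rule: infinite_finite_induct) auto

lemma closed_bops: "closed (bops :: 'h::chilbert_space op set)"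
proof -
  have "(bops :: 'h op set) = (\<Inter>c. \<Inter>\<xi>. {T. blinfun_apply T (c *\<^sub>C \<xi>) = c *\<^sub>C blinfun_apply T \<xi>})"
    by (auto simp: bops_def)
  also have "closed \<dots>"
    by (intro closed_INT ballI closed_Collect_eq bounded_linear.continuous_on[OF bounded_linear_scaleC]
        blinfun.continuous_on continuous_intros)
  finally show ?thesis .
qed

lemma adj_adj [simp]: "T \<in> bops \<Longrightarrow> adj (adj T) = T"
  by (intro adjI) (rule cinner_adj_left)
lemma adj_zero [simp]: "adj 0 = 0"
  by (intro adjI) simp
lemma adj_add: "S \<in> bops \<Longrightarrow> T \<in> bops \<Longrightarrow> adj (S + T) = adj S + adj T"
  by (intro adjI) (simp add: blinfun.add_left cinner_add_left cinner_add_right cinner_adj_right)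
lemma adj_diff: "S \<in> bops \<Longrightarrow> T \<in> bops \<Longrightarrow> adj (S - T) = adj S - adj T"
  by (intro adjI) (simp add: blinfun.diff_left cinner_diff_left cinner_diff_right cinner_adj_right)
lemma adj_comp: "S \<in> bops \<Longrightarrow> T \<in> bops \<Longrightarrow> adj (S o\<^sub>L T) = adj T o\<^sub>L adj S"
  by (intro adjI) (simp add: cinner_adj_right)
lemma adj_scale: "T \<in> bops \<Longrightarrow> adj (op_scale c T) = op_scale (cnj c) (adj T)"
  by (intro adjI) (simp add: cinner_adj_right cinner_scaleC_left cinner_scaleC_right)
lemma adj_sum: "(\<And>i. i \<in> I \<Longrightarrow> f i \<in> bops) \<Longrightarrow> adj (\<Sum>i\<in>I. f i) = (\<Sum>i\<in>I. adj (f i))"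
  by (induction I rule: infinite_finite_induct) (auto simp: adj_add)

lemma op_scale_comp_left [simp]: "op_scale c S o\<^sub>L T = op_scale c (S o\<^sub>L T)"
  by (rule blinfun_eqI) simp
lemma op_scale_comp_right [simp]: "S \<in> bops \<Longrightarrow> S o\<^sub>L op_scale c T = op_scale c (S o\<^sub>L T)"
  by (rule blinfun_eqI) (simp add: bops_scaleC)
lemma op_scale_scale [simp]: "op_scale c (op_scale d T) = op_scale (c * d) T"
  by (rule blinfun_eqI) (simp add: scaleC_scaleC)
lemma op_scale_one [simp]: "op_scale 1 T = T"
  by (rule blinfun_eqI) simp
lemma op_scale_zero [simp]: "op_scale 0 T = 0" "op_scale c 0 = 0"
  by (rule blinfun_eqI, simp)+
lemma op_scale_add_right: "op_scale c (S + T) = op_scale c S + op_scale c T"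
  by (rule blinfun_eqI) (simp add: blinfun.add_left scaleC_add_right)
lemma op_scale_add_left: "op_scale (c + d) T = op_scale c T + op_scale d T"
  by (rule blinfun_eqI) (simp add: blinfun.add_left scaleC_add_left)
lemma op_scale_minus_one: "op_scale (-1) T = - T"
  by (rule blinfun_eqI) (simp add: scaleC_minus1 blinfun.minus_left)
lemma op_scale_sum: "op_scale c (\<Sum>i\<in>I. f i) = (\<Sum>i\<in>I. op_scale c (f i))"
  by (induction I rule: infinite_finite_induct) (auto simp: op_scale_add_right)
lemma op_scale_of_real: "op_scale (complex_of_real r) T = r *\<^sub>R T"
  by (rule blinfun_eqI) (simp add: blinfun.scaleR_left scaleC_of_real)
lemma op_scale_eq_zero [simp]: "op_scale c T = 0 \<longleftrightarrow> c = 0 \<or> T = 0"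
  by (metis op_scale_one op_scale_scale op_scale_zero left_inverse)

lemma adj_comp_self_apply:
  "T \<in> bops \<Longrightarrow> cinner (blinfun_apply (adj T o\<^sub>L T) \<xi>) \<xi> = cinner (blinfun_apply T \<xi>) (blinfun_apply T \<xi>)"
  by (simp add: cinner_adj_left)

lemma adj_comp_self_zero:
  assumes "T \<in> bops" "adj T o\<^sub>L T = 0"
  shows "T = 0"
proof (rule blinfun_eqI)
  fix \<xi>
  show "blinfun_apply T \<xi> = blinfun_apply 0 \<xi>"
    using adj_comp_self_apply[OF assms(1), of \<xi>] assms(2) by simp
qed

lemma adj_eq_zero [simp]: "T \<in> bops \<Longrightarrow> adj T = 0 \<longleftrightarrow> T = 0"
  by (metis adj_adj adj_zero)

lemma comp_adj_self_zero:
  assumes "T \<in> bops" "T o\<^sub>L adj T = 0"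
  shows "T = 0"
  using adj_comp_self_zero[of "adj T"] assms by simp

text \<open>Replacing \<open>\<xi>\<close> by \<open>\<i> \<xi>\<close> turns the imaginary part of the sum into its real part, so that the two
  terms are forced to be complex conjugates of each other.\<close>

lemma adj_eqI_real_form:
  assumes S: "S \<in> bops" and T: "T \<in> bops"
    and real: "\<And>\<xi> \<eta>. Im (cinner (blinfun_apply T \<eta>) \<xi> + cinner (blinfun_apply S \<xi>) \<eta>) = 0"
  shows "adj T = S"
proof (rule adjI)
  fix \<eta> \<xi>
  have "Im (cinner (blinfun_apply T \<eta>) \<xi>) = - Im (cinner (blinfun_apply S \<xi>) \<eta>)"
    using real[of \<eta> \<xi>] by simp
  moreover have "Re (cinner (blinfun_apply T \<eta>) \<xi>) = Re (cinner (blinfun_apply S \<xi>) \<eta>)"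
    using real[of \<eta> "\<i> *\<^sub>C \<xi>"] by (simp add: bops_scaleC[OF S] cinner_scaleC_left cinner_scaleC_right)
  ultimately show "cinner (blinfun_apply T \<eta>) \<xi> = cinner \<eta> (blinfun_apply S \<xi>)"
    by (subst (2) cinner_commute) (simp add: complex_eq_iff)
qed

lemma pos_op_bops: "pos_op T \<Longrightarrow> T \<in> bops"
  by (simp add: pos_op_def)

lemma pos_op_adj:
  assumes "pos_op T"
  shows "adj T = T"
proof (rule adj_eqI_real_form)
  fix \<xi> \<eta>
  let ?q = "\<lambda>\<zeta>. cinner (blinfun_apply T \<zeta>) \<zeta>"
  have "Im (?q \<zeta>) = 0" for \<zeta>
    using assms by (simp add: pos_op_def nonneg_Reals_complex_iff)
  moreover have "?q (\<xi> + \<eta>) = ?q \<xi> + ?q \<eta> + (cinner (blinfun_apply T \<eta>) \<xi> + cinner (blinfun_apply T \<xi>) \<eta>)"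
    by (simp add: blinfun.add_right cinner_add_left cinner_add_right)
  ultimately show "Im (cinner (blinfun_apply T \<eta>) \<xi> + cinner (blinfun_apply T \<xi>) \<eta>) = 0"
    by (metis add.left_neutral plus_complex.sel(2))
qed (use assms pos_op_bops in auto)

lemma pos_op_adj_comp: "T \<in> bops \<Longrightarrow> pos_op (adj T o\<^sub>L T)"
  by (simp add: pos_op_def cinner_adj_left cinner_self_nonneg)

lemma pos_op_comp_adj: "T \<in> bops \<Longrightarrow> pos_op (T o\<^sub>L adj T)"
  using pos_op_adj_comp[of "adj T"] by simp

lemma projection_pos: "projection p \<Longrightarrow> pos_op p"
  unfolding projection_def using pos_op_adj_comp[of p] by simp

lemma projection_norm_le:
  assumes "projection p"
  shows "norm p \<le> 1"
proof (rule norm_blinfun_bound)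
  fix \<xi>
  have p: "p \<in> bops" "adj p = p" "p o\<^sub>L p = p" using assms by (auto simp: projection_def)
  have "(norm (blinfun_apply p \<xi>))\<^sup>2 = Re (cinner (blinfun_apply p \<xi>) (blinfun_apply p \<xi>))"
    by (simp add: cinner_self)
  also have "\<dots> = inner (blinfun_apply p \<xi>) \<xi>"
    using adj_comp_self_apply[OF p(1), of \<xi>] p Re_cinner by metis
  also have "\<dots> \<le> norm (blinfun_apply p \<xi>) * norm \<xi>" by (rule norm_cauchy_schwarz)
  finally show "norm (blinfun_apply p \<xi>) \<le> 1 * norm \<xi>"
    by (cases "blinfun_apply p \<xi> = 0") (simp_all add: power2_eq_square)
qed simp

text \<open>An operator on \<open>H\<close> is determined by its values on the range and on the kernel of a self-adjoint
  operator, because these subspaces are orthogonal with dense sum.\<close>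

lemma zero_on_range_and_kernel:
  assumes W: "W \<in> bops" and h: "h \<in> bops" "adj h = h"
    and range: "W o\<^sub>L h = 0"
    and ker: "\<And>\<xi>. blinfun_apply h \<xi> = 0 \<Longrightarrow> blinfun_apply W \<xi> = 0"
  shows "W = 0"
proof (rule comp_adj_self_zero[OF W], rule blinfun_eqI)
  fix \<eta>
  have "h o\<^sub>L adj W = 0"
    using adj_comp[OF W h(1)] h(2) range by simp
  then have "blinfun_apply h (blinfun_apply (adj W) \<eta>) = 0"
    by (metis blinfun_apply_blinfun_compose blinfun.zero_left)
  then show "blinfun_apply (W o\<^sub>L adj W) \<eta> = blinfun_apply 0 \<eta>"
    by (simp add: ker)
qed

lemma equal_on_range_and_kernel:
  assumes "V \<in> bops" "W \<in> bops" "h \<in> bops" "adj h = h" "V o\<^sub>L h = W o\<^sub>L h"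
    and "\<And>\<xi>. blinfun_apply h \<xi> = 0 \<Longrightarrow> blinfun_apply V \<xi> = 0"
    and "\<And>\<xi>. blinfun_apply h \<xi> = 0 \<Longrightarrow> blinfun_apply W \<xi> = 0"
  shows "V = W"
  using zero_on_range_and_kernel[of "V - W" h] assms by (simp add: oL_diff_left blinfun.diff_left)

lemma douglas_factor:
  assumes T: "T \<in> bops" and h: "h \<in> bops" "adj h = h"
    and bound: "\<And>\<xi>. norm (blinfun_apply T \<xi>) \<le> M * norm (blinfun_apply h \<xi>)"
  shows "\<exists>Z. Z \<in> bops \<and> Z o\<^sub>L h = T \<and> (\<forall>\<xi>. blinfun_apply h \<xi> = 0 \<longrightarrow> blinfun_apply Z \<xi> = 0)"
proof -
  obtain S where S: "S \<in> bops"
    "\<And>\<xi> \<eta>. cinner (blinfun_apply T \<xi>) \<eta> = cinner (blinfun_apply h \<xi>) (blinfun_apply S \<eta>)"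
    "\<And>\<eta>. blinfun_apply S \<eta> \<in> closure (range (blinfun_apply h))"
    using douglas_adjoint_factor[OF T h(1) bound] by metis
  show ?thesis
  proof (intro exI[of _ "adj S"] conjI allI impI)
    show "adj S \<in> bops" using S by simp
    have "cinner \<eta> (blinfun_apply (adj S o\<^sub>L h) \<xi>) = cinner \<eta> (blinfun_apply T \<xi>)" for \<xi> \<eta>
    proof -
      have "cinner \<eta> (blinfun_apply (adj S o\<^sub>L h) \<xi>) = cnj (cinner (blinfun_apply h \<xi>) (blinfun_apply S \<eta>))"
        by (simp add: cinner_adj_right[OF S(1), symmetric] cinner_commute[symmetric])
      also have "\<dots> = cinner \<eta> (blinfun_apply T \<xi>)"
        by (simp add: S(2)[symmetric] cinner_commute[symmetric])
      finally show ?thesis .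
    qed
    then show "adj S o\<^sub>L h = T" by (rule op_eqI)
    fix \<xi> assume \<xi>: "blinfun_apply h \<xi> = 0"
    have "cinner \<eta> (blinfun_apply (adj S) \<xi>) = 0" for \<eta>
    proof -
      obtain x where x: "\<And>n. x n \<in> range (blinfun_apply h)" "x \<longlonglongrightarrow> blinfun_apply S \<eta>"
        using S(3)[of \<eta>] unfolding closure_sequential by blast
      have "(\<lambda>n. cinner (x n) \<xi>) \<longlonglongrightarrow> cinner (blinfun_apply S \<eta>) \<xi>"
        by (intro bounded_bilinear.tendsto[OF bounded_bilinear_cinner] x(2) tendsto_const)
      moreover have "cinner (x n) \<xi> = 0" for n
        using x(1)[of n] cinner_adj_right[OF h(1)] h(2) \<xi> by auto
      ultimately show ?thesis
        by (simp add: LIMSEQ_const_iff cinner_adj_right[OF S(1)])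
    qed
    then have "cinner (blinfun_apply (adj S) \<xi>) (blinfun_apply (adj S) \<xi>) = 0" by blast
    then show "blinfun_apply (adj S) \<xi> = 0" by simp
  qed
qed

section \<open>Star algebras\<close>

lemma star_algebraD:
  assumes "star_algebra A"
  shows "a \<in> A \<Longrightarrow> a \<in> bops" "0 \<in> A" "a \<in> A \<Longrightarrow> b \<in> A \<Longrightarrow> a + b \<in> A"
    "a \<in> A \<Longrightarrow> b \<in> A \<Longrightarrow> a o\<^sub>L b \<in> A" "a \<in> A \<Longrightarrow> adj a \<in> A" "a \<in> A \<Longrightarrow> op_scale c a \<in> A"
  using assms by (auto simp: star_algebra_def)

lemma star_algebra_diff: "star_algebra A \<Longrightarrow> a \<in> A \<Longrightarrow> b \<in> A \<Longrightarrow> a - b \<in> A"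
  using star_algebraD(3)[of A a "op_scale (-1) b"] star_algebraD(6)[of A b "-1"]
  by (simp add: op_scale_minus_one)

lemma star_algebra_sum:
  assumes "star_algebra A" "\<And>i. i \<in> I \<Longrightarrow> f i \<in> A"
  shows "(\<Sum>i\<in>I. f i) \<in> A"
  using assms(2) by (induction I rule: infinite_finite_induct) (auto intro: star_algebraD[OF assms(1)])

lemma cstar_algebra_bops: "cstar_algebra bops"
  by (simp add: cstar_algebra_def star_algebra_def closed_bops)

lemma cstar_generated_cstar_algebra:
  assumes "S \<subseteq> bops"
  shows "cstar_algebra (cstar_generated S)"
proof -
  have "cstar_generated S \<subseteq> bops"
    using assms cstar_algebra_bops by (auto simp: cstar_generated_def)
  moreover have "closed (cstar_generated S)"
    unfolding cstar_generated_def by (intro closed_Inter) (auto simp: cstar_algebra_def)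
  ultimately show ?thesis
    by (simp add: cstar_algebra_def star_algebra_def) (auto simp: cstar_generated_def cstar_algebra_def star_algebra_def)
qed

lemma cstar_generated_superset: "S \<subseteq> cstar_generated S"
  by (auto simp: cstar_generated_def)

lemma cstar_generated_least: "cstar_algebra C \<Longrightarrow> S \<subseteq> C \<Longrightarrow> cstar_generated S \<subseteq> C"
  by (auto simp: cstar_generated_def)

definition csubspace :: "'h::chilbert_space op set \<Rightarrow> bool" where
  "csubspace V \<longleftrightarrow> 0 \<in> V \<and> (\<forall>a\<in>V. \<forall>b\<in>V. a + b \<in> V) \<and> (\<forall>a\<in>V. \<forall>c. op_scale c a \<in> V)"

lemma csubspaceD:
  assumes "csubspace V"
  shows "0 \<in> V" "a \<in> V \<Longrightarrow> b \<in> V \<Longrightarrow> a + b \<in> V" "a \<in> V \<Longrightarrow> op_scale c a \<in> V"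
    "a \<in> V \<Longrightarrow> b \<in> V \<Longrightarrow> a - b \<in> V"
  using assms unfolding csubspace_def
  by (auto simp: op_scale_minus_one[symmetric] diff_conv_add_uminus simp del: add_uminus_conv_diff)

lemma csubspace_sum: "csubspace V \<Longrightarrow> (\<And>i. i \<in> I \<Longrightarrow> f i \<in> V) \<Longrightarrow> (\<Sum>i\<in>I. f i) \<in> V"
  by (induction I rule: infinite_finite_induct) (auto intro: csubspaceD)

lemma star_algebra_csubspace: "star_algebra A \<Longrightarrow> csubspace A"
  by (simp add: star_algebra_def csubspace_def)

definition spanned_by_projections :: "'h::chilbert_space op set \<Rightarrow> bool" where
  "spanned_by_projections A \<longleftrightarrow> (\<forall>V. csubspace V \<and> {p \<in> A. projection p} \<subseteq> V \<longrightarrow> A \<subseteq> V)"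

lemma spanned_by_projections_induct:
  assumes "spanned_by_projections A" "a \<in> A"
    and "P 0" "\<And>p. p \<in> A \<Longrightarrow> projection p \<Longrightarrow> P p"
    and "\<And>a b. P a \<Longrightarrow> P b \<Longrightarrow> P (a + b)" "\<And>a c. P a \<Longrightarrow> P (op_scale c a)"
  shows "P a"
proof -
  have "csubspace (Collect P)" using assms by (simp add: csubspace_def)
  moreover have "{p \<in> A. projection p} \<subseteq> Collect P" using assms by blast
  ultimately show ?thesis using assms(1,2) unfolding spanned_by_projections_def by blast
qed

section \<open>Completely positive maps on unital algebras\<close>

lemma cp_mapD:
  assumes "cp_map A B \<phi>" "\<And>i j. i < n \<Longrightarrow> j < n \<Longrightarrow> a i j \<in> A" "pos_matrix n a"
  shows "pos_matrix n (\<lambda>i j. \<phi> (a i j))"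
  using assms by (simp add: cp_map_def)

lemma cp_two_by_two:
  assumes cp: "cp_map A B \<phi>" and abcd: "a \<in> A" "b \<in> A" "c \<in> A" "d \<in> A"
    and pos: "\<And>\<xi> \<eta>. cinner (blinfun_apply a \<xi>) \<xi> + cinner (blinfun_apply b \<eta>) \<xi> +
      (cinner (blinfun_apply c \<xi>) \<eta> + cinner (blinfun_apply d \<eta>) \<eta>) \<in> \<real>\<^sub>\<ge>\<^sub>0"
  shows "cinner (blinfun_apply (\<phi> a) \<xi>) \<xi> + cinner (blinfun_apply (\<phi> b) \<eta>) \<xi> +
      (cinner (blinfun_apply (\<phi> c) \<xi>) \<eta> + cinner (blinfun_apply (\<phi> d) \<eta>) \<eta>) \<in> \<real>\<^sub>\<ge>\<^sub>0"
proof -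
  define m where "m i j = (if i = 0 then if j = 0 then a else b else if j = (0::nat) then c else d)"
    for i j :: nat
  have "pos_matrix 2 m"
    unfolding pos_matrix_def using pos by (simp add: numeral_2_eq_2 m_def)
  then have "pos_matrix 2 (\<lambda>i j. \<phi> (m i j))"
    by (rule cp_mapD[OF cp, rotated]) (simp add: m_def abcd)
  then have "(\<Sum>i<2. \<Sum>j<2. cinner (blinfun_apply (\<phi> (m i j)) ((if j = 0 then \<xi> else \<eta>)))
      (if i = 0 then \<xi> else \<eta>)) \<in> \<real>\<^sub>\<ge>\<^sub>0"
    unfolding pos_matrix_def by (rule allE[of _ "\<lambda>j::nat. if j = 0 then \<xi> else \<eta>"])
  then show ?thesis by (simp add: numeral_2_eq_2 m_def)
qed

lemma cp_pos_op:
  assumes cp: "cp_map A B \<phi>" and a: "a \<in> A" "pos_op a" and B: "B \<subseteq> bops"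
  shows "pos_op (\<phi> a)"
proof -
  have "pos_matrix 1 (\<lambda>_ _. a)" using a(2) by (simp add: pos_matrix_def pos_op_def)
  then have "pos_matrix 1 (\<lambda>_ _. \<phi> a)"
    by (rule cp_mapD[OF cp a(1)])
  then have "cinner (blinfun_apply (\<phi> a) \<xi>) \<xi> \<in> \<real>\<^sub>\<ge>\<^sub>0" for \<xi>
    unfolding pos_matrix_def by (elim allE[of _ "\<lambda>_. \<xi>"]) simp
  moreover have "\<phi> a \<in> bops" using cp a(1) B by (auto simp: cp_map_def)
  ultimately show ?thesis by (simp add: pos_op_def)
qed

lemma op_linear_onD:
  assumes "op_linear_on A \<phi>"
  shows "a \<in> A \<Longrightarrow> b \<in> A \<Longrightarrow> \<phi> (a + b) = \<phi> a + \<phi> b" "a \<in> A \<Longrightarrow> \<phi> (op_scale c a) = op_scale c (\<phi> a)"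
  using assms by (auto simp: op_linear_on_def)

lemma op_linear_on_zero: "op_linear_on A \<phi> \<Longrightarrow> 0 \<in> A \<Longrightarrow> \<phi> 0 = 0"
  using op_linear_onD(2)[of A \<phi> 0 0] by simp

lemma op_linear_on_diff:
  assumes "op_linear_on A \<phi>" "csubspace A" "a \<in> A" "b \<in> A"
  shows "\<phi> (a - b) = \<phi> a - \<phi> b"
  using op_linear_onD(1)[OF assms(1,3) csubspaceD(3)[OF assms(2,4), of "-1"]]
    op_linear_onD(2)[OF assms(1,4), of "-1"]
  by (simp add: op_scale_minus_one)

lemma op_linear_on_sum:
  assumes "op_linear_on A \<phi>" "csubspace A" "\<And>i. i \<in> I \<Longrightarrow> f i \<in> A"
  shows "\<phi> (\<Sum>i\<in>I. f i) = (\<Sum>i\<in>I. \<phi> (f i))"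
  using assms(3)
proof (induction I rule: infinite_finite_induct)
  case (insert x I)
  then show ?case
    using op_linear_onD(1)[OF assms(1), of "f x" "\<Sum>i\<in>I. f i"] csubspace_sum[OF assms(2), of I f]
    by simp
qed (use op_linear_on_zero[OF assms(1)] csubspaceD(1)[OF assms(2)] in simp_all)

lemma cinner_op_bound: "Re (cinner (blinfun_apply T \<xi>) \<xi>) \<le> norm T * (norm \<xi>)\<^sup>2"
proof -
  have "Re (cinner (blinfun_apply T \<xi>) \<xi>) \<le> cmod (cinner (blinfun_apply T \<xi>) \<xi>)"
    by (rule complex_Re_le_cmod)
  also have "\<dots> \<le> norm (blinfun_apply T \<xi>) * norm \<xi>" by (rule norm_cinner_le)
  also have "\<dots> \<le> (norm T * norm \<xi>) * norm \<xi>" by (intro mult_right_mono norm_blinfun) simp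
  finally show ?thesis by (simp add: power2_eq_square)
qed

locale unital_cp_map =
  fixes F :: "'h::chilbert_space op set" and B :: "'k::chilbert_space op set" and \<phi> e
  assumes star: "star_algebra F"
    and unit: "e \<in> F" "\<And>a. a \<in> F \<Longrightarrow> e o\<^sub>L a = a" "\<And>a. a \<in> F \<Longrightarrow> a o\<^sub>L e = a"
    and cp: "cp_map F B \<phi>" and B_bops: "B \<subseteq> bops"
begin

lemmas in_bops = star_algebraD(1)[OF star]

lemma linear: "op_linear_on F \<phi>"
  using cp by (simp add: cp_map_def)

lemma image_bops: "a \<in> F \<Longrightarrow> \<phi> a \<in> bops"
  using cp B_bops by (auto simp: cp_map_def)

lemma unit_projection: "projection e"
proof -
  have "adj e o\<^sub>L e = adj e" using unit(3) star_algebraD(5)[OF star unit(1)] by blast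
  moreover from this have "adj e o\<^sub>L e = e"
    by (metis adj_adj adj_comp in_bops[OF unit(1)] adj_bops)
  ultimately show ?thesis
    using unit(2)[OF unit(1)] in_bops[OF unit(1)] by (simp add: projection_def)
qed

lemma unit_adj: "adj e = e"
  using unit_projection by (simp add: projection_def)

text \<open>The form of the matrix with rows \<open>(r e, a)\<close> and \<open>(a\<^sup>*, r e)\<close> is bounded below by
  \<open>r (\<parallel>e \<xi>\<parallel> - \<parallel>e \<eta>\<parallel>)\<^sup>2\<close>; complete positivity transfers this to \<open>\<phi>\<close>.\<close>

lemma form_pos:
  assumes a: "a \<in> F" and r: "norm a \<le> r"
  shows "of_real r * cinner (blinfun_apply (\<phi> e) \<xi>) \<xi> + cinner (blinfun_apply (\<phi> a) \<eta>) \<xi> +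
    (cinner (blinfun_apply (\<phi> (adj a)) \<xi>) \<eta> + of_real r * cinner (blinfun_apply (\<phi> e) \<eta>) \<eta>) \<in> \<real>\<^sub>\<ge>\<^sub>0"
proof -
  have r0: "0 \<le> r" using r norm_ge_zero order_trans by blast
  have *: "cinner (blinfun_apply (\<phi> (op_scale (of_real r) e)) \<xi>) \<xi> + cinner (blinfun_apply (\<phi> a) \<eta>) \<xi> +
    (cinner (blinfun_apply (\<phi> (adj a)) \<xi>) \<eta> + cinner (blinfun_apply (\<phi> (op_scale (of_real r) e)) \<eta>) \<eta>) \<in> \<real>\<^sub>\<ge>\<^sub>0"
  proof (rule cp_two_by_two[OF cp])
    fix \<xi> \<eta>
    have ee: "cinner (blinfun_apply e \<zeta>) \<zeta> = of_real ((norm (blinfun_apply e \<zeta>))\<^sup>2)" for \<zeta>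
      using adj_comp_self_apply[OF in_bops[OF unit(1)], of \<zeta>] unit_adj unit(2)[OF unit(1)]
      by (simp add: cinner_self)
    define s where "s = cinner (blinfun_apply a \<eta>) \<xi>"
    have s2: "cinner (blinfun_apply (adj a) \<xi>) \<eta> = cnj s"
      by (simp add: s_def cinner_adj_left[OF in_bops[OF a]] cinner_commute[symmetric])
    have "s = cinner (blinfun_apply a (blinfun_apply e \<eta>)) (blinfun_apply e \<xi>)"
    proof -
      have "s = cinner (blinfun_apply e (blinfun_apply a (blinfun_apply e \<eta>))) \<xi>"
        unfolding s_def using unit(2,3)[OF a] by (metis blinfun_apply_blinfun_compose)
      then show ?thesis using cinner_adj_right[OF in_bops[OF unit(1)]] unit_adj by simp
    qed
    then have "cmod s \<le> norm (blinfun_apply a (blinfun_apply e \<eta>)) * norm (blinfun_apply e \<xi>)"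
      by (simp add: norm_cinner_le)
    also have "\<dots> \<le> (r * norm (blinfun_apply e \<eta>)) * norm (blinfun_apply e \<xi>)"
      by (intro mult_right_mono order_trans[OF norm_blinfun] r) simp_all
    also have "\<dots> \<le> r * (((norm (blinfun_apply e \<eta>))\<^sup>2 + (norm (blinfun_apply e \<xi>))\<^sup>2) / 2)"
      using sum_squares_bound[of "norm (blinfun_apply e \<eta>)" "norm (blinfun_apply e \<xi>)"] r0
      by (simp add: mult.assoc mult_left_mono)
    finally have "- (2 * Re s) \<le> r * ((norm (blinfun_apply e \<eta>))\<^sup>2 + (norm (blinfun_apply e \<xi>))\<^sup>2)"
      using abs_Re_le_cmod[of s] by simp
    then show "cinner (blinfun_apply (op_scale (of_real r) e) \<xi>) \<xi> + cinner (blinfun_apply a \<eta>) \<xi> +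
      (cinner (blinfun_apply (adj a) \<xi>) \<eta> + cinner (blinfun_apply (op_scale (of_real r) e) \<eta>) \<eta>) \<in> \<real>\<^sub>\<ge>\<^sub>0"
      by (simp add: s2 s_def[symmetric] cinner_scaleC_left ee nonneg_Reals_complex_iff algebra_simps)
  qed (use a star_algebraD[OF star] unit in auto)
  then show ?thesis
    by (simp add: op_linear_onD(2)[OF linear unit(1)] cinner_scaleC_left)
qed

text \<open>The form in \<open>form_pos\<close> is in particular real.\<close>

lemma map_adj:
  assumes "a \<in> F"
  shows "\<phi> (adj a) = adj (\<phi> a)"
proof (rule sym, rule adj_eqI_real_form)
  have h: "pos_op (\<phi> e)"
    using cp_pos_op[OF cp unit(1) projection_pos[OF unit_projection] B_bops] .
  fix \<xi> \<eta>
  show "Im (cinner (blinfun_apply (\<phi> a) \<eta>) \<xi> + cinner (blinfun_apply (\<phi> (adj a)) \<xi>) \<eta>) = 0"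
    using form_pos[OF assms order_refl, of \<xi> \<eta>] h
    by (simp add: pos_op_def nonneg_Reals_complex_iff)
qed (use assms star_algebraD[OF star] in \<open>auto intro: image_bops\<close>)

text \<open>Insert \<open>\<xi> = - t \<phi> a \<eta>\<close> into \<open>form_pos\<close> and choose the best \<open>t\<close>.\<close>

lemma norm_le_unit:
  assumes a: "a \<in> F"
  shows "norm (\<phi> a) \<le> norm a * norm (\<phi> e)"
proof (rule norm_blinfun_bound)
  fix \<eta>
  define w where "w = blinfun_apply (\<phi> a) \<eta>"
  define k where "k = norm a * norm (\<phi> e)"
  define W where "W = (norm w)\<^sup>2"
  have k0: "0 \<le> k" by (simp add: k_def)
  have ineq: "2 * (t * W) \<le> k * (t\<^sup>2 * W + (norm \<eta>)\<^sup>2)" for t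
  proof -
    define \<xi> where "\<xi> = (- t) *\<^sub>R w"
    have "Re (cinner (blinfun_apply (\<phi> (adj a)) \<xi>) \<eta>) = Re (cinner w \<xi>)"
      using image_bops[OF a] by (simp add: map_adj[OF a] cinner_adj_left w_def Re_cinner inner_commute)
    moreover have "Re (cinner w \<xi>) = - t * W"
      by (simp add: \<xi>_def Re_cinner W_def power2_norm_eq_inner)
    moreover have "norm a * Re (cinner (blinfun_apply (\<phi> e) \<zeta>) \<zeta>) \<le> k * (norm \<zeta>)\<^sup>2" for \<zeta>
      using mult_left_mono[OF cinner_op_bound[of "\<phi> e" \<zeta>] norm_ge_zero[of a]] by (simp add: k_def mult.assoc)
    from this[of \<xi>] this[of \<eta>]
    have "norm a * Re (cinner (blinfun_apply (\<phi> e) \<xi>) \<xi>) \<le> k * (t\<^sup>2 * W)"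
      "norm a * Re (cinner (blinfun_apply (\<phi> e) \<eta>) \<eta>) \<le> k * (norm \<eta>)\<^sup>2"
      by (simp_all add: \<xi>_def W_def power_mult_distrib)
    moreover have "0 \<le> norm a * Re (cinner (blinfun_apply (\<phi> e) \<xi>) \<xi>) + Re (cinner w \<xi>) +
      (Re (cinner (blinfun_apply (\<phi> (adj a)) \<xi>) \<eta>) + norm a * Re (cinner (blinfun_apply (\<phi> e) \<eta>) \<eta>))"
      using form_pos[OF a order_refl, of \<xi> \<eta>] by (simp add: nonneg_Reals_complex_iff w_def)
    ultimately show ?thesis by (simp add: distrib_left mult.commute[of W t])
  qed
  have "W \<le> (k * norm \<eta>)\<^sup>2"
  proof (cases "k = 0")
    case False
    then have "k > 0" using k0 by simp
    have "2 * (1 / k * W) \<le> k * ((1 / k)\<^sup>2 * W + (norm \<eta>)\<^sup>2)" by (rule ineq)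
    also have "\<dots> = 1 / k * W + k * (norm \<eta>)\<^sup>2"
      using \<open>k > 0\<close> by (simp add: power2_eq_square field_simps)
    finally have "1 / k * W \<le> k * (norm \<eta>)\<^sup>2" by linarith
    then show ?thesis using \<open>k > 0\<close> by (simp add: field_simps power2_eq_square)
  qed (use ineq[of 1] in simp)
  then show "norm (blinfun_apply (\<phi> a) \<eta>) \<le> norm a * norm (\<phi> e) * norm \<eta>"
    unfolding W_def w_def k_def by (rule power2_le_imp_le) simp
qed simp

text \<open>A degenerate Cauchy--Schwarz inequality: the matrix with rows \<open>(e, x)\<close> and \<open>(x\<^sup>*, x\<^sup>* x)\<close> is
  positive, so a zero of the quadratic form of \<open>\<phi> (x\<^sup>* x)\<close> is a zero of \<open>\<phi> x\<close>.\<close>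

lemma kernel_adj_comp:
  assumes x: "x \<in> F" and zero: "blinfun_apply (\<phi> (adj x o\<^sub>L x)) \<eta> = 0"
  shows "blinfun_apply (\<phi> x) \<eta> = 0"
proof -
  define w where "w = blinfun_apply (\<phi> x) \<eta>"
  define C where "C = Re (cinner (blinfun_apply (\<phi> e) w) w)"
  define W where "W = (norm w)\<^sup>2"
  have xb: "x \<in> bops" "adj x \<in> F" "adj x o\<^sub>L x \<in> F"
    using x star_algebraD[OF star] by auto
  have form: "cinner (blinfun_apply (\<phi> e) \<xi>) \<xi> + cinner (blinfun_apply (\<phi> x) \<eta>) \<xi> +
    (cinner (blinfun_apply (\<phi> (adj x)) \<xi>) \<eta> + cinner (blinfun_apply (\<phi> (adj x o\<^sub>L x)) \<eta>) \<eta>) \<in> \<real>\<^sub>\<ge>\<^sub>0" for \<xi>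
  proof (rule cp_two_by_two[OF cp unit(1) x xb(2,3)])
    fix \<xi> \<eta>
    have "cinner (blinfun_apply e \<xi>) \<xi> = cinner (blinfun_apply e \<xi>) (blinfun_apply e \<xi>)"
      using adj_comp_self_apply[OF in_bops[OF unit(1)], of \<xi>] unit_adj unit(2)[OF unit(1)] by simp
    moreover have "cinner (blinfun_apply x \<eta>) \<xi> = cinner (blinfun_apply x \<eta>) (blinfun_apply e \<xi>)"
      using cinner_adj_right[OF in_bops[OF unit(1)], of "blinfun_apply x \<eta>" \<xi>] unit_adj unit(2)[OF x]
      by (metis blinfun_apply_blinfun_compose)
    moreover have "cinner (blinfun_apply (adj x) \<xi>) \<eta> = cinner (blinfun_apply e \<xi>) (blinfun_apply x \<eta>)"
      using cinner_adj_left[OF xb(1)] unit(3)[OF xb(2)] by (metis blinfun_apply_blinfun_compose)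
    ultimately have "cinner (blinfun_apply e \<xi>) \<xi> + cinner (blinfun_apply x \<eta>) \<xi> +
        (cinner (blinfun_apply (adj x) \<xi>) \<eta> + cinner (blinfun_apply (adj x o\<^sub>L x) \<eta>) \<eta>)
      = cinner (blinfun_apply e \<xi> + blinfun_apply x \<eta>) (blinfun_apply e \<xi> + blinfun_apply x \<eta>)"
      by (simp add: cinner_add_left cinner_add_right cinner_adj_left[OF xb(1)])
    then show "cinner (blinfun_apply e \<xi>) \<xi> + cinner (blinfun_apply x \<eta>) \<xi> +
        (cinner (blinfun_apply (adj x) \<xi>) \<eta> + cinner (blinfun_apply (adj x o\<^sub>L x) \<eta>) \<eta>) \<in> \<real>\<^sub>\<ge>\<^sub>0"
      by (simp only: cinner_self_nonneg)
  qed
  have C0: "0 \<le> C"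
    using cp_pos_op[OF cp unit(1) projection_pos[OF unit_projection] B_bops]
    by (simp add: C_def pos_op_def nonneg_Reals_complex_iff)
  have ineq: "2 * t * W \<le> t\<^sup>2 * C" for t
  proof -
    define \<xi> where "\<xi> = (- t) *\<^sub>R w"
    have "Re (cinner (blinfun_apply (\<phi> (adj x)) \<xi>) \<eta>) = Re (cinner w \<xi>)"
      using image_bops[OF x] by (simp add: map_adj[OF x] cinner_adj_left w_def Re_cinner inner_commute)
    moreover have "Re (cinner w \<xi>) = - t * W"
      by (simp add: \<xi>_def Re_cinner W_def power2_norm_eq_inner)
    moreover have "Re (cinner (blinfun_apply (\<phi> e) \<xi>) \<xi>) = t\<^sup>2 * C"
      by (simp add: \<xi>_def C_def Re_cinner blinfun.scaleR_right blinfun.minus_right power2_eq_square)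
    ultimately show ?thesis
      using form[of \<xi>] zero
      by (simp add: nonneg_Reals_complex_iff w_def[symmetric] mult.commute[of W t] mult.assoc)
  qed
  have "W = 0"
  proof (rule ccontr)
    assume "W \<noteq> 0"
    then have W: "0 < W" by (simp add: W_def)
    \<comment> \<open>The inequality compares \<open>2 W\<close> with \<open>t C\<close>, so \<open>t\<close> is chosen to make \<open>t C\<close> smaller than \<open>W\<close>.\<close>
    define t where "t = W / (C + 1)"
    have t: "0 < t" "t * (C + 1) = W" using W C0 by (simp_all add: t_def)
    have "t * (2 * W) \<le> t * (t * C)" using ineq[of t] by (simp add: power2_eq_square ac_simps)
    then have "2 * W \<le> t * C" using t(1) by simp
    moreover have "t * C < W" using t by (simp add: distrib_left)
    ultimately show False using W by linarith
  qed
  then show ?thesis by (simp add: W_def w_def)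
qed

end

section \<open>Order zero maps\<close>

locale unital_order_zero_map = unital_cp_map +
  assumes orthogonal: "\<And>a b. a \<in> F \<Longrightarrow> b \<in> F \<Longrightarrow> pos_op a \<Longrightarrow> pos_op b \<Longrightarrow> a o\<^sub>L b = 0 \<Longrightarrow> \<phi> a o\<^sub>L \<phi> b = 0"
begin

text \<open>Orthogonality of positive elements passes to arbitrary zero products \<open>x y = 0\<close>: the positive
  elements \<open>x\<^sup>* x\<close> and \<open>y y\<^sup>*\<close> are orthogonal, and their images control the kernel of \<open>\<phi> x\<close> and, by
  taking adjoints, the range of \<open>\<phi> y\<close>.\<close>

lemma zero_product:
  assumes x: "x \<in> F" and y: "y \<in> F" and xy: "x o\<^sub>L y = 0"
  shows "\<phi> x o\<^sub>L \<phi> y = 0"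
proof -
  have mem: "adj x \<in> F" "adj y \<in> F" "x \<in> bops" "y \<in> bops" "adj x o\<^sub>L x \<in> F" "y o\<^sub>L adj y \<in> F"
    using x y star_algebraD[OF star] by auto
  define b where "b = y o\<^sub>L adj y"
  have b: "b \<in> F" "adj b = b" using mem by (simp_all add: b_def adj_comp)
  have "(adj x o\<^sub>L x) o\<^sub>L b = 0"
    using xy by (simp add: b_def oL_assoc) (simp add: oL_assoc[symmetric])
  then have "\<phi> (adj x o\<^sub>L x) o\<^sub>L \<phi> b = 0"
    using mem unfolding b_def
    by (intro orthogonal) (simp_all add: pos_op_adj_comp pos_op_comp_adj)
  then have "blinfun_apply (\<phi> (adj x o\<^sub>L x)) (blinfun_apply (\<phi> b) \<xi>) = 0" for \<xi>
    by (metis blinfun_apply_blinfun_compose blinfun.zero_left)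
  then have "\<phi> x o\<^sub>L \<phi> b = 0"
    by (intro blinfun_eqI) (simp add: kernel_adj_comp[OF x])
  then have "adj (\<phi> x o\<^sub>L \<phi> b) = 0" by simp
  then have "\<phi> b o\<^sub>L \<phi> (adj x) = 0"
    using x b by (simp add: adj_comp image_bops map_adj[symmetric])
  then have "blinfun_apply (\<phi> (adj (adj y) o\<^sub>L adj y)) (blinfun_apply (\<phi> (adj x)) \<xi>) = 0" for \<xi>
    unfolding b_def using mem by (metis adj_adj blinfun_apply_blinfun_compose blinfun.zero_left)
  then have "\<phi> (adj y) o\<^sub>L \<phi> (adj x) = 0"
    by (intro blinfun_eqI) (simp add: kernel_adj_comp[OF mem(2)])
  then have "adj (\<phi> x o\<^sub>L \<phi> y) = 0"
    using x y by (simp add: adj_comp image_bops map_adj)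
  then show ?thesis
    using x y by (simp add: image_bops)
qed

text \<open>Zero products suffice to move an idempotent \<open>p\<close> across: both \<open>x p (1 - p) y\<close> and
  \<open>x (1 - p) p y\<close> vanish.\<close>

lemma move_idempotent:
  assumes x: "x \<in> F" and y: "y \<in> F" and p: "p \<in> F" "p o\<^sub>L p = p"
  shows "\<phi> (x o\<^sub>L p) o\<^sub>L \<phi> y = \<phi> x o\<^sub>L \<phi> (p o\<^sub>L y)"
proof -
  have mem: "x o\<^sub>L p \<in> F" "p o\<^sub>L y \<in> F" "y - (p o\<^sub>L y) \<in> F" "x - (x o\<^sub>L p) \<in> F"
    using x y p star_algebraD[OF star] star_algebra_diff[OF star] by auto
  have "\<phi> (x o\<^sub>L p) o\<^sub>L \<phi> (y - (p o\<^sub>L y)) = 0"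
    using p(2) by (intro zero_product mem) (simp add: oL_diff_right oL_assoc, simp add: oL_assoc[symmetric])
  then have 1: "\<phi> (x o\<^sub>L p) o\<^sub>L \<phi> y = \<phi> (x o\<^sub>L p) o\<^sub>L \<phi> (p o\<^sub>L y)"
    using op_linear_on_diff[OF linear star_algebra_csubspace[OF star] y mem(2)] by (simp add: oL_diff_right)
  have "\<phi> (x - (x o\<^sub>L p)) o\<^sub>L \<phi> (p o\<^sub>L y) = 0"
    using p(2) by (intro zero_product mem) (simp add: oL_diff_left oL_assoc, simp add: oL_assoc[symmetric])
  then have "\<phi> x o\<^sub>L \<phi> (p o\<^sub>L y) = \<phi> (x o\<^sub>L p) o\<^sub>L \<phi> (p o\<^sub>L y)"
    using op_linear_on_diff[OF linear star_algebra_csubspace[OF star] x mem(1)] by (simp add: oL_diff_left)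
  with 1 show ?thesis by simp
qed

end

locale order_zero_spanned = unital_order_zero_map +
  assumes spanned: "spanned_by_projections F"
begin

definition h where "h = \<phi> e"

text \<open>Both sides are linear in \<open>a\<close>, so it suffices that projections can be moved.\<close>

lemma move:
  assumes x: "x \<in> F" and y: "y \<in> F" and a: "a \<in> F"
  shows "\<phi> (x o\<^sub>L a) o\<^sub>L \<phi> y = \<phi> x o\<^sub>L \<phi> (a o\<^sub>L y)"
proof -
  let ?P = "\<lambda>a. a \<in> F \<and> \<phi> (x o\<^sub>L a) o\<^sub>L \<phi> y = \<phi> x o\<^sub>L \<phi> (a o\<^sub>L y)"
  have "?P a"
  proof (rule spanned_by_projections_induct[OF spanned a])
    show "?P 0" using star_algebraD(2)[OF star] op_linear_on_zero[OF linear] by simp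
    show "?P p" if "p \<in> F" "projection p" for p
      using that move_idempotent[OF x y] by (auto simp: projection_def)
    show "?P (a + b)" if "?P a" "?P b" for a b
      using that x y star_algebraD[OF star]
      by (simp add: oL_add_left oL_add_right op_linear_onD(1)[OF linear])
    show "?P (op_scale c a)" if "?P a" for a c
      using that x y star_algebraD[OF star]
      by (simp add: op_linear_onD(2)[OF linear] in_bops image_bops)
  qed
  then show ?thesis by blast
qed

lemma mult: "a \<in> F \<Longrightarrow> b \<in> F \<Longrightarrow> \<phi> a o\<^sub>L \<phi> b = h o\<^sub>L \<phi> (a o\<^sub>L b)"
  using move[OF unit(1), of b a] by (simp add: unit h_def)

lemma h_commute: "a \<in> F \<Longrightarrow> h o\<^sub>L \<phi> a = \<phi> a o\<^sub>L h"
  using move[OF unit(1) unit(1), of a] by (simp add: unit h_def)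

lemma h_pos: "pos_op h"
  unfolding h_def using cp_pos_op[OF cp unit(1) projection_pos[OF unit_projection] B_bops] .

lemma h_bops: "h \<in> bops" by (rule pos_op_bops[OF h_pos])
lemma h_adj: "adj h = h" by (rule pos_op_adj[OF h_pos])

text \<open>\<open>(\<phi> p)\<^sup>2 = h \<phi> p\<close> gives \<open>\<parallel>\<phi> p \<xi>\<parallel>\<^sup>2 = \<langle>h \<xi>, \<phi> p \<xi>\<rangle>\<close>, and Cauchy--Schwarz applies. The bound in terms of
  \<open>\<parallel>h \<xi>\<parallel>\<close> is the hypothesis of Douglas' lemma.\<close>

lemma projection_bound:
  assumes p: "p \<in> F" "projection p"
  shows "norm (blinfun_apply (\<phi> p) \<xi>) \<le> norm (blinfun_apply h \<xi>)"
proof -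
  have pa: "adj p = p" "p o\<^sub>L p = p" using p(2) by (auto simp: projection_def)
  have "adj (\<phi> p) o\<^sub>L \<phi> p = \<phi> p o\<^sub>L h"
    using mult[OF p(1) p(1)] h_commute[OF p(1)] by (simp add: map_adj[OF p(1), symmetric] pa)
  then have "cinner (blinfun_apply (\<phi> p) \<xi>) (blinfun_apply (\<phi> p) \<xi>) = cinner (blinfun_apply h \<xi>) (blinfun_apply (\<phi> p) \<xi>)"
    using adj_comp_self_apply[OF image_bops[OF p(1)], of \<xi>]
      cinner_adj_left[OF image_bops[OF p(1)], of "blinfun_apply h \<xi>" \<xi>]
    by (simp add: map_adj[OF p(1), symmetric] pa)
  then have "(norm (blinfun_apply (\<phi> p) \<xi>))\<^sup>2 = inner (blinfun_apply h \<xi>) (blinfun_apply (\<phi> p) \<xi>)"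
    by (metis Re_cinner power2_norm_eq_inner)
  also have "\<dots> \<le> norm (blinfun_apply h \<xi>) * norm (blinfun_apply (\<phi> p) \<xi>)" by (rule norm_cauchy_schwarz)
  finally show ?thesis
    by (cases "blinfun_apply (\<phi> p) \<xi> = 0") (simp_all add: power2_eq_square)
qed

lemma bound:
  assumes a: "a \<in> F"
  shows "\<exists>M. \<forall>\<xi>. norm (blinfun_apply (\<phi> a) \<xi>) \<le> M * norm (blinfun_apply h \<xi>)"
proof -
  let ?P = "\<lambda>a. a \<in> F \<and> (\<exists>M. \<forall>\<xi>. norm (blinfun_apply (\<phi> a) \<xi>) \<le> M * norm (blinfun_apply h \<xi>))"
  have "?P a"
  proof (rule spanned_by_projections_induct[OF spanned a])
    show "?P 0" using star_algebraD(2)[OF star] op_linear_on_zero[OF linear]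
      by (auto intro: exI[of _ 0])
    show "?P p" if "p \<in> F" "projection p" for p
      using that projection_bound by (auto intro: exI[of _ 1])
    show "?P (a + b)" if ab: "?P a" "?P b" for a b
    proof -
      obtain M N where MN: "\<And>\<xi>. norm (blinfun_apply (\<phi> a) \<xi>) \<le> M * norm (blinfun_apply h \<xi>)"
        "\<And>\<xi>. norm (blinfun_apply (\<phi> b) \<xi>) \<le> N * norm (blinfun_apply h \<xi>)"
        using ab by blast
      have "norm (blinfun_apply (\<phi> (a + b)) \<xi>) \<le> (M + N) * norm (blinfun_apply h \<xi>)" for \<xi>
        using ab norm_triangle_mono[OF MN(1) MN(2), of \<xi> \<xi>]
        by (simp add: op_linear_onD(1)[OF linear] blinfun.add_left distrib_right)
      moreover have "a + b \<in> F" using ab star_algebraD(3)[OF star] by simp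
      ultimately show ?thesis by (intro conjI exI[of _ "M + N"] allI)
    qed
    show "?P (op_scale c a)" if ac: "?P a" for a c
    proof -
      obtain M where M: "\<And>\<xi>. norm (blinfun_apply (\<phi> a) \<xi>) \<le> M * norm (blinfun_apply h \<xi>)"
        using ac by blast
      have "norm (blinfun_apply (\<phi> (op_scale c a)) \<xi>) \<le> (cmod c * M) * norm (blinfun_apply h \<xi>)" for \<xi>
        using ac mult_left_mono[OF M[of \<xi>] norm_ge_zero[of c]]
        by (simp add: op_linear_onD(2)[OF linear] norm_scaleC mult.assoc)
      moreover have "op_scale c a \<in> F" using ac star_algebraD(6)[OF star] by simp
      ultimately show ?thesis by (intro conjI exI[of _ "cmod c * M"] allI)
    qed
  qed
  then show ?thesis by blast
qed

text \<open>The quotient \<open>\<phi> a h\<^sup>-\<^sup>1\<close>, made unique by the value zero on the kernel of \<open>h\<close>.\<close>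

definition \<pi> where
  "\<pi> a = (SOME Z. Z \<in> bops \<and> Z o\<^sub>L h = \<phi> a \<and> (\<forall>\<xi>. blinfun_apply h \<xi> = 0 \<longrightarrow> blinfun_apply Z \<xi> = 0))"

lemma pi_props:
  assumes a: "a \<in> F"
  shows "\<pi> a \<in> bops \<and> \<pi> a o\<^sub>L h = \<phi> a \<and> (\<forall>\<xi>. blinfun_apply h \<xi> = 0 \<longrightarrow> blinfun_apply (\<pi> a) \<xi> = 0)"
proof -
  obtain M where "\<And>\<xi>. norm (blinfun_apply (\<phi> a) \<xi>) \<le> M * norm (blinfun_apply h \<xi>)"
    using bound[OF a] by blast
  from douglas_factor[OF image_bops[OF a] h_bops h_adj this] show ?thesis
    unfolding \<pi>_def by (rule someI_ex) 
qed

lemma pi_bops: "a \<in> F \<Longrightarrow> \<pi> a \<in> bops"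
  and pi_h: "a \<in> F \<Longrightarrow> \<pi> a o\<^sub>L h = \<phi> a"
  and pi_ker: "a \<in> F \<Longrightarrow> blinfun_apply h \<xi> = 0 \<Longrightarrow> blinfun_apply (\<pi> a) \<xi> = 0"
  using pi_props by auto

lemma phi_ker: "a \<in> F \<Longrightarrow> blinfun_apply h \<xi> = 0 \<Longrightarrow> blinfun_apply (\<phi> a) \<xi> = 0"
  using pi_h[of a] by (metis blinfun_apply_blinfun_compose blinfun.zero_right)

text \<open>An operator that vanishes on the kernel of \<open>h\<close> is determined by its product with \<open>h\<close>; all algebraic
  properties of \<open>\<pi>\<close> follow by comparing such products.\<close>

lemma pi_eqI:
  assumes "a \<in> F" "Z \<in> bops" "Z o\<^sub>L h = \<phi> a" "\<And>\<xi>. blinfun_apply h \<xi> = 0 \<Longrightarrow> blinfun_apply Z \<xi> = 0"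
  shows "\<pi> a = Z"
  using equal_on_range_and_kernel[of "\<pi> a" Z h] assms pi_bops pi_h pi_ker h_bops h_adj by simp

lemma h_pi: "a \<in> F \<Longrightarrow> h o\<^sub>L \<pi> a = \<phi> a"
proof (rule equal_on_range_and_kernel[OF _ _ h_bops h_adj])
  assume a: "a \<in> F"
  show "h o\<^sub>L \<pi> a o\<^sub>L h = \<phi> a o\<^sub>L h" using pi_h[OF a] h_commute[OF a] by (simp add: oL_assoc)
qed (simp_all add: h_bops pi_bops image_bops pi_ker phi_ker)

lemma pi_phi: "a \<in> F \<Longrightarrow> b \<in> F \<Longrightarrow> \<pi> a o\<^sub>L \<phi> b = \<phi> (a o\<^sub>L b)"
proof (rule equal_on_range_and_kernel[OF _ _ h_bops h_adj])
  assume a: "a \<in> F" and b: "b \<in> F"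
  then have ab: "a o\<^sub>L b \<in> F" using star_algebraD[OF star] by blast
  have "\<pi> a o\<^sub>L \<phi> b o\<^sub>L h = (\<pi> a o\<^sub>L h) o\<^sub>L \<phi> b" using h_commute[OF b] by (simp add: oL_assoc)
  also have "\<dots> = \<phi> (a o\<^sub>L b) o\<^sub>L h" using pi_h[OF a] mult[OF a b] h_commute[OF ab] by simp
  finally show "\<pi> a o\<^sub>L \<phi> b o\<^sub>L h = \<phi> (a o\<^sub>L b) o\<^sub>L h" .
qed (use star_algebraD[OF star] in \<open>auto simp: h_bops pi_bops image_bops phi_ker\<close>)

lemma pi_mult:
  assumes a: "a \<in> F" and b: "b \<in> F"
  shows "\<pi> (a o\<^sub>L b) = \<pi> a o\<^sub>L \<pi> b"
  using a b star_algebraD[OF star]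
  by (intro pi_eqI) (auto simp: pi_bops oL_assoc pi_h pi_phi pi_ker)

text \<open>The adjoint of \<open>\<pi> a\<close> vanishes on the kernel of \<open>h\<close>: it maps this kernel into itself, because it
  commutes with \<open>h\<close>, and into the orthogonal complement of the kernel, because \<open>\<pi> a\<close> vanishes there.\<close>

lemma pi_adj:
  assumes a: "a \<in> F"
  shows "\<pi> (adj a) = adj (\<pi> a)"
proof (rule pi_eqI)
  show "adj a \<in> F" "adj (\<pi> a) \<in> bops" using a star_algebraD[OF star] pi_bops by auto
  have "adj (\<pi> a) o\<^sub>L h = adj (h o\<^sub>L \<pi> a)" using a by (simp add: adj_comp h_bops pi_bops h_adj)
  then show comm: "adj (\<pi> a) o\<^sub>L h = \<phi> (adj a)" using a by (simp add: h_pi map_adj)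
  fix \<xi> assume \<xi>: "blinfun_apply h \<xi> = 0"
  define \<zeta> where "\<zeta> = blinfun_apply (adj (\<pi> a)) \<xi>"
  have "h o\<^sub>L adj (\<pi> a) = adj (\<pi> a o\<^sub>L h)" using a by (simp add: adj_comp h_bops pi_bops h_adj)
  also have "\<dots> = adj (\<pi> a) o\<^sub>L h" using a comm by (simp add: pi_h map_adj)
  finally have "blinfun_apply h \<zeta> = 0"
    unfolding \<zeta>_def by (metis \<xi> blinfun_apply_blinfun_compose blinfun.zero_right)
  then have "blinfun_apply (\<pi> a) \<zeta> = 0" using a pi_ker by blast
  moreover have "cinner \<zeta> \<zeta> = cinner \<xi> (blinfun_apply (\<pi> a) \<zeta>)"
    unfolding \<zeta>_def using cinner_adj_left[OF pi_bops[OF a]] by simp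
  ultimately show "blinfun_apply (adj (\<pi> a)) \<xi> = 0" by (simp add: \<zeta>_def[symmetric])
qed

lemma pi_linear: "op_linear_on F \<pi>"
  unfolding op_linear_on_def
proof (intro conjI ballI allI)
  fix a b assume "a \<in> F" "b \<in> F"
  then show "\<pi> (a + b) = \<pi> a + \<pi> b"
    using star_algebraD[OF star]
    by (intro pi_eqI)
      (auto simp: pi_bops oL_add_left pi_h op_linear_onD(1)[OF linear] blinfun.add_left pi_ker)
next
  fix a c assume "a \<in> F"
  then show "\<pi> (op_scale c a) = op_scale c (\<pi> a)"
    using star_algebraD[OF star]
    by (intro pi_eqI) (auto simp: pi_bops pi_h op_linear_onD(2)[OF linear] pi_ker)
qed

text \<open>The multiplier condition holds on \<open>\<phi> F\<close> because \<open>\<pi> a \<phi> b = \<phi> (a b)\<close>, and the elements for which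
  it holds form a C*-algebra.\<close>

lemma pi_multiplier:
  assumes a: "a \<in> F" and C: "C = cstar_generated (\<phi> ` F)"
  shows "\<pi> a \<in> multipliers C"
proof -
  have "\<phi> ` F \<subseteq> bops" using image_bops by auto
  then have Ca: "cstar_algebra C" "\<phi> ` F \<subseteq> C"
    unfolding C by (simp_all add: cstar_generated_cstar_algebra cstar_generated_superset)
  then have Cs: "star_algebra C" and Ccl: "closed C" by (auto simp: cstar_algebra_def)
  note CD = star_algebraD[OF Cs]
  define S where "S = {c \<in> C. \<forall>a\<in>F. \<pi> a o\<^sub>L c \<in> C \<and> c o\<^sub>L \<pi> a \<in> C}"
  have "star_algebra S"
    unfolding star_algebra_def
  proof (intro conjI ballI allI)
    show "S \<subseteq> bops" "0 \<in> S" using CD by (auto simp: S_def)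
  next
    fix x y assume xy: "x \<in> S" "y \<in> S"
    then show "x + y \<in> S" using CD by (auto simp: S_def oL_add_left oL_add_right)
    have "\<pi> a o\<^sub>L (x o\<^sub>L y) = (\<pi> a o\<^sub>L x) o\<^sub>L y" "(x o\<^sub>L y) o\<^sub>L \<pi> a = x o\<^sub>L (y o\<^sub>L \<pi> a)" for a
      by (simp_all add: oL_assoc)
    then show "x o\<^sub>L y \<in> S" using xy CD unfolding S_def by auto
  next
    fix x assume x: "x \<in> S"
    show "adj x \<in> S"
      unfolding S_def
    proof (intro CollectI conjI ballI)
      show "adj x \<in> C" using x CD by (auto simp: S_def)
      fix a assume a: "a \<in> F"
      then have aa: "adj a \<in> F" using star_algebraD[OF star] by blast
      have xb: "x \<in> bops" using x CD by (auto simp: S_def)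
      have "\<pi> a = adj (\<pi> (adj a))" using pi_adj[OF aa] a by (simp add: in_bops)
      then have "\<pi> a o\<^sub>L adj x = adj (x o\<^sub>L \<pi> (adj a))" "adj x o\<^sub>L \<pi> a = adj (\<pi> (adj a) o\<^sub>L x)"
        using xb aa by (simp_all add: adj_comp pi_bops)
      then show "\<pi> a o\<^sub>L adj x \<in> C" "adj x o\<^sub>L \<pi> a \<in> C"
        using x aa CD by (auto simp: S_def)
    qed
    fix c
    show "op_scale c x \<in> S"
      using x CD by (auto simp: S_def pi_bops)
  qed
  moreover have "closed S"
  proof -
    have "S = C \<inter> (\<Inter>a\<in>F. (\<lambda>c. \<pi> a o\<^sub>L c) -` C \<inter> (\<lambda>c. c o\<^sub>L \<pi> a) -` C)"
      by (auto simp: S_def)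
    also have "closed \<dots>"
      by (intro closed_Int closed_INT ballI Ccl continuous_closed_vimage
          bounded_bilinear.isCont[OF bounded_bilinear_blinfun_compose] continuous_ident continuous_const)
    finally show ?thesis .
  qed
  moreover have "\<phi> ` F \<subseteq> S"
  proof
    fix c assume "c \<in> \<phi> ` F"
    then obtain b where b: "b \<in> F" "c = \<phi> b" by blast
    have "\<phi> b o\<^sub>L \<pi> a = \<phi> (b o\<^sub>L a)" if a: "a \<in> F" for a
    proof -
      have "\<phi> b o\<^sub>L \<pi> a = \<pi> b o\<^sub>L (h o\<^sub>L \<pi> a)" using pi_h[OF b(1)] by (simp add: oL_assoc[symmetric])
      then show ?thesis using a b by (simp add: h_pi pi_phi)
    qed
    then show "c \<in> S"
      using b Ca(2) star_algebraD[OF star] by (auto simp: S_def pi_phi)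
  qed
  ultimately have "C \<subseteq> S"
    unfolding C by (intro cstar_generated_least) (simp_all add: cstar_algebra_def)
  moreover have "h \<in> C" using Ca(2) unit(1) by (auto simp: h_def)
  ultimately show ?thesis
    using a pi_bops[OF a] pi_ker[OF a] by (auto simp: multipliers_def S_def)
qed

lemma map_norm_eq: "map_norm F \<phi> = norm h"
  unfolding map_norm_def
proof (rule cSup_eq_maximum)
  show "norm h \<in> (\<lambda>a. norm (\<phi> a)) ` {a \<in> F. norm a \<le> 1}"
    using unit(1) projection_norm_le[OF unit_projection] by (auto simp: h_def)
  fix r assume "r \<in> (\<lambda>a. norm (\<phi> a)) ` {a \<in> F. norm a \<le> 1}"
  then obtain a where a: "a \<in> F" "norm a \<le> 1" "r = norm (\<phi> a)" by blast
  have "norm (\<phi> a) \<le> norm a * norm h" unfolding h_def by (rule norm_le_unit[OF a(1)])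
  also have "\<dots> \<le> 1 * norm h" by (intro mult_right_mono a) simp
  finally show "r \<le> norm h" by (simp add: a(3))
qed

text \<open>This is the Winter--Zacharias structure theorem for algebras spanned by their projections.\<close>

theorem supporting_hom_exists: "supporting_hom F \<phi> \<pi>"
  unfolding supporting_hom_def
proof (intro exI conjI)
  let ?C = "cstar_generated (\<phi> ` F)"
  have "\<phi> ` F \<subseteq> bops" using image_bops by auto
  then have Ca: "cstar_algebra ?C" "\<phi> ` F \<subseteq> ?C"
    by (simp_all add: cstar_generated_cstar_algebra cstar_generated_superset)
  then have Cs: "star_algebra ?C" and Ccl: "closed ?C" by (auto simp: cstar_algebra_def)
  note CD = star_algebraD[OF Cs]
  have hC: "h \<in> ?C" using Ca(2) unit(1) by (auto simp: h_def)
  show "?C = ?C" ..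
  have "?C \<subseteq> {c \<in> bops. h o\<^sub>L c = c o\<^sub>L h}"
  proof (rule cstar_generated_least)
    have "star_algebra {c \<in> bops. h o\<^sub>L c = c o\<^sub>L h}"
      unfolding star_algebra_def
    proof (intro conjI ballI allI)
      fix x y assume "x \<in> {c \<in> bops. h o\<^sub>L c = c o\<^sub>L h}" "y \<in> {c \<in> bops. h o\<^sub>L c = c o\<^sub>L h}"
      then have xy: "x \<in> bops" "y \<in> bops" "h o\<^sub>L x = x o\<^sub>L h" "h o\<^sub>L y = y o\<^sub>L h" by auto
      then show "x + y \<in> {c \<in> bops. h o\<^sub>L c = c o\<^sub>L h}" by (auto simp: oL_add_left oL_add_right)
      have "h o\<^sub>L (x o\<^sub>L y) = (x o\<^sub>L y) o\<^sub>L h" using xy(3,4) by (metis oL_assoc)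
      then show "x o\<^sub>L y \<in> {c \<in> bops. h o\<^sub>L c = c o\<^sub>L h}" using xy by auto
    next
      fix x assume "x \<in> {c \<in> bops. h o\<^sub>L c = c o\<^sub>L h}"
      then have x: "x \<in> bops" "h o\<^sub>L x = x o\<^sub>L h" by auto
      then have "adj (h o\<^sub>L x) = adj (x o\<^sub>L h)" by simp
      then show "adj x \<in> {c \<in> bops. h o\<^sub>L c = c o\<^sub>L h}"
        using x(1) h_bops h_adj by (simp add: adj_comp)
      show "op_scale c x \<in> {c \<in> bops. h o\<^sub>L c = c o\<^sub>L h}" for c using x h_bops by auto
    qed auto
    moreover have "closed {c. h o\<^sub>L c = c o\<^sub>L h}"
      by (intro closed_Collect_eq continuous_intros
          bounded_bilinear.continuous_on[OF bounded_bilinear_blinfun_compose])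
    ultimately show "cstar_algebra {c \<in> bops. h o\<^sub>L c = c o\<^sub>L h}"
      using closed_Int[OF closed_bops] by (simp add: cstar_algebra_def Collect_conj_eq)
    show "\<phi> ` F \<subseteq> {c \<in> bops. h o\<^sub>L c = c o\<^sub>L h}" using h_commute image_bops by auto
  qed
  then show "h \<in> multipliers ?C \<inter> commutant ?C"
    using hC CD h_bops by (auto simp: multipliers_def commutant_def)
  show "pos_op h" by (rule h_pos)
  show "norm h = map_norm F \<phi>" by (simp add: map_norm_eq)
  show "\<forall>e'\<in>F. (\<forall>a\<in>F. e' o\<^sub>L a = a \<and> a o\<^sub>L e' = a) \<longrightarrow> h = \<phi> e'"
  proof (intro ballI impI)
    fix e' assume "e' \<in> F" "\<forall>a\<in>F. e' o\<^sub>L a = a \<and> a o\<^sub>L e' = a"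
    then have "e' = e" using unit by metis
    then show "h = \<phi> e'" by (simp add: h_def)
  qed
  show "star_hom F (multipliers ?C \<inter> commutant {h}) \<pi>"
    unfolding star_hom_def using pi_linear pi_mult pi_adj pi_multiplier pi_bops pi_h h_pi
    by (auto simp: commutant_def)
  show "\<forall>a\<in>F. \<phi> a = h o\<^sub>L \<pi> a" using h_pi by simp
qed

end

section \<open>Matrix entries of operators on square-summable sequences\<close>

lemma summable_single: "summable (\<lambda>k. (norm (if k = n then 1 else 0 :: complex))\<^sup>2)"
  by (rule summable_finite[of "{n}"]) auto

lemma ell2_nth_basis [simp]: "ell2_nth (ell2_basis n) k = (if k = n then 1 else 0)"
  unfolding ell2_basis_def by (subst Abs_ell2_inverse) (simp_all add: summable_single)

lemma ell2_eqI: "(\<And>n. ell2_nth f n = ell2_nth g n) \<Longrightarrow> f = g"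
  by (simp add: ell2_nth_inject[symmetric] fun_eq_iff)

lemma cinner_basis_right: "cinner f (ell2_basis n) = ell2_nth f n"
proof -
  have "(\<lambda>k. cinner (ell2_nth f k) (ell2_nth (ell2_basis n) k)) = (\<lambda>k. if k = n then ell2_nth f k else 0)"
    by (rule ext) (simp add: cinner_complex_def)
  then show ?thesis
    unfolding cinner_ell2_def using suminf_finite[of "{n}" "\<lambda>k. if k = n then ell2_nth f k else 0"] by simp
qed

lemma ell2_nth_linear:
  "ell2_nth (f + g) n = ell2_nth f n + ell2_nth g n"
  "ell2_nth (f - g) n = ell2_nth f n - ell2_nth g n"
  "ell2_nth (0 :: complex ell2) n = 0"
  "ell2_nth (c *\<^sub>C f) n = c * ell2_nth f n"
  for f :: "complex ell2"
  by (simp_all add: plus_ell2.rep_eq minus_ell2.rep_eq zero_ell2.rep_eq scaleC_ell2.rep_eq scaleC_complex_def)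

lemma norm_ell2_basis [simp]: "norm (ell2_basis n) = 1"
proof -
  have "complex_of_real ((norm (ell2_basis n))\<^sup>2) = 1"
    by (simp only: cinner_self[symmetric] cinner_basis_right) simp
  then have "(norm (ell2_basis n))\<^sup>2 = 1" by (simp only: of_real_eq_1_iff)
  then show ?thesis by (simp add: power2_eq_1_iff) (metis norm_ge_zero not_one_le_zero neg_0_le_iff_le)
qed

definition entry :: "complex ell2 op \<Rightarrow> nat \<Rightarrow> nat \<Rightarrow> complex" where
  "entry x r s = ell2_nth (blinfun_apply x (ell2_basis s)) r"

lemma entry_cinner: "entry x r s = cinner (blinfun_apply x (ell2_basis s)) (ell2_basis r)"
  by (simp add: entry_def cinner_basis_right)

lemma entry_adj: "x \<in> bops \<Longrightarrow> entry (adj x) r s = cnj (entry x s r)"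
  by (simp add: entry_cinner cinner_adj_left cinner_commute[symmetric])

text \<open>The entries of the adjoint vanish as well, so the adjoint annihilates the basis vectors, and then all
  coordinates of the values of \<open>x\<close> vanish.\<close>

lemma entry_zero:
  assumes x: "x \<in> bops" and zero: "\<And>r s. entry x r s = 0"
  shows "x = 0"
proof (rule blinfun_eqI, rule ell2_eqI)
  fix \<xi> r
  have "blinfun_apply (adj x) (ell2_basis r) = 0"
    using zero by (intro ell2_eqI) (simp add: entry_def[symmetric] entry_adj[OF x] ell2_nth_linear)
  then have "cinner (blinfun_apply x \<xi>) (ell2_basis r) = 0"
    by (simp add: cinner_adj_right[OF x])
  then show "ell2_nth (blinfun_apply x \<xi>) r = ell2_nth (blinfun_apply 0 \<xi>) r"
    by (simp add: cinner_basis_right ell2_nth_linear)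
qed

lemma entry_linear:
  "entry (x + y) r s = entry x r s + entry y r s"
  "entry (x - y) r s = entry x r s - entry y r s"
  "entry 0 r s = 0"
  "entry (op_scale c x) r s = c * entry x r s"
  by (simp_all add: entry_def blinfun.add_left blinfun.diff_left ell2_nth_linear)

lemma entry_sum: "entry (\<Sum>i\<in>I. f i) r s = (\<Sum>i\<in>I. entry (f i) r s)"
  by (induction I rule: infinite_finite_induct) (simp_all add: entry_linear)

lemma entry_eqI:
  assumes "x \<in> bops" "y \<in> bops" "\<And>r s. entry x r s = entry y r s"
  shows "x = y"
  using entry_zero[of "x - y"] assms by (simp add: entry_linear)

lift_definition matunit :: "nat \<Rightarrow> nat \<Rightarrow> complex ell2 op" is
  "\<lambda>r s \<xi>. ell2_nth \<xi> s *\<^sub>C ell2_basis r"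
proof (rule bounded_linear_intro[where K = 1])
  fix r s :: nat and \<xi> \<zeta> :: "complex ell2" and c :: real
  show "ell2_nth (\<xi> + \<zeta>) s *\<^sub>C ell2_basis r = ell2_nth \<xi> s *\<^sub>C ell2_basis r + ell2_nth \<zeta> s *\<^sub>C ell2_basis r"
    by (simp add: ell2_nth_linear scaleC_add_left)
  show "ell2_nth (c *\<^sub>R \<xi>) s *\<^sub>C ell2_basis r = c *\<^sub>R ell2_nth \<xi> s *\<^sub>C ell2_basis r"
    by (simp only: scaleC_of_real[symmetric] scaleC_scaleC ell2_nth_linear)
  show "norm (ell2_nth \<xi> s *\<^sub>C ell2_basis r) \<le> norm \<xi> * 1"
    using ell2_norm_nth_le[of \<xi> s] by (simp add: norm_scaleC)
qed

lemma matunit_apply [simp]: "blinfun_apply (matunit r s) \<xi> = ell2_nth \<xi> s *\<^sub>C ell2_basis r"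
  by transfer simp

lemma matunit_bops [simp]: "matunit r s \<in> bops"
  by (simp add: bops_def ell2_nth_linear scaleC_scaleC)

lemma entry_matunit: "entry (matunit a b) r s = (if r = a \<and> s = b then 1 else 0)"
  by (simp add: entry_def ell2_nth_linear)

lemma entry_matunit_comp: "entry (matunit a b o\<^sub>L x) r s = (if r = a then entry x b s else 0)"
  by (simp add: entry_def ell2_nth_linear)

lemma entry_comp_matunit: "x \<in> bops \<Longrightarrow> entry (x o\<^sub>L matunit a b) r s = (if s = b then entry x r a else 0)"
  by (simp add: entry_def ell2_nth_linear)

lemma matunit_comp: "matunit a b o\<^sub>L matunit c d = (if b = c then matunit a d else 0)"
  by (rule entry_eqI) (auto simp: entry_matunit_comp entry_matunit entry_linear)

lemma adj_matunit [simp]: "adj (matunit a b) = matunit b a"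
  by (rule entry_eqI) (auto simp: entry_adj entry_matunit)

lemma matunit_nonzero [simp]: "matunit a b \<noteq> 0"
  using entry_matunit[of a b a b] by (auto simp: entry_linear)

lemma compress_matunit: "x \<in> bops \<Longrightarrow> matunit a a o\<^sub>L x o\<^sub>L matunit b b = op_scale (entry x a b) (matunit a b)"
  by (rule entry_eqI) (auto simp: entry_matunit_comp entry_comp_matunit entry_matunit entry_linear)

lemma projection_matunit: "projection (matunit k k)"
  by (simp add: projection_def matunit_comp)

section \<open>Block diagonal matrix algebras\<close>

lemma block_alg_iff: "x \<in> block_alg E \<longleftrightarrow> x \<in> bops \<and> (\<forall>r s. (r, s) \<notin> E \<longrightarrow> entry x r s = 0)"
  by (simp add: block_alg_def entry_def)

lemma block_alg_bops: "x \<in> block_alg E \<Longrightarrow> x \<in> bops"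
  by (simp add: block_alg_iff)

lemma block_alg_entry: "x \<in> block_alg E \<Longrightarrow> (r, s) \<notin> E \<Longrightarrow> entry x r s = 0"
  by (simp add: block_alg_iff)

lemma diagonal_entry: "x \<in> block_alg (Id_on X) \<Longrightarrow> r \<noteq> s \<Longrightarrow> entry x r s = 0"
  by (rule block_alg_entry) auto

lemma csubspace_block_alg: "csubspace (block_alg E)"
  by (auto simp: csubspace_def block_alg_iff entry_linear)

lemma matunit_in_block_alg: "(r, s) \<in> E \<Longrightarrow> matunit r s \<in> block_alg E"
  by (auto simp: block_alg_iff entry_matunit)

lemma block_alg_mono: "E \<subseteq> E' \<Longrightarrow> block_alg E \<subseteq> block_alg E'"
  by (fastforce simp: block_alg_iff)

lemma block_expand:
  assumes "finite E" "x \<in> block_alg E"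
  shows "x = (\<Sum>(r, s)\<in>E. op_scale (entry x r s) (matunit r s))"
proof (rule entry_eqI)
  fix r s
  have "entry (\<Sum>(a, b)\<in>E. op_scale (entry x a b) (matunit a b)) r s
      = (\<Sum>p\<in>E. if p = (r, s) then entry x r s else 0)"
    unfolding entry_sum by (rule sum.cong) (auto simp: entry_linear entry_matunit split: prod.splits)
  then show "entry x r s = entry (\<Sum>(a, b)\<in>E. op_scale (entry x a b) (matunit a b)) r s"
    using assms by (simp add: block_alg_iff)
qed (use assms in \<open>auto simp: block_alg_iff intro!: bops_sum\<close>)

lemma block_alg_subset:
  assumes "finite E" "csubspace V" "\<And>r s. (r, s) \<in> E \<Longrightarrow> matunit r s \<in> V"
  shows "block_alg E \<subseteq> V"
proof
  fix x assume "x \<in> block_alg E"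
  then have "x = (\<Sum>(r, s)\<in>E. op_scale (entry x r s) (matunit r s))" by (rule block_expand[OF assms(1)])
  also have "\<dots> \<in> V" using assms by (intro csubspace_sum) (auto intro: csubspaceD)
  finally show "x \<in> V" .
qed

lemma closed_block_alg: "closed (block_alg E)"
proof -
  have "block_alg E = bops \<inter> (\<Inter>r. \<Inter>s\<in>{s. (r, s) \<notin> E}.
      {x. cinner (blinfun_apply x (ell2_basis s)) (ell2_basis r) = 0})"
    by (auto simp: block_alg_iff entry_cinner)
  also have "closed \<dots>"
    by (intro closed_Int closed_bops closed_INT ballI closed_Collect_eq
        bounded_bilinear.continuous_on[OF bounded_bilinear_cinner] blinfun.continuous_on continuous_intros)
  finally show ?thesis .
qed

lemma finite_dim_block_alg:
  assumes "finite E"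
  shows "finite_dim (block_alg E)"
  unfolding finite_dim_def
proof (intro exI conjI)
  let ?S = "(\<lambda>(r, s). matunit r s) ` E \<union> (\<lambda>(r, s). op_scale \<i> (matunit r s)) ` E"
  show "finite ?S" using assms by simp
  have scale: "op_scale c (matunit r s) \<in> span ?S" if "(r, s) \<in> E" for c r s
  proof -
    have "op_scale c (matunit r s) = Re c *\<^sub>R matunit r s + Im c *\<^sub>R op_scale \<i> (matunit r s)"
      by (subst (1) complex_eq[of c]) (simp add: op_scale_add_left op_scale_of_real[symmetric] mult.commute)
    moreover have "matunit r s \<in> ?S" "op_scale \<i> (matunit r s) \<in> ?S" using that by force+
    ultimately show ?thesis by (simp add: span_add span_scale span_base)
  qed
  show "block_alg E \<subseteq> span ?S"
  proof
    fix x assume "x \<in> block_alg E"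
    then have "x = (\<Sum>(r, s)\<in>E. op_scale (entry x r s) (matunit r s))" by (rule block_expand[OF assms])
    also have "\<dots> \<in> span ?S" by (intro span_sum) (use scale in auto)
    finally show "x \<in> span ?S" .
  qed
qed

lemma entry_comp:
  assumes X: "finite X" "E \<subseteq> X \<times> X" and x: "x \<in> bops" and y: "y \<in> block_alg E"
  shows "entry (x o\<^sub>L y) r s = (\<Sum>k\<in>X. entry x r k * entry y k s)"
proof -
  have eq: "blinfun_apply y (ell2_basis s) = (\<Sum>k\<in>X. entry y k s *\<^sub>C ell2_basis k)"
  proof (rule ell2_eqI)
    fix n
    have "ell2_nth (\<Sum>k\<in>X. entry y k s *\<^sub>C ell2_basis k) n = (\<Sum>k\<in>X. if k = n then entry y n s else 0)"
      by (simp add: cinner_basis_right[symmetric] cinner_sum_left cinner_scaleC_left)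
        (auto simp: cinner_basis_right intro: sum.cong)
    then show "ell2_nth (blinfun_apply y (ell2_basis s)) n = ell2_nth (\<Sum>k\<in>X. entry y k s *\<^sub>C ell2_basis k) n"
      using X y by (auto simp: block_alg_iff entry_def)
  qed
  show ?thesis
    unfolding entry_cinner[of "x o\<^sub>L y"] blinfun_apply_blinfun_compose eq
    by (simp add: blinfun.sum_right cinner_sum_left bops_scaleC[OF x] cinner_scaleC_left
        entry_cinner[of x] mult.commute)
qed

lemma equiv_subset: "equiv X E \<Longrightarrow> E \<subseteq> X \<times> X"
  by (auto simp: equiv_def refl_on_def)

lemma equiv_Id_on: "equiv X (Id_on X)"
  by (auto simp: equiv_def refl_on_def sym_def trans_def)

lemma finite_equiv: "finite X \<Longrightarrow> equiv X E \<Longrightarrow> finite E"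
  using equiv_subset finite_subset by blast

lemma star_algebra_block_alg:
  assumes X: "finite X" "equiv X E"
  shows "star_algebra (block_alg E)"
proof -
  have E: "E \<subseteq> X \<times> X" "sym E" "trans E" using X(2) equiv_subset by (auto simp: equiv_def)
  have comp: "x o\<^sub>L y \<in> block_alg E" if x: "x \<in> block_alg E" and y: "y \<in> block_alg E" for x y
  proof -
    have "entry x r k * entry y k s = 0" if "(r, s) \<notin> E" for r s k
      using x y that transD[OF E(3), of r k s] by (auto simp: block_alg_iff)
    then have "entry (x o\<^sub>L y) r s = 0" if "(r, s) \<notin> E" for r s
      unfolding entry_comp[OF X(1) E(1) block_alg_bops[OF x] y] using that by (intro sum.neutral) blast
    then show ?thesis using x y by (simp add: block_alg_iff)
  qed
  have "adj x \<in> block_alg E" if "x \<in> block_alg E" for x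
    using that symD[OF E(2)] by (auto simp: block_alg_iff entry_adj)
  then show ?thesis
    using comp csubspaceD[OF csubspace_block_alg] block_alg_bops by (auto simp: star_algebra_def)
qed

lemma abelian_diagonal:
  assumes "finite X"
  shows "abelian (block_alg (Id_on X))"
  unfolding abelian_def
proof (intro ballI entry_eqI)
  fix x y r s assume xy: "x \<in> block_alg (Id_on X)" "y \<in> block_alg (Id_on X)"
  have E: "Id_on X \<subseteq> X \<times> X" by auto
  have "entry x r k * entry y k s = entry y r k * entry x k s" if "k \<in> X" for k
    using diagonal_entry[OF xy(1)] diagonal_entry[OF xy(2)] by (cases "r = k"; cases "k = s") auto
  then show "entry (x o\<^sub>L y) r s = entry (y o\<^sub>L x) r s"
    using entry_comp[OF assms E block_alg_bops[OF xy(1)] xy(2)] entry_comp[OF assms E block_alg_bops[OF xy(2)] xy(1)]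
    by simp
qed (auto simp: block_alg_iff)

text \<open>Commuting with \<open>matunit r r\<close> forces the entries of row \<open>r\<close> off the diagonal to vanish.\<close>

lemma masa_diagonal:
  assumes X: "finite X" "equiv X E"
  shows "masa (block_alg (Id_on X)) (block_alg E)"
  unfolding masa_def
proof (intro conjI allI impI)
  show "star_algebra (block_alg (Id_on X))" by (rule star_algebra_block_alg[OF X(1) equiv_Id_on])
  show "abelian (block_alg (Id_on X))" by (rule abelian_diagonal[OF X(1)])
  show "block_alg (Id_on X) \<subseteq> block_alg E"
    using X(2) by (intro block_alg_mono) (auto simp: equiv_def refl_on_def)
  fix D' assume D': "star_algebra D' \<and> abelian D' \<and> block_alg (Id_on X) \<subseteq> D' \<and> D' \<subseteq> block_alg E"
  have "x \<in> block_alg (Id_on X)" if x: "x \<in> D'" for x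
  proof -
    have xE: "x \<in> block_alg E" using x D' by blast
    have "entry x r s = 0" if rs: "(r, s) \<notin> Id_on X" for r s
    proof (cases "(r, s) \<in> E")
      case True
      then have "r \<in> X" "r \<noteq> s" using rs equiv_subset[OF X(2)] by auto
      then have "matunit r r \<in> D'" using D' matunit_in_block_alg[of r r "Id_on X"] by auto
      then have "matunit r r o\<^sub>L x = x o\<^sub>L matunit r r" using D' x by (auto simp: abelian_def)
      then have "entry (matunit r r o\<^sub>L x) r s = entry (x o\<^sub>L matunit r r) r s" by simp
      then show ?thesis
        using \<open>r \<noteq> s\<close> block_alg_bops[OF xE] by (simp add: entry_matunit_comp entry_comp_matunit)
    qed (use xE in \<open>auto simp: block_alg_iff\<close>)
    then show ?thesis using block_alg_bops[OF xE] by (simp add: block_alg_iff)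
  qed
  then show "D' = block_alg (Id_on X)" using D' by blast
qed

lemma block_alg_unit:
  assumes X: "finite X" "equiv X E"
  shows "(\<Sum>k\<in>X. matunit k k) \<in> block_alg E"
    and "x \<in> block_alg E \<Longrightarrow> (\<Sum>k\<in>X. matunit k k) o\<^sub>L x = x"
    and "x \<in> block_alg E \<Longrightarrow> x o\<^sub>L (\<Sum>k\<in>X. matunit k k) = x"
proof -
  have E: "E \<subseteq> X \<times> X" by (rule equiv_subset[OF X(2)])
  have Erefl: "(k, k) \<in> E" if "k \<in> X" for k using X(2) that by (auto simp: equiv_def refl_on_def)
  show "(\<Sum>k\<in>X. matunit k k) \<in> block_alg E"
    by (intro csubspace_sum csubspace_block_alg matunit_in_block_alg Erefl)
  assume x: "x \<in> block_alg E"
  show "(\<Sum>k\<in>X. matunit k k) o\<^sub>L x = x"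
  proof (rule entry_eqI)
    fix r s
    show "entry ((\<Sum>k\<in>X. matunit k k) o\<^sub>L x) r s = entry x r s"
      using x X(1) E by (auto simp: oL_sum_left entry_sum entry_matunit_comp block_alg_iff)
  qed (use x in \<open>auto simp: block_alg_iff\<close>)
  show "x o\<^sub>L (\<Sum>k\<in>X. matunit k k) = x"
  proof (rule entry_eqI)
    fix r s
    show "entry (x o\<^sub>L (\<Sum>k\<in>X. matunit k k)) r s = entry x r s"
      using x X(1) E by (auto simp: oL_sum_right entry_sum entry_comp_matunit block_alg_iff)
  qed (use x in \<open>auto simp: block_alg_iff\<close>)
qed

text \<open>The off-diagonal matrix unit is recovered from the rank-one projections onto \<open>\<delta>\<^sub>r + w\<^sup>* \<delta>\<^sub>s\<close> with
  \<open>w = 1\<close> and \<open>w = \<i>\<close>, as in the polarisation identity.\<close>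

lemma spanned_by_projections_block_alg:
  assumes X: "finite X" "equiv X E"
  shows "spanned_by_projections (block_alg E)"
  unfolding spanned_by_projections_def
proof (intro allI impI)
  fix V assume V: "csubspace V \<and> {p \<in> block_alg E. projection p} \<subseteq> V"
  show "block_alg E \<subseteq> V"
  proof (rule block_alg_subset)
    show "finite E" by (rule finite_equiv[OF X])
    show "csubspace V" using V by blast
    fix r s assume rs: "(r, s) \<in> E"
    then have mem: "(r, r) \<in> E" "(s, s) \<in> E" "(s, r) \<in> E"
      using X(2) by (auto simp: equiv_def refl_on_def sym_def)
    have diag: "matunit r r \<in> V" "matunit s s \<in> V"
      using V mem projection_matunit matunit_in_block_alg by blast+
    show "matunit r s \<in> V"
    proof (cases "r = s")
      case False
      define q where "q w = op_scale (1/2)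
        (matunit r r + matunit s s + op_scale w (matunit r s) + op_scale (cnj w) (matunit s r))" for w
      have qb: "q w \<in> bops" for w by (simp add: q_def)
      have q_entry: "entry (q w) a b = (if a = r \<and> b = r \<or> a = s \<and> b = s then 1/2 else
          if a = r \<and> b = s then w/2 else if a = s \<and> b = r then cnj w/2 else 0)" for w a b
        using False by (auto simp: q_def entry_linear entry_matunit)
      have qV: "q w \<in> V" if w: "w * cnj w = 1" for w
      proof -
        have "q w \<in> block_alg E"
          unfolding q_def using rs mem
          by (intro csubspaceD[OF csubspace_block_alg] matunit_in_block_alg)
        moreover have "projection (q w)"
          unfolding projection_def
        proof (intro conjI qb)
          show "adj (q w) = q w"
            by (simp add: q_def adj_scale adj_add add.assoc add.commute[of "op_scale w _"])
          define u where "u = cnj w"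
          have uw: "w * u = 1" "u * w = 1" using w by (simp_all add: u_def mult.commute)
          have qw: "entry (q w) a b = (if a = r \<and> b = r \<or> a = s \<and> b = s then 1/2 else
            if a = r \<and> b = s then w/2 else if a = s \<and> b = r then u/2 else 0)" for a b
            unfolding u_def by (rule q_entry)
          have "q w o\<^sub>L q w = op_scale (1/2) ((matunit r r + matunit s s + op_scale w (matunit r s)
              + op_scale u (matunit s r)) o\<^sub>L q w)"
            unfolding u_def by (simp add: q_def)
          also have "\<dots> = q w"
          proof (rule entry_eqI)
            fix a b
            show "entry (op_scale (1/2) ((matunit r r + matunit s s + op_scale w (matunit r s)
              + op_scale u (matunit s r)) o\<^sub>L q w)) a b = entry (q w) a b"
              using False by (simp add: oL_add_left entry_linear entry_matunit_comp qw uw)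
          qed (simp_all add: qb)
          finally show "q w o\<^sub>L q w = q w" .
        qed
        ultimately show ?thesis using V by blast
      qed
      have "matunit r s = q 1 - op_scale \<i> (q \<i>) - op_scale ((1 - \<i>)/2) (matunit r r + matunit s s)"
        by (rule entry_eqI) (use False in \<open>auto simp: qb entry_linear entry_matunit q_entry algebra_simps diff_divide_distrib\<close>)
      also have "\<dots> \<in> V"
        using V by (intro csubspaceD qV diag) auto
      finally show ?thesis .
    qed (use diag in simp)
  qed
qed

lemma min_projection_diagonalD:
  assumes X: "finite X" and p: "min_projection (block_alg (Id_on X)) p"
  shows "\<exists>k\<in>X. p = matunit k k"
proof -
  have pD: "p \<in> block_alg (Id_on X)" "projection p" "p \<noteq> 0" using p by (auto simp: min_projection_def)
  then have pb: "p \<in> bops" "p o\<^sub>L p = p" by (auto simp: projection_def)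
  have "\<exists>k\<in>X. entry p k k \<noteq> 0"
  proof (rule ccontr)
    assume "\<not> ?thesis"
    then have "entry p r s = 0" for r s using pD(1) by (cases "(r, s) \<in> Id_on X") (auto simp: block_alg_iff)
    then show False using entry_zero[OF pb(1)] pD(3) by blast
  qed
  then obtain k where k: "k \<in> X" "entry p k k \<noteq> 0" by blast
  have "entry p k k = entry (p o\<^sub>L p) k k" using pb by simp
  also have "\<dots> = (\<Sum>l\<in>X. entry p k l * entry p l k)"
    by (rule entry_comp[OF X _ pb(1) pD(1)]) auto
  also have "\<dots> = (\<Sum>l\<in>X. if l = k then entry p k k * entry p k k else 0)"
    using diagonal_entry[OF pD(1)] by (intro sum.cong) auto
  also have "\<dots> = entry p k k * entry p k k" using X k by simp
  finally have one: "entry p k k = 1" using k(2) by simp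
  have "matunit k k o\<^sub>L p = matunit k k"
  proof (rule entry_eqI)
    fix r s
    show "entry (matunit k k o\<^sub>L p) r s = entry (matunit k k) r s"
      using diagonal_entry[OF pD(1)] one by (auto simp: entry_matunit_comp entry_matunit)
  qed (simp_all add: pb)
  moreover have "matunit k k \<in> block_alg (Id_on X)" using k(1) by (intro matunit_in_block_alg) auto
  ultimately have "matunit k k = p"
    using p projection_matunit matunit_nonzero unfolding min_projection_def by blast
  then show ?thesis using k(1) by blast
qed

lemma min_projection_matunit:
  assumes X: "finite X" and k: "k \<in> X"
  shows "min_projection (block_alg (Id_on X)) (matunit k k)"
  unfolding min_projection_def
proof (intro conjI ballI impI)
  show "matunit k k \<in> block_alg (Id_on X)" using k by (intro matunit_in_block_alg) auto
  fix q assume q: "q \<in> block_alg (Id_on X)" and "projection q \<and> q o\<^sub>L matunit k k = q"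
  then have qb: "q \<in> bops" "q o\<^sub>L q = q" "q o\<^sub>L matunit k k = q" by (auto simp: projection_def)
  have q_eq: "q = op_scale (entry q k k) (matunit k k)"
  proof (rule entry_eqI)
    fix r s
    have "entry q r s = entry (q o\<^sub>L matunit k k) r s" using qb by simp
    then show "entry q r s = entry (op_scale (entry q k k) (matunit k k)) r s"
      using diagonal_entry[OF q] qb(1) by (auto simp: entry_comp_matunit entry_linear entry_matunit)
  qed (use qb in auto)
  define c where "c = entry q k k"
  have qc: "q = op_scale c (matunit k k)" using q_eq unfolding c_def .
  then have "op_scale (c * c) (matunit k k) = op_scale c (matunit k k)"
    using qb(2) by (simp add: matunit_comp)
  then have "entry (op_scale (c * c) (matunit k k)) k k = entry (op_scale c (matunit k k)) k k" by simp
  then have "c = 0 \<or> c = 1" by (simp add: entry_linear entry_matunit)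
  then show "q = 0 \<or> q = matunit k k" using qc by auto
qed (simp_all add: projection_matunit)

lemma matrix_unit_matunit:
  assumes X: "finite X" "equiv X E" and kl: "(k, l) \<in> E"
  shows "matrix_unit (block_alg E) (block_alg (Id_on X)) (matunit k l)"
proof -
  have "k \<in> X" "l \<in> X" using equiv_subset[OF X(2)] kl by auto
  then show ?thesis
    unfolding matrix_unit_def
    using matunit_in_block_alg[OF kl] min_projection_matunit[OF X(1)] by (simp add: matunit_comp)
qed

text \<open>\<open>v\<close> is compressed by the rank-one projections \<open>v v\<^sup>*\<close> and \<open>v\<^sup>* v\<close> to a single entry.\<close>

lemma matrix_unitD:
  assumes X: "finite X" "equiv X E" and v: "matrix_unit (block_alg E) (block_alg (Id_on X)) v"
  shows "\<exists>k l c. (k, l) \<in> E \<and> v = op_scale c (matunit k l)"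
proof -
  have vb: "v \<in> bops" and vE: "v \<in> block_alg E" using v by (auto simp: matrix_unit_def block_alg_iff)
  obtain k l where kl: "k \<in> X" "v o\<^sub>L adj v = matunit k k" "l \<in> X" "adj v o\<^sub>L v = matunit l l"
    using v min_projection_diagonalD[OF X(1)] unfolding matrix_unit_def by blast
  have left: "matunit k k o\<^sub>L v = v"
  proof -
    have "(v - (matunit k k o\<^sub>L v)) o\<^sub>L adj (v - (matunit k k o\<^sub>L v)) = 0"
      using vb kl(2) by (simp add: adj_diff adj_comp oL_diff_left oL_diff_right oL_assoc)
        (simp add: oL_assoc[symmetric] matunit_comp)
    then show ?thesis using comp_adj_self_zero[of "v - (matunit k k o\<^sub>L v)"] vb by simp
  qed
  have right: "v o\<^sub>L matunit l l = v"
    using left kl vb by (metis oL_assoc)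
  have v_eq: "v = op_scale (entry v k l) (matunit k l)"
    using compress_matunit[OF vb, of k l] left right by simp
  moreover have "(k, l) \<in> E"
  proof (rule ccontr)
    assume "(k, l) \<notin> E"
    then have "entry v k l = 0" using vE by (simp add: block_alg_iff)
    then have "v = 0" using v_eq by simp
    then show False using kl(2) matunit_nonzero[of k k] by simp
  qed
  ultimately show ?thesis by blast
qed

section \<open>Direct sums of block diagonal algebras\<close>

lemma equiv_Union:
  assumes E: "\<And>i. i \<le> (d::nat) \<Longrightarrow> equiv (X i) (E i)"
    and disj: "\<And>i j. i \<le> d \<Longrightarrow> j \<le> d \<Longrightarrow> i \<noteq> j \<Longrightarrow> X i \<inter> X j = {}"
  shows "equiv (\<Union>i\<le>d. X i) (\<Union>i\<le>d. E i)"
proof (rule equivI)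
  show "(\<Union>i\<le>d. E i) \<subseteq> (\<Union>i\<le>d. X i) \<times> (\<Union>i\<le>d. X i)"
    using equiv_subset[OF E] by fastforce
  show "refl_on (\<Union>i\<le>d. X i) (\<Union>i\<le>d. E i)"
    using E by (fastforce simp: equiv_def refl_on_def)
  show "sym (\<Union>i\<le>d. E i)"
    using E by (fastforce simp: equiv_def sym_def)
  show "trans (\<Union>i\<le>d. E i)"
  proof (rule transI)
    fix x y z assume "(x, y) \<in> (\<Union>i\<le>d. E i)" "(y, z) \<in> (\<Union>i\<le>d. E i)"
    then obtain i j where ij: "i \<le> d" "(x, y) \<in> E i" "j \<le> d" "(y, z) \<in> E j" by auto
    then have "y \<in> X i \<inter> X j" using equiv_subset[OF E] by blast
    then have "i = j" using disj ij by blast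
    then have "(x, z) \<in> E i" using ij E[OF ij(1)] by (meson equiv_def transD)
    then show "(x, z) \<in> (\<Union>i\<le>d. E i)" using ij by blast
  qed
qed

lemma dsum_block_alg:
  assumes fin: "\<And>i. i \<le> d \<Longrightarrow> finite (E i)"
    and disj: "\<And>i j. i \<le> d \<Longrightarrow> j \<le> d \<Longrightarrow> i \<noteq> j \<Longrightarrow> E i \<inter> E j = {}"
  shows "dsum d (\<lambda>i. block_alg (E i)) = block_alg (\<Union>i\<le>d. E i)"
proof
  show "dsum d (\<lambda>i. block_alg (E i)) \<subseteq> block_alg (\<Union>i\<le>d. E i)"
  proof
    fix y assume "y \<in> dsum d (\<lambda>i. block_alg (E i))"
    then obtain x where x: "y = (\<Sum>i\<le>d. x i)" "\<And>i. i \<le> d \<Longrightarrow> x i \<in> block_alg (E i)"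
      by (auto simp: dsum_def)
    have "x i \<in> block_alg (\<Union>i\<le>d. E i)" if "i \<le> d" for i
      using x(2)[OF that] block_alg_mono[of "E i" "\<Union>i\<le>d. E i"] that by blast
    then show "y \<in> block_alg (\<Union>i\<le>d. E i)"
      unfolding x(1) by (intro csubspace_sum csubspace_block_alg) simp
  qed
  show "block_alg (\<Union>i\<le>d. E i) \<subseteq> dsum d (\<lambda>i. block_alg (E i))"
  proof
    fix y assume y: "y \<in> block_alg (\<Union>i\<le>d. E i)"
    define x where "x i = (\<Sum>(r, s)\<in>E i. op_scale (entry y r s) (matunit r s))" for i
    have "y = (\<Sum>(r, s)\<in>(\<Union>i\<le>d. E i). op_scale (entry y r s) (matunit r s))"
      by (rule block_expand[OF _ y]) (use fin in simp)
    also have "\<dots> = (\<Sum>i\<le>d. x i)"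
      unfolding x_def by (rule sum.UNION_disjoint) (use fin disj in auto)
    finally have "y = (\<Sum>i\<le>d. x i)" .
    moreover have "x i \<in> block_alg (E i)" for i
      unfolding x_def
      by (intro csubspace_sum csubspace_block_alg) (auto intro!: csubspaceD[OF csubspace_block_alg] matunit_in_block_alg)
    ultimately show "y \<in> dsum d (\<lambda>i. block_alg (E i))" by (auto simp: dsum_def)
  qed
qed

lemma block_alg_orthogonal:
  assumes "finite X" "finite Y" "E \<subseteq> X \<times> X" "E' \<subseteq> Y \<times> Y" "X \<inter> Y = {}" "x \<in> block_alg E" "y \<in> block_alg E'"
  shows "x o\<^sub>L y = 0"
proof (rule entry_zero)
  fix r s
  have "entry x r k = 0" if "k \<in> Y" for k
  proof (rule block_alg_entry[OF assms(6)])
    show "(r, k) \<notin> E" using assms(3,5) that by auto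
  qed
  then show "entry (x o\<^sub>L y) r s = 0"
    using entry_comp[OF assms(2,4) block_alg_bops[OF assms(6)] assms(7)] by simp
qed (use assms in \<open>auto simp: block_alg_iff\<close>)

section \<open>Tensor products with the complex numbers\<close>

text \<open>The tensor product of the square-summable sequences with \<open>\<complex>\<close> is modelled by the same space of
  sequences.\<close>

lemma tensor_vec_complex: "tensor_vec \<xi> \<eta> = \<eta> *\<^sub>C \<xi>" for \<eta> :: complex
proof -
  have "(\<lambda>n. ell2_nth \<xi> n *\<^sub>C \<eta>) = ell2_nth (\<eta> *\<^sub>C \<xi>)"
    by (rule ext) (simp add: ell2_nth_linear scaleC_complex_def mult.commute)
  then show ?thesis unfolding tensor_vec_def by (simp add: ell2_nth_inverse)
qed

lemma tensor_op_complex: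
  assumes x: "x \<in> bops"
  shows "tensor_op x (blinfun_mult_right c :: complex op) = op_scale c x"
  unfolding tensor_op_def
proof (rule the_equality)
  show "op_scale c x \<in> bops \<and> (\<forall>\<xi> \<eta>. blinfun_apply (op_scale c x) (tensor_vec \<xi> \<eta>)
      = tensor_vec (blinfun_apply x \<xi>) (blinfun_apply (blinfun_mult_right c) \<eta>))"
    using x by (simp add: tensor_vec_complex bops_scaleC scaleC_scaleC)
  fix T assume "T \<in> bops \<and> (\<forall>\<xi> \<eta>. blinfun_apply T (tensor_vec \<xi> \<eta>)
      = tensor_vec (blinfun_apply x \<xi>) (blinfun_apply (blinfun_mult_right c :: complex op) \<eta>))"
  then have "blinfun_apply T (tensor_vec \<xi> (1::complex)) = tensor_vec (blinfun_apply x \<xi>) (c * 1)" for \<xi>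
    by (metis blinfun_mult_right.rep_eq)
  then show "T = op_scale c x"
    by (intro blinfun_eqI) (simp add: tensor_vec_complex)
qed

lemma csubspace_span:
  assumes "csubspace V"
  shows "span V = V"
proof (rule span_eq_iff[THEN iffD2])
  show "subspace V"
    using csubspaceD[OF assms] by (auto simp: subspace_def op_scale_of_real[symmetric])
qed

lemma tensor_alg_complex:
  assumes "csubspace F" "closed F" "F \<subseteq> bops"
  shows "tensor_alg F complex_alg = F"
proof -
  have "{tensor_op x b | x b. x \<in> F \<and> b \<in> complex_alg} = F"
  proof (intro subset_antisym subsetI)
    fix y assume "y \<in> {tensor_op x b | x b. x \<in> F \<and> b \<in> complex_alg}"
    then show "y \<in> F"
      using assms csubspaceD[OF assms(1)] by (auto simp: complex_alg_def tensor_op_complex subset_iff)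
  next
    fix y assume y: "y \<in> F"
    then have "y = tensor_op y (blinfun_mult_right 1 :: complex op)"
      using assms by (subst tensor_op_complex) auto
    then show "y \<in> {tensor_op x b | x b. x \<in> F \<and> b \<in> complex_alg}"
      using y unfolding complex_alg_def by blast
  qed
  then show ?thesis
    unfolding tensor_alg_def using assms by (simp add: csubspace_span)
qed

lemma tensor_alg_block_alg: "tensor_alg (block_alg E) complex_alg = block_alg E"
  by (rule tensor_alg_complex) (auto simp: csubspace_block_alg closed_block_alg block_alg_iff)

section \<open>Normalisers\<close>

lemma normaliser_scale:
  assumes A: "csubspace A" "A \<subseteq> bops" and D: "csubspace D" "D \<subseteq> bops" and a: "a \<in> normalisers A D"
  shows "op_scale c a \<in> normalisers A D"
proof -
  have ab: "a \<in> A" "a \<in> bops" "adj a \<in> bops" using a A by (auto simp: normalisers_def)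
  have "op_scale c a o\<^sub>L x o\<^sub>L adj (op_scale c a) = op_scale (c * cnj c) (a o\<^sub>L x o\<^sub>L adj a)"
    "adj (op_scale c a) o\<^sub>L x o\<^sub>L op_scale c a = op_scale (cnj c * c) (adj a o\<^sub>L x o\<^sub>L a)"
    if "x \<in> D" for x
    using that ab D by (simp_all add: adj_scale subset_iff mult.commute)
  then show ?thesis
    using a ab csubspaceD[OF A(1)] csubspaceD[OF D(1)] by (simp add: normalisers_def)
qed

text \<open>If the summands have orthogonal sources and orthogonal ranges relative to \<open>D\<close>, then only the
  diagonal terms of \<open>a x a\<^sup>*\<close> survive.\<close>

lemma normaliser_sum:
  assumes A: "csubspace A" "A \<subseteq> bops" and D: "csubspace D"
    and f: "\<And>p. p \<in> P \<Longrightarrow> f p \<in> normalisers A D"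
    and zero: "\<And>p q x. p \<in> P \<Longrightarrow> q \<in> P \<Longrightarrow> p \<noteq> q \<Longrightarrow> x \<in> D \<Longrightarrow> f p o\<^sub>L x o\<^sub>L adj (f q) = 0"
      "\<And>p q x. p \<in> P \<Longrightarrow> q \<in> P \<Longrightarrow> p \<noteq> q \<Longrightarrow> x \<in> D \<Longrightarrow> adj (f p) o\<^sub>L x o\<^sub>L f q = 0"
  shows "(\<Sum>p\<in>P. f p) \<in> normalisers A D"
proof -
  have fA: "f p \<in> A" "f p \<in> bops" if "p \<in> P" for p
    using f[OF that] A by (auto simp: normalisers_def)
  have adj: "adj (\<Sum>p\<in>P. f p) = (\<Sum>p\<in>P. adj (f p))"
    using fA by (simp add: adj_sum)
  have mem: "(\<Sum>p\<in>P. \<Sum>q\<in>P. g q p) \<in> D"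
    if "\<And>p q. p \<in> P \<Longrightarrow> q \<in> P \<Longrightarrow> g p q \<in> D" for g :: "_ \<Rightarrow> _ \<Rightarrow> 'a op"
    using that by (intro csubspace_sum D) auto
  have "(\<Sum>p\<in>P. f p) o\<^sub>L x o\<^sub>L adj (\<Sum>p\<in>P. f p) \<in> D" if x: "x \<in> D" for x
  proof -
    have "f p o\<^sub>L x o\<^sub>L adj (f q) \<in> D" if "p \<in> P" "q \<in> P" for p q
      using f[OF that(1)] zero(1)[OF that] x csubspaceD(1)[OF D]
      by (cases "p = q") (auto simp: normalisers_def)
    then show ?thesis
      unfolding adj oL_sum_left oL_sum_right by (rule mem)
  qed
  moreover have "adj (\<Sum>p\<in>P. f p) o\<^sub>L x o\<^sub>L (\<Sum>p\<in>P. f p) \<in> D" if x: "x \<in> D" for x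
  proof -
    have "adj (f p) o\<^sub>L x o\<^sub>L f q \<in> D" if "p \<in> P" "q \<in> P" for p q
      using f[OF that(1)] zero(2)[OF that] x csubspaceD(1)[OF D]
      by (cases "p = q") (auto simp: normalisers_def)
    then show ?thesis
      unfolding adj oL_sum_left oL_sum_right by (rule mem)
  qed
  moreover have "(\<Sum>p\<in>P. f p) \<in> A" using fA by (intro csubspace_sum A)
  ultimately show ?thesis by (simp add: normalisers_def)
qed

text \<open>The entry of \<open>n\<^sup>* e n\<close> at \<open>(s, t)\<close>, where \<open>e\<close> is the diagonal matrix unit at \<open>r\<close>, is the product of the
  conjugate of \<open>n\<^sub>r\<^sub>s\<close> with \<open>n\<^sub>r\<^sub>t\<close>, and it lies off the diagonal.\<close>

lemma normaliser_diagonal_row: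
  assumes X: "finite X" "equiv X E" and n: "n \<in> normalisers (block_alg E) (block_alg (Id_on X))"
    and r: "r \<in> X" and st: "s \<noteq> t"
  shows "entry n r s * entry n r t = 0"
proof -
  have nE: "n \<in> block_alg E" and nb: "n \<in> bops" using n by (auto simp: normalisers_def block_alg_iff)
  have "matunit r r \<in> block_alg (Id_on X)" using r by (intro matunit_in_block_alg) auto
  then have "adj n o\<^sub>L matunit r r o\<^sub>L n \<in> block_alg (Id_on X)" using n by (simp add: normalisers_def)
  then have "entry (adj n o\<^sub>L matunit r r o\<^sub>L n) s t = 0" using st by (rule diagonal_entry)
  moreover have "entry (adj n o\<^sub>L matunit r r o\<^sub>L n) s t = (\<Sum>k\<in>X. entry (adj n o\<^sub>L matunit r r) s k * entry n k t)"
    using nb by (intro entry_comp[OF X(1) equiv_subset[OF X(2)] _ nE]) simp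
  moreover have "\<dots> = (\<Sum>k\<in>X. if k = r then cnj (entry n r s) * entry n r t else 0)"
    using nb by (intro sum.cong) (auto simp: entry_comp_matunit entry_adj)
  moreover have "\<dots> = cnj (entry n r s) * entry n r t" using X(1) r by simp
  ultimately show ?thesis by simp
qed

lemma normalisers_adj: "n \<in> normalisers F D \<Longrightarrow> star_algebra F \<Longrightarrow> adj n \<in> normalisers F D"
  using star_algebraD[of F] by (auto simp: normalisers_def)

lemma normaliser_diagonal_column:
  assumes X: "finite X" "equiv X E" and n: "n \<in> normalisers (block_alg E) (block_alg (Id_on X))"
    and s: "s \<in> X" and rt: "r \<noteq> t"
  shows "entry n r s * entry n t s = 0"
proof -
  have "n \<in> bops" using n by (auto simp: normalisers_def block_alg_iff)
  then show ?thesis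
    using normaliser_diagonal_row[OF X normalisers_adj[OF n star_algebra_block_alg[OF X]] s rt]
    by (simp add: entry_adj flip: complex_cnj_mult)
qed

section \<open>From generalised diagonal dimension to diagonal dimension\<close>

context order_zero_spanned
begin

lemma phi_pi: "a \<in> F \<Longrightarrow> b \<in> F \<Longrightarrow> \<phi> a o\<^sub>L \<pi> b = \<phi> (a o\<^sub>L b)"
proof -
  assume ab: "a \<in> F" "b \<in> F"
  have "\<phi> a o\<^sub>L \<pi> b = \<pi> a o\<^sub>L (h o\<^sub>L \<pi> b)" using pi_h[OF ab(1)] by (simp add: oL_assoc[symmetric])
  then show ?thesis using ab by (simp add: h_pi pi_phi)
qed

text \<open>The product is \<open>\<phi> a (\<pi> p x \<pi> q) \<phi> b\<close>, and the middle factor is \<open>x \<pi> (p q)\<close>.\<close>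

lemma orthogonal_supports:
  assumes F: "a \<in> F" "b \<in> F" "p \<in> F" "q \<in> F" and pq: "p o\<^sub>L q = 0"
    and comm: "\<pi> p o\<^sub>L x = x o\<^sub>L \<pi> p"
  shows "\<phi> (a o\<^sub>L p) o\<^sub>L x o\<^sub>L \<phi> (q o\<^sub>L b) = 0"
proof -
  have "\<phi> (a o\<^sub>L p) o\<^sub>L x o\<^sub>L \<phi> (q o\<^sub>L b) = \<phi> a o\<^sub>L (\<pi> p o\<^sub>L x) o\<^sub>L (\<pi> q o\<^sub>L \<phi> b)"
    by (simp add: phi_pi[OF F(1,3), symmetric] pi_phi[OF F(4,2), symmetric] oL_assoc)
  also have "\<dots> = \<phi> a o\<^sub>L x o\<^sub>L (\<pi> p o\<^sub>L \<pi> q) o\<^sub>L \<phi> b"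
    by (simp add: comm oL_assoc)
  also have "\<pi> p o\<^sub>L \<pi> q = 0"
    using F pi_mult[of p q] pq op_linear_on_zero[OF pi_linear star_algebraD(2)[OF star]] by simp
  finally show ?thesis by simp
qed

end

lemma order_zero_spanned_block_alg:
  assumes X: "finite X" "equiv X E" and oz: "order_zero (block_alg E) A \<phi>" and A: "A \<subseteq> bops"
  shows "order_zero_spanned (block_alg E) A \<phi> (\<Sum>k\<in>X. matunit k k)"
proof unfold_locales
  show "star_algebra (block_alg E)" by (rule star_algebra_block_alg[OF X])
  show "(\<Sum>k\<in>X. matunit k k) \<in> block_alg E" by (rule block_alg_unit(1)[OF X])
  show "spanned_by_projections (block_alg E)" by (rule spanned_by_projections_block_alg[OF X])
  show "cp_map (block_alg E) A \<phi>" using oz by (simp add: order_zero_def)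
  show "A \<subseteq> bops" by (rule A)
  show "\<phi> a o\<^sub>L \<phi> b = 0" if "a \<in> block_alg E" "b \<in> block_alg E" "pos_op a" "pos_op b" "a o\<^sub>L b = 0" for a b
    using oz that by (simp add: order_zero_def)
qed (use block_alg_unit[OF X] in auto)

text \<open>The normaliser \<open>n\<close> is the sum of its entries times matrix units. Two distinct nonzero entries lie in
  different rows and different columns, so the cross terms are killed by \<open>orthogonal_supports\<close>.\<close>

lemma normaliser_image_block_alg:
  assumes X: "finite X" "equiv X E" and oz: "order_zero (block_alg E) A \<phi>"
    and A: "star_algebra A" and D: "star_algebra D"
    and units: "\<And>k l. (k, l) \<in> E \<Longrightarrow> \<phi> (matunit k l) \<in> normalisers A D"
    and supp: "\<And>\<pi> k. supporting_hom (block_alg E) \<phi> \<pi> \<Longrightarrow> k \<in> X \<Longrightarrow> \<pi> (matunit k k) \<in> commutant D"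
    and n: "n \<in> normalisers (block_alg E) (block_alg (Id_on X))"
  shows "\<phi> n \<in> normalisers A D"
proof -
  have Ab: "A \<subseteq> bops" "csubspace A" and Db: "D \<subseteq> bops" "csubspace D"
    using A D star_algebra_csubspace by (auto simp: star_algebra_def)
  interpret order_zero_spanned "block_alg E" A \<phi> "\<Sum>k\<in>X. matunit k k"
    by (rule order_zero_spanned_block_alg[OF X oz Ab(1)])
  have comm: "\<pi> (matunit k k) o\<^sub>L x = x o\<^sub>L \<pi> (matunit k k)" if "k \<in> X" "x \<in> D" for k x
    using supp[OF supporting_hom_exists that(1)] that(2) by (simp add: commutant_def)
  have mem: "matunit r s \<in> block_alg E" "matunit s r \<in> block_alg E" "matunit r r \<in> block_alg E"
      "matunit s s \<in> block_alg E" "r \<in> X" "s \<in> X" if "(r, s) \<in> E" for r s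
  proof -
    have "(s, r) \<in> E" "(r, r) \<in> E" "(s, s) \<in> E" "r \<in> X" "s \<in> X"
      using X(2) that equiv_subset[OF X(2)] by (auto simp: equiv_def refl_on_def sym_def)
    then show "matunit r s \<in> block_alg E" "matunit s r \<in> block_alg E" "matunit r r \<in> block_alg E"
      "matunit s s \<in> block_alg E" "r \<in> X" "s \<in> X"
      using that by (auto intro: matunit_in_block_alg)
  qed
  have adj_phi: "adj (\<phi> (matunit r s)) = \<phi> (matunit s r)" if "(r, s) \<in> E" for r s
    using map_adj[OF mem(1)[OF that]] by simp
  have cross: "\<phi> (matunit r s) o\<^sub>L x o\<^sub>L \<phi> (matunit t u) = 0"
    if "(r, s) \<in> E" "(t, u) \<in> E" "s \<noteq> t" "x \<in> D" for r s t u x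
    using orthogonal_supports[of "matunit r s" "matunit t u" "matunit s s" "matunit t t" x]
      mem[OF that(1)] mem[OF that(2)] comm[of s x] that by (simp add: matunit_comp)
  define f where "f p = op_scale (entry n (fst p) (snd p)) (\<phi> (matunit (fst p) (snd p)))" for p
  have nE: "n \<in> block_alg E" using n by (simp add: normalisers_def)
  have "\<phi> n = \<phi> (\<Sum>p\<in>E. op_scale (entry n (fst p) (snd p)) (matunit (fst p) (snd p)))"
    using block_expand[OF finite_equiv[OF X] nE] by (simp add: case_prod_beta)
  also have "\<dots> = (\<Sum>p\<in>E. f p)"
    unfolding f_def
    using mem by (subst op_linear_on_sum[OF linear csubspace_block_alg])
      (auto intro!: sum.cong csubspaceD[OF csubspace_block_alg] simp: op_linear_onD(2)[OF linear])
  also have "\<dots> \<in> normalisers A D"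
  proof (rule normaliser_sum[OF Ab(2,1) Db(2)])
    fix p assume p: "p \<in> E"
    then show "f p \<in> normalisers A D"
      unfolding f_def by (intro normaliser_scale Ab Db units) simp
    fix q x assume q: "q \<in> E" and pq: "p \<noteq> q" and x: "x \<in> D"
    obtain r s t u where rs: "p = (r, s)" and tu: "q = (t, u)" by (cases p; cases q)
    have E: "(r, s) \<in> E" "(t, u) \<in> E" using p q rs tu by auto
    have b: "\<phi> (matunit r s) \<in> bops" "\<phi> (matunit t u) \<in> bops" "\<phi> (matunit s r) \<in> bops" "\<phi> (matunit u t) \<in> bops"
      using E mem by (auto intro!: image_bops)
    have xb: "x \<in> bops" using x Db by auto
    have E': "(s, r) \<in> E" "(u, t) \<in> E" using E X(2) by (auto simp: equiv_def sym_def)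
    show "f p o\<^sub>L x o\<^sub>L adj (f q) = 0"
    proof (cases "s = u")
      case True
      then have "entry n r s * entry n t u = 0"
        using normaliser_diagonal_column[OF X n, of s r t] pq rs tu mem[OF E(1)] by auto
      then show ?thesis by (auto simp: f_def rs tu)
    next
      case False
      then show ?thesis
        using cross[OF E(1) E'(2) _ x] b xb
        by (simp add: f_def rs tu adj_scale adj_phi[OF E(2)])
    qed
    show "adj (f p) o\<^sub>L x o\<^sub>L f q = 0"
    proof (cases "r = t")
      case True
      then have "entry n r s * entry n t u = 0"
        using normaliser_diagonal_row[OF X n, of r s u] pq rs tu mem[OF E(1)] by auto
      then show ?thesis by (auto simp: f_def rs tu)
    next
      case False
      then show ?thesis
        using cross[OF E'(1) E(2) _ x] b xb
        by (simp add: f_def rs tu adj_scale adj_phi[OF E(1)])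
    qed
  qed
  finally show ?thesis .
qed

lemma dsum_cong: "(\<And>i. i \<le> d \<Longrightarrow> F i = G i) \<Longrightarrow> dsum d F = dsum d G"
  by (simp add: dsum_def)

lemma mult_right_one: "blinfun_mult_right 1 = (id_blinfun :: complex op)"
  by (rule blinfun_eqI) simp

lemma approx_unit_complex: "approx_unit (principal {id_blinfun}) complex_alg"
proof -
  have "id_blinfun \<in> complex_alg"
    using mult_right_one by (auto simp: complex_alg_def intro: range_eqI[of _ _ 1])
  moreover have "pos_op (id_blinfun :: complex op)"
    by (simp add: pos_op_def cinner_self_nonneg)
  moreover have "id_blinfun o\<^sub>L a = a" "a o\<^sub>L id_blinfun = a" for a :: "complex op"
    by (auto intro!: blinfun_eqI)
  ultimately show ?thesis
    unfolding approx_unit_def eventually_principal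
    by (auto intro!: tendsto_eventually simp: eventually_principal norm_blinfun_id_le principal_eq_bot_iff)
qed

lemma tendsto_principal_singleton_iff:
  "((f \<longlongrightarrow> l) (principal {x})) \<longleftrightarrow> f x = (l :: 'a::t2_space)"
proof
  assume "(f \<longlongrightarrow> l) (principal {x})"
  then show "f x = l"
    using tendsto_unique[of "principal {x}" f "f x" l] tendsto_principal_singleton[of f x]
    by (simp add: principal_eq_bot_iff)
qed (use tendsto_principal_singleton[of f x] in simp)

text \<open>The same algebras and maps serve for both dimensions. The commutation condition is used for the
  one-point approximate unit of the complex numbers, where the limit is the value itself.\<close>

lemma gen_diag_dim_le_imp_diag_dim_le:
  fixes A D :: "'h::chilbert_space op set"
  assumes A: "cstar_algebra A" and D: "cstar_algebra D"
    and gen: "gen_diag_dim_le D A complex_alg d"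
  shows "diag_dim_le D A d"
  unfolding diag_dim_le_def
proof (intro allI impI)
  fix \<F> :: "'h op set" and \<epsilon> :: real
  assume fe: "finite \<F> \<and> \<F> \<subseteq> A \<and> 0 < \<epsilon>"
  have As: "star_algebra A" and Ds: "star_algebra D" using A D by (auto simp: cstar_algebra_def)
  from gen fe obtain X E and F DF :: "nat \<Rightarrow> complex ell2 op set" and \<psi> \<phi> where
    blocks: "\<forall>i\<le>d. finite (X i) \<and> equiv (X i) (E i) \<and> F i = block_alg (E i) \<and> DF i = block_alg (Id_on (X i))"
    and disj: "\<forall>i\<le>d. \<forall>j\<le>d. i \<noteq> j \<longrightarrow> X i \<inter> X j = {}"
    and cp: "cp_map A (tensor_alg (dsum d F) complex_alg) \<psi>" "cp_map (tensor_alg (dsum d F) complex_alg) A \<phi>"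
    and psi: "contractive_on A \<psi>" and approx: "\<forall>a\<in>\<F>. norm (\<phi> (\<psi> a) - a) < \<epsilon>"
    and oz: "\<forall>i\<le>d. contractive_on (tensor_alg (F i) complex_alg) \<phi> \<and> order_zero (tensor_alg (F i) complex_alg) A \<phi>"
    and psiD: "\<psi> ` D \<subseteq> tensor_alg (dsum d DF) complex_alg"
    and nor: "\<forall>i\<le>d. \<phi> ` tensor_alg (DF i) complex_alg \<subseteq> normalisers A D \<and>
        (\<forall>v. matrix_unit (F i) (DF i) v \<longrightarrow> (\<forall>b\<in>complex_alg. \<phi> (tensor_op v b) \<in> normalisers A D))"
    and comm: "\<forall>i\<le>d. \<forall>\<pi> U v.
        supporting_hom (tensor_alg (F i) complex_alg) \<phi> \<pi> \<and> approx_unit U complex_alg \<and> min_projection (DF i) v \<longrightarrow>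
        (\<exists>T\<in>commutant D. \<forall>\<xi>.
          ((\<lambda>u. blinfun_apply (\<pi> (tensor_op v u)) \<xi>) \<longlongrightarrow> blinfun_apply T \<xi>) U)"
    unfolding gen_diag_dim_le_def by (elim allE[of _ \<F>] allE[of _ \<epsilon>] impE exE conjE) blast
  have X: "finite (X i)" "equiv (X i) (E i)" and Fi: "F i = block_alg (E i)" "DF i = block_alg (Id_on (X i))"
    if "i \<le> d" for i using blocks that by auto
  let ?X = "\<Union>i\<le>d. X i" and ?E = "\<Union>i\<le>d. E i"
  have Xd: "X i \<inter> X j = {}" if "i \<le> d" "j \<le> d" "i \<noteq> j" for i j using disj that by blast
  have disjE: "E i \<inter> E j = {}" "Id_on (X i) \<inter> Id_on (X j) = {}" if "i \<le> d" "j \<le> d" "i \<noteq> j" for i j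
    using equiv_subset[OF X(2)[OF that(1)]] equiv_subset[OF X(2)[OF that(2)]] Xd[OF that] by auto
  have dF: "dsum d F = block_alg ?E"
  proof -
    have "dsum d F = dsum d (\<lambda>i. block_alg (E i))" by (rule dsum_cong) (rule Fi(1))
    also have "\<dots> = block_alg ?E"
      by (rule dsum_block_alg) (use finite_equiv[OF X] disjE in auto)
    finally show ?thesis .
  qed
  have dDF: "dsum d DF = block_alg (Id_on ?X)"
  proof -
    have "dsum d DF = dsum d (\<lambda>i. block_alg (Id_on (X i)))" by (rule dsum_cong) (rule Fi(2))
    also have "\<dots> = block_alg (\<Union>i\<le>d. Id_on (X i))"
    proof (rule dsum_block_alg)
      show "finite (Id_on (X i))" if "i \<le> d" for i
        by (rule finite_equiv[OF X(1)[OF that] equiv_Id_on])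
    qed (use disjE in auto)
    also have "(\<Union>i\<le>d. Id_on (X i)) = Id_on ?X" by auto
    finally show ?thesis .
  qed
  have UX: "finite ?X" "equiv ?X ?E"
    using X(1) equiv_Union[of d X E] X(2) Xd by auto
  have t: "tensor_alg (dsum d F) complex_alg = dsum d F" "tensor_alg (dsum d DF) complex_alg = dsum d DF"
    by (simp_all add: dF dDF tensor_alg_block_alg)
  have ti: "tensor_alg (F i) complex_alg = F i" "tensor_alg (DF i) complex_alg = DF i" if "i \<le> d" for i
    using Fi[OF that] by (simp_all add: tensor_alg_block_alg)
  show "\<exists>(F :: nat \<Rightarrow> complex ell2 op set) (DF :: nat \<Rightarrow> complex ell2 op set) \<psi> \<phi>.
      (\<forall>i\<le>d. cstar_algebra (F i) \<and> finite_dim (F i)) \<and> orthogonal_algs d F \<and>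
      (\<forall>i\<le>d. star_algebra (DF i) \<and> DF i \<subseteq> F i) \<and> masa (dsum d DF) (dsum d F) \<and>
      cp_map A (dsum d F) \<psi> \<and> cp_map (dsum d F) A \<phi> \<and>
      contractive_on A \<psi> \<and>
      (\<forall>a\<in>\<F>. norm (\<phi> (\<psi> a) - a) < \<epsilon>) \<and>
      (\<forall>i\<le>d. contractive_on (F i) \<phi> \<and> order_zero (F i) A \<phi>) \<and>
      \<psi> ` D \<subseteq> dsum d DF \<and>
      (\<forall>i\<le>d. \<phi> ` normalisers (F i) (DF i) \<subseteq> normalisers A D)"
  proof (rule exI[of _ F], rule exI[of _ DF], rule exI[of _ \<psi>], rule exI[of _ \<phi>],
      intro conjI allI impI)
    fix i assume i: "i \<le> d"
    show "cstar_algebra (F i)"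
      unfolding Fi(1)[OF i] cstar_algebra_def
      using star_algebra_block_alg[OF X[OF i]] closed_block_alg by blast
    show "finite_dim (F i)"
      unfolding Fi(1)[OF i] using finite_dim_block_alg finite_equiv[OF X[OF i]] by blast
    show "star_algebra (DF i)"
      unfolding Fi(2)[OF i] by (rule star_algebra_block_alg[OF X(1)[OF i] equiv_Id_on])
    show "DF i \<subseteq> F i"
      unfolding Fi[OF i] using masa_diagonal[OF X[OF i]] by (simp add: masa_def)
    show "contractive_on (F i) \<phi>" "order_zero (F i) A \<phi>"
      using oz i ti(1)[OF i] by auto
    show "\<phi> ` normalisers (F i) (DF i) \<subseteq> normalisers A D"
      unfolding Fi[OF i]
    proof (rule image_subsetI, rule normaliser_image_block_alg[OF X[OF i] _ As Ds])
      show "order_zero (block_alg (E i)) A \<phi>" using oz i ti(1)[OF i] Fi(1)[OF i] by auto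
      fix k l assume "(k, l) \<in> E i"
      then have "matrix_unit (F i) (DF i) (matunit k l)"
        unfolding Fi[OF i] by (rule matrix_unit_matunit[OF X[OF i]])
      moreover have "(blinfun_mult_right 1 :: complex op) \<in> complex_alg" by (simp add: complex_alg_def)
      ultimately have "\<phi> (tensor_op (matunit k l) (blinfun_mult_right 1 :: complex op)) \<in> normalisers A D"
        using nor i by blast
      then show "\<phi> (matunit k l) \<in> normalisers A D" by (simp add: tensor_op_complex)
    next
      fix \<pi> k assume pi: "supporting_hom (block_alg (E i)) \<phi> \<pi>" and k: "k \<in> X i"
      have "supporting_hom (tensor_alg (F i) complex_alg) \<phi> \<pi>" using pi ti(1)[OF i] Fi(1)[OF i] by simp
      moreover have "min_projection (DF i) (matunit k k)"
        unfolding Fi(2)[OF i] by (rule min_projection_matunit[OF X(1)[OF i] k])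
      ultimately obtain T where T: "T \<in> commutant D" "\<forall>\<xi>.
          ((\<lambda>u. blinfun_apply (\<pi> (tensor_op (matunit k k) u)) \<xi>) \<longlongrightarrow> blinfun_apply T \<xi>) (principal {id_blinfun})"
        using comm i approx_unit_complex by blast
      have "tensor_op (matunit k k) (id_blinfun :: complex op) = matunit k k"
        using tensor_op_complex[of "matunit k k" 1] by (simp add: mult_right_one)
      then have "\<pi> (matunit k k) = T"
        using T(2) by (intro blinfun_eqI) (simp add: tendsto_principal_singleton_iff)
      then show "\<pi> (matunit k k) \<in> commutant D" using T(1) by simp
    qed
  next
    show "orthogonal_algs d F"
      unfolding orthogonal_algs_def
    proof (intro allI impI ballI)
      fix i j x y assume "i \<le> d" "j \<le> d" "i \<noteq> j" "x \<in> F i" "y \<in> F j"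
      then show "x o\<^sub>L y = 0"
        using block_alg_orthogonal[OF X(1) X(1) equiv_subset[OF X(2)] equiv_subset[OF X(2)] Xd, of i j x y] Fi(1)
        by simp
    qed
    show "masa (dsum d DF) (dsum d F)"
      unfolding dF dDF by (rule masa_diagonal[OF UX])
    show "\<forall>a\<in>\<F>. norm (\<phi> (\<psi> a) - a) < \<epsilon>" by (rule approx)
  qed (use cp psi psiD t in auto)
qed

section \<open>Minimal projections in finite-dimensional algebras\<close>

lemma subspace_eq_of_dim_le:
  fixes S T :: "'a::real_vector set"
  assumes S: "subspace S" and ST: "S \<subseteq> T" and W: "finite W" "T \<subseteq> span W" and dim: "dim T \<le> dim S"
  shows "S = T"
proof (rule ccontr)
  assume "S \<noteq> T"
  then obtain t where t: "t \<in> T" "t \<notin> S" using ST by blast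
  obtain B where B: "B \<subseteq> S" "independent B" "S \<subseteq> span B" "card B = dim S" by (rule basis_exists)
  obtain C where C: "C \<subseteq> T" "independent C" "T \<subseteq> span C" "card C = dim T" by (rule basis_exists)
  have fin: "finite C" "finite B"
    using independent_span_bound[OF W(1) C(2)] independent_span_bound[OF W(1) B(2)] C(1) B(1) ST W(2) by auto
  have "span B = S" using B S by (metis span_subspace)
  then have "t \<notin> span B" using t by simp
  then have "independent (insert t B)" "t \<notin> B"
    using real_vector.independent_insertI B(2) span_base by blast+
  moreover have "insert t B \<subseteq> span C" using t B(1) ST C(3) by auto
  ultimately have "card (insert t B) \<le> card C"
    using independent_span_bound[OF fin(1)] by blast
  then show False using \<open>t \<notin> B\<close> fin(2) B(4) C(4) dim by simp
qed

lemma selfadjoint_spanning: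
  fixes A :: "'a::chilbert_space op set"
  assumes A: "star_algebra A" and V: "csubspace V" and sa: "\<And>a. a \<in> A \<Longrightarrow> adj a = a \<Longrightarrow> a \<in> V"
  shows "A \<subseteq> V"
proof
  fix a assume a: "a \<in> A"
  note AD = star_algebraD[OF A] star_algebra_diff[OF A]
  have ab: "a \<in> bops" using a AD by blast
  define b where "b = a + adj a"
  define c where "c = op_scale \<i> a + op_scale (- \<i>) (adj a)"
  have "adj b = b" "adj c = c"
    using ab by (simp_all add: b_def c_def adj_add adj_scale add.commute)
  then have bc: "b \<in> V" "c \<in> V"
    using a AD by (auto intro!: sa simp: b_def c_def)
  have half: "op_scale (1/2) y + op_scale (1/2) y = y" "op_scale (1/2) y + op_scale (-1/2) y = 0" for y :: "'a op"
    by (simp_all add: op_scale_add_left[symmetric])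
  have "op_scale (1/2) b + op_scale (- \<i>/2) c
      = (op_scale (1/2) a + op_scale (1/2) a) + (op_scale (1/2) (adj a) + op_scale (-1/2) (adj a))"
    by (simp add: b_def c_def op_scale_add_right)
  then have "a = op_scale (1/2) b + op_scale (- \<i>/2) c" unfolding half by simp
  then show "a \<in> V" using csubspaceD[OF V] bc by metis
qed

text \<open>Positivity of the form at \<open>\<xi> - t g \<xi>\<close> with \<open>t = 1 / \<parallel>g\<parallel>\<close>.\<close>

lemma pos_op_schwarz:
  assumes g: "pos_op g"
  shows "(norm (blinfun_apply g \<xi>))\<^sup>2 \<le> norm g * Re (cinner (blinfun_apply g \<xi>) \<xi>)"
proof (cases "g = 0")
  case False
  define w where "w = blinfun_apply g \<xi>"
  define t where "t = 1 / norm g"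
  have t: "0 < t" "t * norm g = 1" using False by (simp_all add: t_def)
  have gb: "g \<in> bops" "adj g = g" using g pos_op_bops pos_op_adj by auto
  have "0 \<le> inner (blinfun_apply g (\<xi> - t *\<^sub>R w)) (\<xi> - t *\<^sub>R w)"
    using g by (simp add: pos_op_def nonneg_Reals_complex_iff Re_cinner)
  also have "\<dots> = inner w \<xi> - t * inner w w - t * inner (blinfun_apply g w) \<xi> + t * (t * inner (blinfun_apply g w) w)"
    by (simp add: blinfun.diff_right blinfun.scaleR_right inner_diff w_def[symmetric] algebra_simps)
  also have "inner (blinfun_apply g w) \<xi> = inner w w"
    using cinner_adj_left[OF gb(1), of w \<xi>] gb(2) unfolding w_def by (metis Re_cinner)
  also have "inner (blinfun_apply g w) w \<le> norm g * inner w w"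
    using cinner_op_bound[of g w] by (simp add: Re_cinner power2_norm_eq_inner)
  finally have "0 \<le> inner w \<xi> - t * inner w w - t * inner w w + t * (t * (norm g * inner w w))"
    using t(1) by (simp add: mult_left_mono)
  also have "t * (t * (norm g * inner w w)) = t * inner w w"
    using t(2) by (metis mult.assoc mult.left_neutral)
  finally have "t * inner w w \<le> inner w \<xi>" by simp
  then have "norm g * (t * inner w w) \<le> norm g * inner w \<xi>" by (intro mult_left_mono) auto
  then show ?thesis
    using t(2) by (simp add: power2_norm_eq_inner Re_cinner w_def[symmetric] mult.assoc[symmetric] mult.commute[of "norm g" t])
qed simp

text \<open>In an abelian star algebra every element is normal, so \<open>(x\<^sup>* x)\<^sup>2 = (x\<^sup>*)\<^sup>2 x\<^sup>2\<close>.\<close>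

lemma abelian_square_nonzero:
  assumes M: "star_algebra M" "abelian M" and x: "x \<in> M" "x \<noteq> 0"
  shows "x o\<^sub>L x \<noteq> 0"
proof
  assume 0: "x o\<^sub>L x = 0"
  have xb: "x \<in> bops" "adj x \<in> M" using x star_algebraD[OF M(1)] by auto
  define y where "y = adj x o\<^sub>L x"
  have "adj y o\<^sub>L y = adj x o\<^sub>L (x o\<^sub>L adj x) o\<^sub>L x" using xb by (simp add: y_def adj_comp oL_assoc)
  also have "x o\<^sub>L adj x = adj x o\<^sub>L x" using M(2) x(1) xb(2) by (auto simp: abelian_def)
  also have "adj x o\<^sub>L (adj x o\<^sub>L x) o\<^sub>L x = adj x o\<^sub>L adj x o\<^sub>L (x o\<^sub>L x)" by (simp add: oL_assoc)
  finally have "adj y o\<^sub>L y = 0" by (simp add: 0)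
  then have "y = 0" using adj_comp_self_zero[of y] xb by (simp add: y_def)
  then show False using adj_comp_self_zero[of x] xb x(2) by (simp add: y_def)
qed

text \<open>A normal idempotent \<open>q\<close> equals the self-adjoint \<open>s = q\<^sup>* q\<close>, because \<open>(q - s)\<^sup>* (q - s) = 0\<close>.\<close>

lemma abelian_idempotent_projection:
  assumes M: "star_algebra M" "abelian M" and q: "q \<in> M" "q o\<^sub>L q = q"
  shows "projection q"
proof -
  have qb: "q \<in> bops" "adj q \<in> M" using q star_algebraD[OF M(1)] by auto
  have comm: "adj q o\<^sub>L q = q o\<^sub>L adj q" using M(2) q(1) qb(2) by (auto simp: abelian_def)
  define s where "s = adj q o\<^sub>L q"
  have aa: "adj q o\<^sub>L adj q = adj q" using adj_comp[OF qb(1) qb(1)] q(2) by simp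
  have s: "adj s = s" "s \<in> bops" using qb by (simp_all add: s_def adj_comp)
  have 1: "adj q o\<^sub>L s = s" using aa by (simp add: s_def oL_assoc[symmetric])
  have 2: "s o\<^sub>L q = s" using q(2) by (simp add: s_def oL_assoc)
  have 3: "s o\<^sub>L s = s"
  proof -
    have "s o\<^sub>L s = (s o\<^sub>L adj q) o\<^sub>L q" by (simp add: s_def oL_assoc)
    also have "s o\<^sub>L adj q = adj (q o\<^sub>L s)" using s qb by (simp add: adj_comp)
    also have "q o\<^sub>L s = q o\<^sub>L q o\<^sub>L adj q" by (simp add: s_def comm oL_assoc)
    also have "\<dots> = s" by (simp add: q(2) s_def comm)
    finally show ?thesis by (simp add: s 2)
  qed
  have "adj (q - s) o\<^sub>L (q - s) = 0"
    using s qb 1 2 3 by (simp add: adj_diff oL_diff_left oL_diff_right s_def[symmetric])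
  then have "q = s" using adj_comp_self_zero[of "q - s"] qb s by simp
  then show ?thesis using s(1) qb(1) q(2) by (simp add: projection_def)
qed

text \<open>In a finite-dimensional abelian star algebra these are the minimal projections; the form stated here is
  the one-dimensionality of the ideal that they generate.\<close>

definition minimal_in :: "'h::chilbert_space op set \<Rightarrow> 'h op \<Rightarrow> bool" where
  "minimal_in M q \<longleftrightarrow> q \<in> M \<and> projection q \<and> q \<noteq> 0 \<and> (\<forall>c\<in>M. \<exists>z. q o\<^sub>L c = op_scale z q)"

lemma unit_vector_in_range:
  assumes q: "projection q" "q \<noteq> 0"
  shows "\<exists>\<xi>. norm \<xi> = 1 \<and> blinfun_apply q \<xi> = \<xi>"
proof -
  obtain \<eta> where \<eta>: "blinfun_apply q \<eta> \<noteq> 0"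
    using q(2) by (metis blinfun_eqI blinfun.zero_left)
  have "blinfun_apply q (blinfun_apply q \<eta>) = blinfun_apply q \<eta>"
    using q(1) unfolding projection_def by (metis blinfun_apply_blinfun_compose)
  then show ?thesis
    using \<eta> by (intro exI[of _ "(1 / norm (blinfun_apply q \<eta>)) *\<^sub>R blinfun_apply q \<eta>"])
      (simp add: blinfun.scaleR_right)
qed

text \<open>If every nonzero element of the ideal \<open>q M\<close> generates it, then \<open>q M\<close> is spanned by \<open>q\<close>: with
  \<open>\<lambda>\<close> the supremum of the quadratic form of a self-adjoint \<open>x\<close> on the range of \<open>q\<close>, the positive element
  \<open>\<lambda> q - x\<close> is not bounded below there, so it generates a proper ideal and vanishes.\<close>

lemma selfadjoint_scalar:
  assumes q: "projection q" "q \<noteq> 0"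
    and x: "x \<in> bops" "adj x = x" "q o\<^sub>L x = x" "x o\<^sub>L q = x"
    and gen: "\<And>l. op_scale (of_real l) q - x \<noteq> 0 \<Longrightarrow> \<exists>m. q = m o\<^sub>L (op_scale (of_real l) q - x)"
  shows "\<exists>z. x = op_scale z q"
proof -
  have qb: "q \<in> bops" "adj q = q" "q o\<^sub>L q = q" using q by (auto simp: projection_def)
  define S where "S = {\<xi>. norm \<xi> = 1 \<and> blinfun_apply q \<xi> = \<xi>}"
  define f where "f \<xi> = Re (cinner (blinfun_apply x \<xi>) \<xi>)" for \<xi>
  define l where "l = (SUP \<xi>\<in>S. f \<xi>)"
  have S0: "S \<noteq> {}" using unit_vector_in_range[OF q] by (auto simp: S_def)
  have bdd: "bdd_above (f ` S)"
  proof (rule bdd_aboveI2)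
    show "f \<xi> \<le> norm x" if "\<xi> \<in> S" for \<xi>
      using cinner_op_bound[of x \<xi>] that by (simp add: f_def S_def)
  qed
  have fl: "f \<xi> \<le> l" if "\<xi> \<in> S" for \<xi>
    unfolding l_def by (rule cSUP_upper[OF that bdd])
  define g where "g = op_scale (of_real l) q - x"
  have gb: "g \<in> bops" "adj g = g" using qb x by (simp_all add: g_def adj_diff adj_scale)
  have g_form: "Re (cinner (blinfun_apply g \<xi>) \<xi>) = l * (norm \<xi>)\<^sup>2 - f \<xi>" if "blinfun_apply q \<xi> = \<xi>" for \<xi>
    using that by (simp add: g_def f_def blinfun.diff_left cinner_diff_left cinner_scaleC_left cinner_self)
  have "g = 0"
  proof (rule ccontr)
    assume "g \<noteq> 0"
    then obtain m where m: "q = m o\<^sub>L g" using gen unfolding g_def by blast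
    have "pos_op g"
      unfolding pos_op_def
    proof (intro conjI allI gb)
      fix \<eta>
      define \<xi> where "\<xi> = blinfun_apply q \<eta>"
      have q\<xi>: "blinfun_apply q \<xi> = \<xi>" unfolding \<xi>_def using qb(3) by (metis blinfun_apply_blinfun_compose)
      have "g = q o\<^sub>L g o\<^sub>L q" using x qb by (simp add: g_def oL_diff_left oL_diff_right)
      then have "cinner (blinfun_apply g \<eta>) \<eta> = cinner (blinfun_apply g \<xi>) \<xi>"
        unfolding \<xi>_def using cinner_adj_right[OF qb(1)] qb(2) by (metis blinfun_apply_blinfun_compose)
      moreover have "Im (cinner (blinfun_apply g \<xi>) \<xi>) = 0"
      proof -
        have "cinner (blinfun_apply g \<xi>) \<xi> = cnj (cinner (blinfun_apply g \<xi>) \<xi>)"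
          using cinner_adj_right[OF gb(1), of \<xi> \<xi>] gb(2) cinner_commute[of \<xi> "blinfun_apply g \<xi>"] by simp
        then show ?thesis by (metis complex_cnj cnj.simps(2) equal_neg_zero)
      qed
      moreover have "0 \<le> Re (cinner (blinfun_apply g \<xi>) \<xi>)"
      proof (cases "\<xi> = 0")
        case False
        then have "(1 / norm \<xi>) *\<^sub>R \<xi> \<in> S" using q\<xi> by (simp add: S_def blinfun.scaleR_right)
        then have "f ((1 / norm \<xi>) *\<^sub>R \<xi>) \<le> l" by (rule fl)
        then have "f \<xi> \<le> l * (norm \<xi>)\<^sup>2"
          using False by (simp add: f_def Re_cinner blinfun.scaleR_right power2_eq_square field_simps)
        then show ?thesis using g_form[OF q\<xi>] by simp
      qed simp
      ultimately show "cinner (blinfun_apply g \<eta>) \<eta> \<in> \<real>\<^sub>\<ge>\<^sub>0" by (simp add: nonneg_Reals_complex_iff)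
    qed
    define K where "K = (norm m)\<^sup>2 * norm g"
    have K0: "0 \<le> K" by (simp add: K_def)
    have low: "1 \<le> K * (l - f \<xi>)" if "\<xi> \<in> S" for \<xi>
    proof -
      have \<xi>: "norm \<xi> = 1" "blinfun_apply q \<xi> = \<xi>" using that by (auto simp: S_def)
      have "1 = norm (blinfun_apply m (blinfun_apply g \<xi>))"
        using \<xi> m by (metis blinfun_apply_blinfun_compose)
      also have "\<dots> \<le> norm m * norm (blinfun_apply g \<xi>)" by (rule norm_blinfun)
      finally have "1\<^sup>2 \<le> (norm m * norm (blinfun_apply g \<xi>))\<^sup>2" by (intro power_mono) auto
      also have "\<dots> = (norm m)\<^sup>2 * (norm (blinfun_apply g \<xi>))\<^sup>2" by (simp add: power_mult_distrib)
      also have "\<dots> \<le> (norm m)\<^sup>2 * (norm g * Re (cinner (blinfun_apply g \<xi>) \<xi>))"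
        by (intro mult_left_mono pos_op_schwarz \<open>pos_op g\<close>) simp
      also have "\<dots> = K * (l - f \<xi>)" using g_form[OF \<xi>(2)] \<xi>(1) by (simp add: K_def)
      finally show ?thesis by simp
    qed
    \<comment> \<open>By \<open>low\<close>, \<open>f\<close> stays at distance at least \<open>1 / K\<close> below its supremum \<open>l\<close>.\<close>
    have "l - 1 / (2 * (K + 1)) < l" using K0 by simp
    then obtain \<xi> where \<xi>: "\<xi> \<in> S" "l - 1 / (2 * (K + 1)) < f \<xi>"
      unfolding l_def using less_cSUP_iff[OF S0 bdd] by blast
    have "1 \<le> K * (l - f \<xi>)" by (rule low[OF \<xi>(1)])
    also have "\<dots> \<le> K * (1 / (2 * (K + 1)))" using \<xi>(2) K0 by (intro mult_left_mono) auto
    also have "\<dots> < 1" using K0 by (simp add: field_simps)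
    finally show False by simp
  qed
  then show ?thesis unfolding g_def by (metis right_minus_eq)
qed

text \<open>A nonzero principal ideal of minimal dimension is generated by each of its nonzero elements; hence
  it contains a unit, which is a minimal projection.\<close>

lemma minimal_projection_exists:
  fixes M :: "'h::chilbert_space op set"
  assumes M: "star_algebra M" "abelian M" "finite_dim M" and b: "b \<in> M" "b \<noteq> 0"
  shows "\<exists>q m. minimal_in M q \<and> m \<in> M \<and> q = b o\<^sub>L m"
proof -
  note MD = star_algebraD[OF M(1)]
  have comm: "x o\<^sub>L y = y o\<^sub>L x" if "x \<in> M" "y \<in> M" for x y using M(2) that by (auto simp: abelian_def)
  obtain W where W: "finite W" "M \<subseteq> span W" using M(3) by (auto simp: finite_dim_def)
  define V where "V a = (\<lambda>m. a o\<^sub>L m) ` M" for a :: "'h op"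
  have V_sub: "subspace (V a)" for a
  proof -
    have "subspace M"
      using MD by (auto simp: subspace_def op_scale_of_real[symmetric])
    then show ?thesis
      unfolding V_def by (intro linear_subspace_image bounded_linear.linear
          bounded_bilinear.bounded_linear_right[OF bounded_bilinear_blinfun_compose])
  qed
  have VM: "V a \<subseteq> M" if "a \<in> M" for a using that MD by (auto simp: V_def)
  have Vtrans: "V y \<subseteq> V a" if "y \<in> V a" for y a
    using that MD by (auto simp: V_def oL_assoc)
  have "b o\<^sub>L adj b \<in> V b" "b o\<^sub>L adj b \<noteq> 0"
    using b MD(5) comp_adj_self_zero[of b] MD(1) by (auto simp: V_def)
  then have "\<exists>a. (a \<in> V b \<and> a \<noteq> 0) \<and> (\<forall>y. y \<in> V b \<and> y \<noteq> 0 \<longrightarrow> dim (V a) \<le> dim (V y))"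
    using ex_has_least_nat[of "\<lambda>a. a \<in> V b \<and> a \<noteq> 0" "b o\<^sub>L adj b" "\<lambda>a. dim (V a)"] by blast
  then obtain a where a: "a \<in> V b" "a \<noteq> 0" "\<And>y. y \<in> V b \<Longrightarrow> y \<noteq> 0 \<Longrightarrow> dim (V a) \<le> dim (V y)"
    by blast
  have aM: "a \<in> M" using a(1) VM[OF b(1)] by blast
  have gen: "V y = V a" if y: "y \<in> V a" "y \<noteq> 0" for y
  proof (rule subspace_eq_of_dim_le[OF V_sub Vtrans[OF y(1)] W(1)])
    show "V a \<subseteq> span W" using VM[OF aM] W(2) by blast
    show "dim (V a) \<le> dim (V y)" using a(3) y Vtrans[OF a(1)] by blast
  qed
  define y where "y = a o\<^sub>L adj a"
  have y: "y \<in> V a" "y \<noteq> 0" "y \<in> M"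
    using aM a(2) MD comp_adj_self_zero[of a] by (auto simp: y_def V_def)
  have yy: "y o\<^sub>L y \<in> V a" using y Vtrans[OF y(1)] by (auto simp: V_def)
  have "y o\<^sub>L y \<noteq> 0" by (rule abelian_square_nonzero[OF M(1,2) y(3,2)])
  then have "y \<in> V (y o\<^sub>L y)" using gen[OF yy] y(1) by simp
  then obtain m where m: "m \<in> M" "y = y o\<^sub>L y o\<^sub>L m" by (auto simp: V_def)
  define q where "q = y o\<^sub>L m"
  have qy: "y o\<^sub>L q = y" using m(2) by (simp add: q_def oL_assoc)
  have qVa: "q \<in> V a" using Vtrans[OF y(1)] m(1) by (auto simp: q_def V_def)
  have qM: "q \<in> M" using qVa VM[OF aM] by blast
  have q0: "q \<noteq> 0" using qy y(2) by auto
  have "q o\<^sub>L q = m o\<^sub>L (y o\<^sub>L q)" using comm[OF y(3) m(1)] by (simp add: q_def oL_assoc)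
  also have "\<dots> = q" using qy comm[OF y(3) m(1)] by (simp add: q_def)
  finally have qq: "q o\<^sub>L q = q" .
  have qp: "projection q" by (rule abelian_idempotent_projection[OF M(1,2) qM qq])
  have qb: "q \<in> bops" "adj q = q" using qp by (auto simp: projection_def)
  have scalar: "\<exists>z. q o\<^sub>L c = op_scale z q" if c: "c \<in> M" for c
  proof -
    have "M \<subseteq> {c. \<exists>z. q o\<^sub>L c = op_scale z q}"
    proof (rule selfadjoint_spanning[OF M(1)])
      show "csubspace {c. \<exists>z. q o\<^sub>L c = op_scale z q}"
        unfolding csubspace_def
      proof (intro conjI ballI allI)
        show "0 \<in> {c. \<exists>z. q o\<^sub>L c = op_scale z q}" by (auto intro: exI[of _ 0])
        fix u v assume "u \<in> {c. \<exists>z. q o\<^sub>L c = op_scale z q}" "v \<in> {c. \<exists>z. q o\<^sub>L c = op_scale z q}"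
        then show "u + v \<in> {c. \<exists>z. q o\<^sub>L c = op_scale z q}"
          by (auto simp: oL_add_right op_scale_add_left[symmetric])
      next
        fix u z assume "u \<in> {c. \<exists>z. q o\<^sub>L c = op_scale z q}"
        then show "op_scale z u \<in> {c. \<exists>z. q o\<^sub>L c = op_scale z q}" using qb(1) by auto
      qed
      fix c assume c: "c \<in> M" "adj c = c"
      have cb: "c \<in> bops" using c MD by blast
      have "\<exists>z. q o\<^sub>L c = op_scale z q"
      proof (rule selfadjoint_scalar[OF qp q0])
        show "q o\<^sub>L c \<in> bops" using qb cb by simp
        show "adj (q o\<^sub>L c) = q o\<^sub>L c" using qb cb c(2) comm[OF qM c(1)] by (simp add: adj_comp)
        show "q o\<^sub>L (q o\<^sub>L c) = q o\<^sub>L c" using qq by (simp add: oL_assoc[symmetric])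
        show "q o\<^sub>L c o\<^sub>L q = q o\<^sub>L c" using comm[OF qM c(1)] qq by (simp add: oL_assoc)
        fix l :: real
        define g where "g = op_scale (of_real l) q - (q o\<^sub>L c)"
        assume "op_scale (of_real l) q - (q o\<^sub>L c) \<noteq> 0"
        then have "g \<noteq> 0" by (simp add: g_def)
        moreover have gVq: "g \<in> V q"
          unfolding V_def
        proof (rule image_eqI)
          show "g = q o\<^sub>L (op_scale (of_real l) q - c)"
            using qb(1) qq by (simp add: g_def oL_diff_right)
          show "op_scale (of_real l) q - c \<in> M"
            by (rule star_algebra_diff[OF M(1) MD(6)[OF qM] c(1)])
        qed
        moreover have "V q = V a" using gen[OF qVa q0] .
        ultimately have "V g = V q" using gen by simp
        moreover have "q \<in> V q" using qM qq by (auto simp: V_def intro!: image_eqI[of _ _ q])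
        ultimately obtain n where n: "n \<in> M" "q = g o\<^sub>L n" by (auto simp: V_def)
        have "g \<in> M" using gVq VM[OF qM] by blast
        then have "q = n o\<^sub>L g" using n comm by metis
        then show "\<exists>m. q = m o\<^sub>L (op_scale (of_real l) q - (q o\<^sub>L c))" unfolding g_def by blast
      qed
      then show "c \<in> {c. \<exists>z. q o\<^sub>L c = op_scale z q}" by simp
    qed
    then show ?thesis using c by blast
  qed
  have "q \<in> V b" using qVa Vtrans[OF a(1)] by blast
  then obtain n where "n \<in> M" "q = b o\<^sub>L n" by (auto simp: V_def)
  then show ?thesis using qM qp q0 scalar unfolding minimal_in_def by blast
qed

section \<open>Matrix units adapted to a maximal abelian subalgebra\<close>

text \<open>The bicommutant inside \<open>G\<close> of a commuting self-adjoint set is an abelian star algebra containing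
  it.\<close>

lemma masa_self_commutant:
  assumes G: "star_algebra G" and M: "masa M G"
    and x: "x \<in> G" "adj x = x" "\<And>m. m \<in> M \<Longrightarrow> x o\<^sub>L m = m o\<^sub>L x"
  shows "x \<in> M"
proof -
  note GD = star_algebraD[OF G]
  have Ms: "star_algebra M" "abelian M" "M \<subseteq> G" using M by (auto simp: masa_def)
  define rc where "rc S = {y \<in> G. \<forall>s\<in>S. y o\<^sub>L s = s o\<^sub>L y}" for S
  have rc: "star_algebra (rc S)" if S: "S \<subseteq> G" "\<And>s. s \<in> S \<Longrightarrow> adj s \<in> S" for S
    unfolding star_algebra_def
  proof (intro conjI ballI allI)
    show "rc S \<subseteq> bops" "0 \<in> rc S" using GD by (auto simp: rc_def)
  next
    fix y z assume yz: "y \<in> rc S" "z \<in> rc S"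
    then show "y + z \<in> rc S" using GD by (auto simp: rc_def oL_add_left oL_add_right)
    have "y o\<^sub>L z o\<^sub>L s = s o\<^sub>L (y o\<^sub>L z)" if "s \<in> S" for s
      using yz that unfolding rc_def by (metis (mono_tags, lifting) mem_Collect_eq oL_assoc)
    then show "y o\<^sub>L z \<in> rc S" using yz GD by (auto simp: rc_def)
  next
    fix y assume y: "y \<in> rc S"
    have "adj y o\<^sub>L s = s o\<^sub>L adj y" if s: "s \<in> S" for s
    proof -
      have b: "y \<in> bops" "s \<in> bops" using y s S GD by (auto simp: rc_def)
      have "y o\<^sub>L adj s = adj s o\<^sub>L y" using y S(2)[OF s] by (auto simp: rc_def)
      then have "adj (y o\<^sub>L adj s) = adj (adj s o\<^sub>L y)" by simp
      then show ?thesis using b by (simp add: adj_comp)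
    qed
    then show "adj y \<in> rc S" using y GD by (auto simp: rc_def)
    show "op_scale c y \<in> rc S" for c
      using y GD S by (auto simp: rc_def subset_iff)
  qed
  define S where "S = insert x M"
  have S: "S \<subseteq> G" "\<And>s. s \<in> S \<Longrightarrow> adj s \<in> S"
    using x Ms star_algebraD[OF Ms(1)] by (auto simp: S_def)
  have "S \<subseteq> rc S"
    using x Ms by (auto simp: rc_def S_def abelian_def)
  then have anti: "rc (rc S) \<subseteq> rc S" by (auto simp: rc_def)
  have "star_algebra (rc (rc S))"
    using star_algebraD[OF rc[OF S]] by (intro rc) (auto simp: rc_def)
  moreover have "abelian (rc (rc S))"
    unfolding abelian_def
  proof (intro ballI)
    fix u v assume "u \<in> rc (rc S)" "v \<in> rc (rc S)"
    then have "u \<in> rc (rc S)" "v \<in> rc S" using anti by auto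
    then show "u o\<^sub>L v = v o\<^sub>L u" unfolding rc_def[of "rc S"] by simp
  qed
  moreover have SS: "S \<subseteq> rc (rc S)" using S(1) by (auto simp: rc_def)
  moreover have "rc (rc S) \<subseteq> G" by (auto simp: rc_def)
  ultimately have "rc (rc S) = M" using M SS by (simp add: masa_def S_def)
  then show ?thesis using SS by (auto simp: S_def)
qed

locale finite_dim_masa =
  fixes G M :: "'h::chilbert_space op set"
  assumes G: "star_algebra G" and fd: "finite_dim G" and masa: "masa M G"
begin

lemma M: "star_algebra M" "abelian M" "M \<subseteq> G"
  using masa by (auto simp: masa_def)

lemma M_finite_dim: "finite_dim M"
  using fd M(3) by (auto simp: finite_dim_def)

lemmas GD = star_algebraD[OF G] and MD = star_algebraD[OF M(1)]

lemma M_comm: "x \<in> M \<Longrightarrow> y \<in> M \<Longrightarrow> x o\<^sub>L y = y o\<^sub>L x"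
  using M(2) by (auto simp: abelian_def)

definition P where "P = Collect (minimal_in M)"

lemma PD:
  assumes "q \<in> P"
  shows "q \<in> M" "projection q" "q \<noteq> 0" "q \<in> bops" "adj q = q" "q o\<^sub>L q = q" "q \<in> G"
    "c \<in> M \<Longrightarrow> \<exists>z. q o\<^sub>L c = op_scale z q"
  using assms M(3) by (auto simp: P_def minimal_in_def projection_def)

text \<open>\<open>p q\<close> is a multiple of \<open>p\<close> and of \<open>q\<close>; being idempotent, it is zero or equal to both.\<close>

lemma P_orthogonal:
  assumes p: "p \<in> P" and q: "q \<in> P" and pq: "p \<noteq> q"
  shows "p o\<^sub>L q = 0"
proof -
  obtain z w where z: "p o\<^sub>L q = op_scale z p" and w: "q o\<^sub>L p = op_scale w q"
    using PD(8)[OF p PD(1)[OF q]] PD(8)[OF q PD(1)[OF p]] by blast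
  have comm: "p o\<^sub>L q = q o\<^sub>L p" by (rule M_comm[OF PD(1)[OF p] PD(1)[OF q]])
  have "op_scale (z * z) p = op_scale z p o\<^sub>L op_scale z p" using PD(4,6)[OF p] by simp
  also have "\<dots> = p o\<^sub>L (q o\<^sub>L p) o\<^sub>L q" unfolding z[symmetric] by (simp add: oL_assoc)
  also have "\<dots> = (p o\<^sub>L p) o\<^sub>L (q o\<^sub>L q)" unfolding comm[symmetric] by (simp add: oL_assoc)
  also have "\<dots> = op_scale z p" using PD(6)[OF p] PD(6)[OF q] z by simp
  finally have zz: "op_scale (z * z - z) p = 0"
    by (metis add_diff_cancel op_scale_add_left diff_add_cancel cancel_comm_monoid_add_class.diff_cancel)
  have "op_scale (w * w) q = op_scale w q o\<^sub>L op_scale w q" using PD(4,6)[OF q] by simp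
  also have "\<dots> = q o\<^sub>L (p o\<^sub>L q) o\<^sub>L p" unfolding w[symmetric] by (simp add: oL_assoc)
  also have "\<dots> = (q o\<^sub>L q) o\<^sub>L (p o\<^sub>L p)" unfolding comm by (simp add: oL_assoc)
  also have "\<dots> = op_scale w q" using PD(6)[OF p] PD(6)[OF q] w by simp
  finally have ww: "op_scale (w * w - w) q = 0"
    by (metis add_diff_cancel op_scale_add_left diff_add_cancel cancel_comm_monoid_add_class.diff_cancel)
  have "z = 0 \<or> z = 1" "w = 0 \<or> w = 1" using zz ww PD(3)[OF p] PD(3)[OF q] by auto
  then show ?thesis using z w comm pq by auto
qed

text \<open>Orthogonal nonzero projections are linearly independent.\<close>

lemma finite_P: "finite P"
proof -
  obtain W where W: "finite W" "G \<subseteq> span W" using fd by (auto simp: finite_dim_def)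
  have "independent P"
    unfolding dependent_def
  proof (intro notI, elim bexE)
    fix q assume q: "q \<in> P" "q \<in> span (P - {q})"
    have "subspace {x. q o\<^sub>L x = 0}"
      by (auto simp: subspace_def oL_add_right bounded_bilinear.scaleR_right[OF bounded_bilinear_blinfun_compose])
    moreover have "P - {q} \<subseteq> {x. q o\<^sub>L x = 0}" using P_orthogonal[OF q(1)] by auto
    ultimately have "span (P - {q}) \<subseteq> {x. q o\<^sub>L x = 0}" by (intro span_minimal)
    then show False using q PD(3,6)[OF q(1)] by auto
  qed
  moreover have "P \<subseteq> span W" using PD(7) W(2) by blast
  ultimately show ?thesis using independent_span_bound[OF W(1)] by blast
qed

definition e where "e = (\<Sum>q\<in>P. q)"

lemma e_M: "e \<in> M"
  unfolding e_def by (intro star_algebra_sum M PD(1))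

lemma e_P: "q \<in> P \<Longrightarrow> e o\<^sub>L q = q"
proof -
  assume q: "q \<in> P"
  have "e o\<^sub>L q = (\<Sum>p\<in>P. if p = q then q else 0)"
    unfolding e_def oL_sum_left using q P_orthogonal PD(6) by (intro sum.cong) auto
  then show ?thesis using q finite_P by simp
qed

text \<open>Otherwise some minimal projection would be orthogonal to \<open>e\<close>, and hence to itself.\<close>

lemma e_unit_M:
  assumes m: "m \<in> M"
  shows "e o\<^sub>L m = m"
proof (rule ccontr)
  assume "e o\<^sub>L m \<noteq> m"
  then have "m - (e o\<^sub>L m) \<noteq> 0" by auto
  moreover have "m - (e o\<^sub>L m) \<in> M" by (rule star_algebra_diff[OF M(1) m MD(4)[OF e_M m]])
  ultimately obtain q n where q: "minimal_in M q" "q = (m - (e o\<^sub>L m)) o\<^sub>L n"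
    using minimal_projection_exists[OF M(1,2) M_finite_dim] by blast
  have "e o\<^sub>L e = (\<Sum>q\<in>P. e o\<^sub>L q)"
    by (subst (2) e_def) (rule oL_sum_right)
  also have "\<dots> = (\<Sum>q\<in>P. q)" by (rule sum.cong) (auto simp: e_P)
  finally have ee: "e o\<^sub>L e = e" by (simp add: e_def)
  have "e o\<^sub>L q = ((e o\<^sub>L m) - ((e o\<^sub>L e) o\<^sub>L m)) o\<^sub>L n"
    unfolding q(2) by (simp add: oL_diff_left oL_diff_right oL_assoc)
  then have "e o\<^sub>L q = 0" by (simp add: ee)
  moreover have "q \<in> P" using q(1) by (simp add: P_def)
  ultimately show False using e_P[of q] PD(3)[of q] by simp
qed

lemma e_bops: "e \<in> bops" using e_M MD by blast

lemma e_adj: "adj e = e"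
  unfolding e_def using PD(4,5) by (simp add: adj_sum)

lemma e_projection: "projection e"
  using e_bops e_adj e_unit_M[OF e_M] by (simp add: projection_def)

text \<open>With \<open>u = (1 - e) g\<close>, the self-adjoint \<open>u u\<^sup>*\<close> is annihilated by \<open>M\<close> and in particular commutes with
  it. By maximality it lies in \<open>M\<close>, where \<open>e\<close> is a unit, so it vanishes.\<close>

lemma e_unit_left:
  assumes g: "g \<in> G"
  shows "e o\<^sub>L g = g"
proof -
  have eG: "e \<in> G" using e_M M(3) by blast
  define u where "u = g - (e o\<^sub>L g)"
  have u: "u \<in> G" unfolding u_def by (rule star_algebra_diff[OF G g GD(4)[OF eG g]])
  have ub: "u \<in> bops" using u GD by blast
  have mu: "m o\<^sub>L u = 0" if m: "m \<in> M" for m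
  proof -
    have "m o\<^sub>L e = m" using e_unit_M[OF m] M_comm[OF m e_M] by simp
    then show ?thesis by (simp add: u_def oL_diff_right oL_assoc[symmetric])
  qed
  define k where "k = u o\<^sub>L adj u"
  have k: "k \<in> G" "adj k = k" "k \<in> bops" using u ub GD by (auto simp: k_def adj_comp)
  have mk: "m o\<^sub>L k = 0" if "m \<in> M" for m using mu[OF that] by (simp add: k_def oL_assoc[symmetric])
  have km: "k o\<^sub>L m = 0" if m: "m \<in> M" for m
  proof -
    have "adj (k o\<^sub>L m) = adj m o\<^sub>L k" using k m MD by (simp add: adj_comp)
    then have "adj (k o\<^sub>L m) = 0" using mk[of "adj m"] m MD by simp
    then show ?thesis using k m MD by simp
  qed
  have "k \<in> M" using masa_self_commutant[OF G masa k(1,2)] mk km by simp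
  then have "k = 0" using e_unit_M[of k] mk[OF e_M] by simp
  then have "u = 0" using comp_adj_self_zero[OF ub] by (simp add: k_def)
  then show ?thesis by (simp add: u_def)
qed

lemma e_unit_right:
  assumes g: "g \<in> G"
  shows "g o\<^sub>L e = g"
proof -
  have "adj (g o\<^sub>L e) = e o\<^sub>L adj g" using g GD e_bops by (simp add: adj_comp e_adj)
  also have "\<dots> = adj g" by (rule e_unit_left[OF GD(5)[OF g]])
  finally have "adj (adj (g o\<^sub>L e)) = adj (adj g)" by simp
  then show ?thesis using g GD e_bops by simp
qed

text \<open>For self-adjoint \<open>g\<close> the corner \<open>q g q\<close> commutes with \<open>M\<close>, so it belongs to \<open>M\<close> by maximality, and
  \<open>q M\<close> is one-dimensional.\<close>

lemma corner_scalar: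
  assumes q: "q \<in> P" and g: "g \<in> G"
  shows "\<exists>z. q o\<^sub>L g o\<^sub>L q = op_scale z q"
proof -
  have "G \<subseteq> {g. \<exists>z. q o\<^sub>L g o\<^sub>L q = op_scale z q}"
  proof (rule selfadjoint_spanning[OF G])
    show "csubspace {g. \<exists>z. q o\<^sub>L g o\<^sub>L q = op_scale z q}"
      unfolding csubspace_def
    proof (intro conjI ballI allI)
      show "0 \<in> {g. \<exists>z. q o\<^sub>L g o\<^sub>L q = op_scale z q}" by (auto intro: exI[of _ 0])
      fix u v assume "u \<in> {g. \<exists>z. q o\<^sub>L g o\<^sub>L q = op_scale z q}" "v \<in> {g. \<exists>z. q o\<^sub>L g o\<^sub>L q = op_scale z q}"
      then show "u + v \<in> {g. \<exists>z. q o\<^sub>L g o\<^sub>L q = op_scale z q}"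
        by (auto simp: oL_add_right oL_add_left op_scale_add_left[symmetric])
    next
      fix u z assume "u \<in> {g. \<exists>z. q o\<^sub>L g o\<^sub>L q = op_scale z q}"
      then show "op_scale z u \<in> {g. \<exists>z. q o\<^sub>L g o\<^sub>L q = op_scale z q}" using PD(4)[OF q] by auto
    qed
    fix g assume g: "g \<in> G" "adj g = g"
    define x where "x = q o\<^sub>L g o\<^sub>L q"
    have gb: "g \<in> bops" by (rule GD(1)[OF g(1)])
    have "x \<in> M"
    proof (rule masa_self_commutant[OF G masa])
      show "x \<in> G" unfolding x_def by (intro GD(4) PD(7) q g(1))
      show "adj x = x" using gb g(2) PD(4,5)[OF q] by (simp add: x_def adj_comp oL_assoc)
      fix m assume m: "m \<in> M"
      obtain z where z: "q o\<^sub>L m = op_scale z q" using PD(8)[OF q m] by blast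
      have zm: "m o\<^sub>L q = op_scale z q" using z M_comm[OF m PD(1)[OF q]] by simp
      have "x o\<^sub>L m = op_scale z x" using gb PD(4)[OF q] z by (simp add: x_def oL_assoc)
      moreover have "m o\<^sub>L x = (m o\<^sub>L q) o\<^sub>L (g o\<^sub>L q)" by (simp add: x_def oL_assoc)
      ultimately show "x o\<^sub>L m = m o\<^sub>L x" unfolding zm by (simp add: x_def oL_assoc)
    qed
    moreover have "q o\<^sub>L x = x" using PD(6)[OF q] by (simp add: x_def oL_assoc[symmetric])
    ultimately show "g \<in> {g. \<exists>z. q o\<^sub>L g o\<^sub>L q = op_scale z q}"
      using PD(8)[OF q, of x] by (simp add: x_def)
  qed
  then show ?thesis using g by blast
qed

text \<open>Two minimal projections are linked if they lie in the same simple summand of \<open>G\<close>.\<close>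

definition linked where "linked p q \<longleftrightarrow> (\<exists>g\<in>G. p o\<^sub>L g o\<^sub>L q \<noteq> 0)"

text \<open>Rescaling a nonzero element of \<open>p G q\<close> gives a partial isometry, because \<open>q G q\<close> and \<open>p G p\<close> are
  one-dimensional.\<close>

lemma linked_partial_isometry:
  assumes p: "p \<in> P" and q: "q \<in> P" and pq: "linked p q"
  shows "\<exists>v\<in>G. p o\<^sub>L v = v \<and> v o\<^sub>L q = v \<and> adj v o\<^sub>L v = q \<and> v o\<^sub>L adj v = p"
proof -
  obtain g where g: "g \<in> G" "p o\<^sub>L g o\<^sub>L q \<noteq> 0" using pq by (auto simp: linked_def)
  define x where "x = p o\<^sub>L g o\<^sub>L q"
  have gb: "g \<in> bops" by (rule GD(1)[OF g(1)])
  have x: "x \<in> G" unfolding x_def by (intro GD(4) PD(7) p q g(1))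
  then have xb: "x \<in> bops" by (rule GD(1))
  have px: "p o\<^sub>L x = x" "x o\<^sub>L q = x"
    using PD(6)[OF p] PD(6)[OF q] by (simp_all add: x_def oL_assoc) (simp add: oL_assoc[symmetric])
  have corner: "\<exists>z. r o\<^sub>L y o\<^sub>L r = op_scale z r" if "y \<in> G" "r \<in> P" for y r
    using corner_scalar that by blast
  have qx: "q o\<^sub>L adj x = adj x" "adj x o\<^sub>L p = adj x"
    using adj_comp[OF xb PD(4)[OF q]] adj_comp[OF PD(4)[OF p] xb] px PD(5)[OF q] PD(5)[OF p] by simp_all
  have "adj x o\<^sub>L x \<in> G" by (intro GD(4,5) x)
  then obtain z where z: "q o\<^sub>L (adj x o\<^sub>L x) o\<^sub>L q = op_scale z q"
    using corner[OF _ q] by blast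
  then have z: "adj x o\<^sub>L x = op_scale z q"
    using px qx by (simp add: oL_assoc) (simp add: oL_assoc[symmetric])
  obtain \<xi> where \<xi>: "norm \<xi> = 1" "blinfun_apply q \<xi> = \<xi>"
    using unit_vector_in_range[OF PD(2,3)[OF q]] by blast
  have "z = of_real ((norm (blinfun_apply x \<xi>))\<^sup>2)"
    using adj_comp_self_apply[OF xb, of \<xi>] z \<xi> by (simp add: cinner_scaleC_left cinner_self)
  then obtain t where t: "z = of_real (t\<^sup>2)" "t \<ge> 0" using norm_ge_zero by blast
  have t0: "t \<noteq> 0"
    using z t(1) g(2) adj_comp_self_zero[OF xb] by (auto simp: x_def)
  define v where "v = op_scale (of_real (1 / t)) x"
  have v: "v \<in> G" "v \<in> bops" using GD(6)[OF x] xb by (simp_all add: v_def)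
  have pv: "p o\<^sub>L v = v" "v o\<^sub>L q = v" using px PD(4)[OF p] by (simp_all add: v_def)
  have vv: "adj v o\<^sub>L v = q"
    using xb z t t0 by (simp add: v_def adj_scale power2_eq_square)
  have qv: "adj v o\<^sub>L p = adj v"
    using adj_comp[OF PD(4)[OF p] v(2)] pv PD(5)[OF p] by simp
  have "v o\<^sub>L adj v \<in> G" by (intro GD(4,5) v(1))
  then obtain w where w: "p o\<^sub>L (v o\<^sub>L adj v) o\<^sub>L p = op_scale w p"
    using corner[OF _ p] by blast
  then have w: "v o\<^sub>L adj v = op_scale w p"
    using pv qv by (simp add: oL_assoc) (simp add: oL_assoc[symmetric])
  have "op_scale w v = (v o\<^sub>L adj v) o\<^sub>L v" using w pv by simp
  also have "\<dots> = v" using vv pv by (simp add: oL_assoc)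
  finally have "op_scale (w - 1) v = 0"
    by (metis add_diff_cancel op_scale_add_left diff_add_cancel op_scale_one cancel_comm_monoid_add_class.diff_cancel)
  moreover have "v \<noteq> 0" using vv PD(3)[OF q] by auto
  ultimately have "w = 1" by simp
  then show ?thesis using v pv vv w by auto
qed

lemma linked_refl: "p \<in> P \<Longrightarrow> linked p p"
  unfolding linked_def using PD(3,6,7) by (metis)

lemma linked_sym:
  assumes "p \<in> P" "q \<in> P" "linked p q"
  shows "linked q p"
proof -
  obtain v where v: "v \<in> G" "p o\<^sub>L v = v" "v o\<^sub>L q = v" "adj v o\<^sub>L v = q"
    using linked_partial_isometry[OF assms] by blast
  have vb: "v \<in> bops" by (rule GD(1)[OF v(1)])
  have "q o\<^sub>L adj v o\<^sub>L p = adj (p o\<^sub>L v o\<^sub>L q)"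
    using vb PD(4,5)[OF assms(1)] PD(4,5)[OF assms(2)] by (simp add: adj_comp oL_assoc)
  also have "\<dots> = adj v" using v by simp
  finally have "q o\<^sub>L adj v o\<^sub>L p \<noteq> 0" using v(4) PD(3)[OF assms(2)] by auto
  then show ?thesis using GD(5)[OF v(1)] by (auto simp: linked_def)
qed

lemma linked_trans:
  assumes P: "p \<in> P" "q \<in> P" "r \<in> P" and pq: "linked p q" and qr: "linked q r"
  shows "linked p r"
proof -
  obtain v where v: "v \<in> G" "p o\<^sub>L v = v" "v o\<^sub>L q = v" "adj v o\<^sub>L v = q"
    using linked_partial_isometry[OF P(1,2) pq] by blast
  obtain g where g: "g \<in> G" "q o\<^sub>L g o\<^sub>L r \<noteq> 0" using qr by (auto simp: linked_def)
  have "adj v o\<^sub>L (p o\<^sub>L (v o\<^sub>L g) o\<^sub>L r) = (adj v o\<^sub>L (p o\<^sub>L v)) o\<^sub>L g o\<^sub>L r" by (simp add: oL_assoc)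
  also have "\<dots> = q o\<^sub>L g o\<^sub>L r" by (simp add: v)
  finally have "p o\<^sub>L (v o\<^sub>L g) o\<^sub>L r \<noteq> 0" using g(2) by auto
  then show ?thesis using GD(4)[OF v(1) g(1)] unfolding linked_def by blast
qed

end

section \<open>The matrix model of a finite-dimensional algebra with a maximal abelian subalgebra\<close>

text \<open>The minimal projections are enumerated by natural numbers, which index the rows and columns of block
  algebras.\<close>

locale matrix_model = finite_dim_masa G M for G M :: "complex ell2 op set" +
  fixes Q :: "nat \<Rightarrow> complex ell2 op" and X :: "nat set"
  assumes bij: "bij_betw Q X P"
begin

lemma finite_X: "finite X"
  using bij finite_P bij_betw_finite by blast

lemma Q_P: "r \<in> X \<Longrightarrow> Q r \<in> P"
  using bij by (auto simp: bij_betw_def)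

lemma Q_orthogonal: "r \<in> X \<Longrightarrow> s \<in> X \<Longrightarrow> r \<noteq> s \<Longrightarrow> Q r o\<^sub>L Q s = 0"
  using bij by (intro P_orthogonal Q_P) (auto simp: bij_betw_def inj_on_def)

lemma sum_Q: "(\<Sum>r\<in>X. Q r) = e"
  unfolding e_def using sum.reindex_bij_betw[OF bij, of "\<lambda>q. q"] by simp

definition E where "E = {(r, s). r \<in> X \<and> s \<in> X \<and> linked (Q r) (Q s)}"

lemma equiv_E: "equiv X E"
proof (rule equivI)
  show "E \<subseteq> X \<times> X" by (auto simp: E_def)
  show "refl_on X E" by (auto simp: refl_on_def E_def linked_refl Q_P)
  show "sym E" by (auto simp: sym_def E_def intro: linked_sym Q_P)
  show "trans E" unfolding trans_def E_def using linked_trans Q_P by blast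
qed

lemma E_X: "(r, s) \<in> E \<Longrightarrow> r \<in> X" "(r, s) \<in> E \<Longrightarrow> s \<in> X"
  by (auto simp: E_def)

lemma E_refl: "r \<in> X \<Longrightarrow> (r, r) \<in> E"
  by (auto simp: E_def linked_refl Q_P)

lemma E_sym: "(r, s) \<in> E \<Longrightarrow> (s, r) \<in> E"
  using equiv_E by (auto simp: equiv_def sym_def)

lemma E_trans: "(r, s) \<in> E \<Longrightarrow> (s, t) \<in> E \<Longrightarrow> (r, t) \<in> E"
  using equiv_E by (auto simp: equiv_def trans_def)

lemma finite_E: "finite E"
  by (rule finite_equiv[OF finite_X equiv_E])

text \<open>Matrix units are composed of partial isometries from one representative of each class of linked
  projections to all of its members; their multiplication rules are then automatic.\<close>

definition rep where "rep r = (LEAST s. (r, s) \<in> E)"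

lemma rep_E: "r \<in> X \<Longrightarrow> (r, rep r) \<in> E"
  unfolding rep_def by (rule LeastI) (rule E_refl)

lemma rep_X: "r \<in> X \<Longrightarrow> rep r \<in> X"
  using rep_E E_X by blast

lemma rep_eq:
  assumes "(r, s) \<in> E"
  shows "rep r = rep s"
proof -
  have "(r, t) \<in> E \<longleftrightarrow> (s, t) \<in> E" for t
    using assms E_sym E_trans by blast
  then show ?thesis by (simp add: rep_def)
qed

definition isom where
  "isom r = (SOME v. v \<in> G \<and> Q r o\<^sub>L v = v \<and> v o\<^sub>L Q (rep r) = v \<and> adj v o\<^sub>L v = Q (rep r) \<and> v o\<^sub>L adj v = Q r)"

lemma isom_props:
  assumes "r \<in> X"
  shows "isom r \<in> G \<and> Q r o\<^sub>L isom r = isom r \<and> isom r o\<^sub>L Q (rep r) = isom r \<and>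
    adj (isom r) o\<^sub>L isom r = Q (rep r) \<and> isom r o\<^sub>L adj (isom r) = Q r"
proof -
  have "linked (Q r) (Q (rep r))" using rep_E[OF assms] by (simp add: E_def)
  then have "\<exists>v. v \<in> G \<and> Q r o\<^sub>L v = v \<and> v o\<^sub>L Q (rep r) = v \<and> adj v o\<^sub>L v = Q (rep r) \<and> v o\<^sub>L adj v = Q r"
    using linked_partial_isometry[OF Q_P[OF assms] Q_P[OF rep_X[OF assms]]] by blast
  then show ?thesis unfolding isom_def by (rule someI_ex)
qed

lemma isom:
  assumes "r \<in> X"
  shows "isom r \<in> G" "Q r o\<^sub>L isom r = isom r" "isom r o\<^sub>L Q (rep r) = isom r"
    "adj (isom r) o\<^sub>L isom r = Q (rep r)" "isom r o\<^sub>L adj (isom r) = Q r"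
    "isom r \<in> bops" "adj (isom r) o\<^sub>L Q r = adj (isom r)"
proof -
  show *: "isom r \<in> G" "Q r o\<^sub>L isom r = isom r" "isom r o\<^sub>L Q (rep r) = isom r"
    "adj (isom r) o\<^sub>L isom r = Q (rep r)" "isom r o\<^sub>L adj (isom r) = Q r"
    using isom_props[OF assms] by auto
  show "isom r \<in> bops" by (rule GD(1)[OF *(1)])
  then show "adj (isom r) o\<^sub>L Q r = adj (isom r)"
    using adj_comp[of "Q r" "isom r"] *(2) PD(4,5)[OF Q_P[OF assms]] by simp
qed

lemma isom_adj_isom:
  assumes "r \<in> X" "s \<in> X"
  shows "adj (isom r) o\<^sub>L isom s = (if r = s then Q (rep r) else 0)"
proof (cases "r = s")
  case False
  have "adj (isom r) o\<^sub>L isom s = (adj (isom r) o\<^sub>L Q r) o\<^sub>L (Q s o\<^sub>L isom s)"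
    using isom[OF assms(1)] isom[OF assms(2)] by simp
  also have "\<dots> = adj (isom r) o\<^sub>L (Q r o\<^sub>L Q s) o\<^sub>L isom s" by (simp add: oL_assoc)
  finally show ?thesis using False Q_orthogonal[OF assms] by simp
qed (use isom assms in simp)

definition unit_at where "unit_at r s = isom r o\<^sub>L adj (isom s)"

lemma unit_at_G: "r \<in> X \<Longrightarrow> s \<in> X \<Longrightarrow> unit_at r s \<in> G"
  unfolding unit_at_def by (intro GD(4,5) isom(1))

lemma unit_at_bops: "r \<in> X \<Longrightarrow> s \<in> X \<Longrightarrow> unit_at r s \<in> bops"
  by (rule GD(1)[OF unit_at_G])

lemma unit_at_diag: "r \<in> X \<Longrightarrow> unit_at r r = Q r"
  by (simp add: unit_at_def isom)

lemma adj_unit_at: "r \<in> X \<Longrightarrow> s \<in> X \<Longrightarrow> adj (unit_at r s) = unit_at s r"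
  by (simp add: unit_at_def adj_comp isom(6))

lemma unit_at_comp:
  assumes "(r, s) \<in> E" "(t, u) \<in> E"
  shows "unit_at r s o\<^sub>L unit_at t u = (if s = t then unit_at r u else 0)"
proof -
  note X = E_X[OF assms(1)] E_X[OF assms(2)]
  have "unit_at r s o\<^sub>L unit_at t u = isom r o\<^sub>L (adj (isom s) o\<^sub>L isom t) o\<^sub>L adj (isom u)"
    by (simp add: unit_at_def oL_assoc)
  also have "\<dots> = (if s = t then isom r o\<^sub>L Q (rep s) o\<^sub>L adj (isom u) else 0)"
    by (simp add: isom_adj_isom[OF X(2,3)])
  also have "isom r o\<^sub>L Q (rep s) = isom r" using isom(3)[OF X(1)] rep_eq[OF assms(1)] by simp
  finally show ?thesis unfolding unit_at_def .
qed

definition \<zeta>0 where "\<zeta>0 k = (SOME \<xi>. norm \<xi> = 1 \<and> blinfun_apply (Q k) \<xi> = \<xi>)"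

lemma \<zeta>0: "k \<in> X \<Longrightarrow> norm (\<zeta>0 k) = 1" "k \<in> X \<Longrightarrow> blinfun_apply (Q k) (\<zeta>0 k) = \<zeta>0 k"
proof -
  assume "k \<in> X"
  then have "\<exists>\<xi>. norm \<xi> = 1 \<and> blinfun_apply (Q k) \<xi> = \<xi>"
    using unit_vector_in_range PD(2,3)[OF Q_P] by blast
  then show "norm (\<zeta>0 k) = 1" "blinfun_apply (Q k) (\<zeta>0 k) = \<zeta>0 k"
    unfolding \<zeta>0_def by (metis (mono_tags, lifting) someI_ex)+
qed

text \<open>The orthonormal vectors \<open>\<zeta> r\<close> span a subspace that \<open>G\<close> leaves invariant and on which it acts faithfully
  by block diagonal matrices.\<close>

definition \<zeta> where "\<zeta> r = blinfun_apply (isom r) (\<zeta>0 (rep r))"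

lemma Q_\<zeta>: "r \<in> X \<Longrightarrow> blinfun_apply (Q r) (\<zeta> r) = \<zeta> r"
  unfolding \<zeta>_def using isom(2) by (metis blinfun_apply_blinfun_compose)

lemma unit_at_\<zeta>: "(r, s) \<in> E \<Longrightarrow> blinfun_apply (unit_at r s) (\<zeta> s) = \<zeta> r"
proof -
  assume rs: "(r, s) \<in> E"
  note X = E_X[OF rs]
  have "blinfun_apply (unit_at r s) (\<zeta> s) = blinfun_apply (isom r) (blinfun_apply (Q (rep s)) (\<zeta>0 (rep s)))"
    unfolding \<zeta>_def unit_at_def using isom(4)[OF X(2)]
    by (metis blinfun_apply_blinfun_compose)
  then show ?thesis
    using \<zeta>0(2)[OF rep_X[OF X(2)]] rep_eq[OF rs] by (simp add: \<zeta>_def)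
qed

lemma cinner_\<zeta>:
  assumes "r \<in> X" "s \<in> X"
  shows "cinner (\<zeta> r) (\<zeta> s) = (if r = s then 1 else 0)"
proof -
  have "cinner (\<zeta> r) (\<zeta> s) = cinner (blinfun_apply (adj (isom s) o\<^sub>L isom r) (\<zeta>0 (rep r))) (\<zeta>0 (rep s))"
    using cinner_adj_left[OF isom(6)[OF assms(2)]] by (simp add: \<zeta>_def)
  also have "adj (isom s) o\<^sub>L isom r = (if s = r then Q (rep s) else 0)"
    by (rule isom_adj_isom[OF assms(2,1)])
  finally show ?thesis
    using \<zeta>0[OF rep_X[OF assms(1)]] by (cases "r = s") (simp_all add: cinner_self)
qed

definition coeff where "coeff x r s = cinner (blinfun_apply x (\<zeta> s)) (\<zeta> r)"

lemma coeff_corner: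
  assumes "r \<in> X" "s \<in> X"
  shows "coeff (Q r o\<^sub>L x o\<^sub>L Q s) r s = coeff x r s"
proof -
  have "coeff (Q r o\<^sub>L x o\<^sub>L Q s) r s = cinner (blinfun_apply (Q r) (blinfun_apply x (\<zeta> s))) (\<zeta> r)"
    using Q_\<zeta>[OF assms(2)] by (simp add: coeff_def)
  also have "\<dots> = cinner (blinfun_apply x (\<zeta> s)) (blinfun_apply (Q r) (\<zeta> r))"
    using cinner_adj_right[OF PD(4)[OF Q_P[OF assms(1)]]] PD(5)[OF Q_P[OF assms(1)]] by simp
  finally show ?thesis using Q_\<zeta>[OF assms(1)] by (simp add: coeff_def)
qed

text \<open>Conjugation by the partial isometries moves the corner \<open>Q r G Q s\<close> into the one-dimensional corner of
  the representative.\<close>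

lemma corner_expand:
  assumes rs: "r \<in> X" "s \<in> X" and x: "x \<in> G"
  shows "Q r o\<^sub>L x o\<^sub>L Q s = (if (r, s) \<in> E then op_scale (coeff x r s) (unit_at r s) else 0)"
proof (cases "(r, s) \<in> E")
  case True
  define y where "y = adj (isom r) o\<^sub>L x o\<^sub>L isom s"
  have yG: "y \<in> G" unfolding y_def by (intro GD(4,5) isom(1) rs x)
  have "isom r o\<^sub>L (Q (rep r) o\<^sub>L y o\<^sub>L Q (rep s)) o\<^sub>L adj (isom s)
      = (isom r o\<^sub>L Q (rep r)) o\<^sub>L adj (isom r) o\<^sub>L x o\<^sub>L (isom s o\<^sub>L Q (rep s)) o\<^sub>L adj (isom s)"
    by (simp add: y_def oL_assoc)
  also have "\<dots> = (isom r o\<^sub>L adj (isom r)) o\<^sub>L x o\<^sub>L (isom s o\<^sub>L adj (isom s))"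
    using isom(3)[OF rs(1)] isom(3)[OF rs(2)] by (simp add: oL_assoc)
  also have "\<dots> = Q r o\<^sub>L x o\<^sub>L Q s" using isom(5)[OF rs(1)] isom(5)[OF rs(2)] by simp
  finally have eq: "Q r o\<^sub>L x o\<^sub>L Q s = isom r o\<^sub>L (Q (rep r) o\<^sub>L y o\<^sub>L Q (rep r)) o\<^sub>L adj (isom s)"
    using rep_eq[OF True] by simp
  obtain z where z: "Q (rep r) o\<^sub>L y o\<^sub>L Q (rep r) = op_scale z (Q (rep r))"
    using corner_scalar[OF Q_P[OF rep_X[OF rs(1)]] yG] by blast
  have "Q r o\<^sub>L x o\<^sub>L Q s = op_scale z (unit_at r s)"
    unfolding eq z using isom(6)[OF rs(1)] isom(3)[OF rs(1)] by (simp add: unit_at_def)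
  moreover from this have "coeff x r s = z"
    using coeff_corner[OF rs, of x] unit_at_\<zeta>[OF True] cinner_\<zeta>[OF rs(1,1)]
    by (simp add: coeff_def cinner_scaleC_left)
  ultimately show ?thesis using True by simp
next
  case False
  then have "\<not> linked (Q r) (Q s)" using rs by (simp add: E_def)
  then show ?thesis using x False by (simp add: linked_def)
qed

lemma coeff_outside: "x \<in> G \<Longrightarrow> r \<in> X \<Longrightarrow> s \<in> X \<Longrightarrow> (r, s) \<notin> E \<Longrightarrow> coeff x r s = 0"
  using corner_expand[of r s x] coeff_corner[of r s x] by (simp add: coeff_def)

lemma G_expand:
  assumes x: "x \<in> G"
  shows "x = (\<Sum>p\<in>E. op_scale (coeff x (fst p) (snd p)) (unit_at (fst p) (snd p)))"
proof -
  have "x = (\<Sum>r\<in>X. Q r) o\<^sub>L x o\<^sub>L (\<Sum>s\<in>X. Q s)"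
    using e_unit_left[OF x] e_unit_right[OF x] by (simp add: sum_Q)
  also have "\<dots> = (\<Sum>r\<in>X. \<Sum>s\<in>X. Q r o\<^sub>L x o\<^sub>L Q s)"
    by (simp add: oL_sum_left oL_sum_right) (rule sum.swap)
  also have "\<dots> = (\<Sum>p\<in>X \<times> X. Q (fst p) o\<^sub>L x o\<^sub>L Q (snd p))"
    by (simp add: sum.cartesian_product case_prod_beta)
  also have "\<dots> = (\<Sum>p\<in>E. Q (fst p) o\<^sub>L x o\<^sub>L Q (snd p))"
    using finite_X corner_expand[OF _ _ x] by (intro sum.mono_neutral_right) (auto simp: E_X)
  also have "\<dots> = (\<Sum>p\<in>E. op_scale (coeff x (fst p) (snd p)) (unit_at (fst p) (snd p)))"
    using corner_expand[OF _ _ x] by (intro sum.cong) (auto simp: E_X)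
  finally show ?thesis .
qed

definition to_matrix where
  "to_matrix x = (\<Sum>p\<in>E. op_scale (coeff x (fst p) (snd p)) (matunit (fst p) (snd p)))"

definition of_matrix where
  "of_matrix y = (\<Sum>p\<in>E. op_scale (entry y (fst p) (snd p)) (unit_at (fst p) (snd p)))"

lemma to_matrix_in: "to_matrix x \<in> block_alg E"
  unfolding to_matrix_def
  by (intro csubspace_sum csubspace_block_alg csubspaceD(3)[OF csubspace_block_alg] matunit_in_block_alg) simp

lemma entry_to_matrix: "(r, s) \<in> E \<Longrightarrow> entry (to_matrix x) r s = coeff x r s"
proof -
  assume rs: "(r, s) \<in> E"
  have "entry (to_matrix x) r s = (\<Sum>p\<in>E. if p = (r, s) then coeff x r s else 0)"
    unfolding to_matrix_def entry_sum by (rule sum.cong) (auto simp: entry_linear entry_matunit)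
  then show ?thesis using rs finite_E by simp
qed

lemma of_to_matrix: "x \<in> G \<Longrightarrow> of_matrix (to_matrix x) = x"
  unfolding of_matrix_def by (subst (3) G_expand) (auto intro!: sum.cong simp: entry_to_matrix)

lemma of_matrix_in: "of_matrix y \<in> G"
  unfolding of_matrix_def using star_algebra_csubspace[OF G]
  by (intro csubspace_sum csubspaceD(3)[OF star_algebra_csubspace[OF G]] unit_at_G) (auto simp: E_X)

lemma of_matrix_matunit: "(r, s) \<in> E \<Longrightarrow> of_matrix (matunit r s) = unit_at r s"
proof -
  assume rs: "(r, s) \<in> E"
  have "of_matrix (matunit r s) = (\<Sum>p\<in>E. if p = (r, s) then unit_at r s else 0)"
    unfolding of_matrix_def by (rule sum.cong) (auto simp: entry_matunit)
  then show ?thesis using rs finite_E by simp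
qed

lemma of_matrix_linear: "op_linear_on A of_matrix"
  unfolding op_linear_on_def of_matrix_def
  by (auto simp: entry_linear op_scale_add_left sum.distrib op_scale_sum)

lemma to_matrix_linear: "op_linear_on A to_matrix"
  unfolding op_linear_on_def to_matrix_def coeff_def
  by (auto simp: blinfun.add_left cinner_add_left cinner_scaleC_left op_scale_add_left sum.distrib op_scale_sum)

lemma of_matrix_mult:
  assumes x: "x \<in> block_alg E" and y: "y \<in> block_alg E"
  shows "of_matrix (x o\<^sub>L y) = of_matrix x o\<^sub>L of_matrix y"
proof -
  note lin = of_matrix_linear[of UNIV, unfolded op_linear_on_def, simplified]
  have B: "z o\<^sub>L w \<in> block_alg E" if "z \<in> block_alg E" "w \<in> block_alg E" for z w
    using star_algebraD(4)[OF star_algebra_block_alg[OF finite_X equiv_E]] that by blast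
  have zero: "of_matrix 0 = 0" by (simp add: of_matrix_def entry_linear)
  have ob: "of_matrix z \<in> bops" for z by (rule GD(1)[OF of_matrix_in])
  have bb: "z \<in> bops" if "z \<in> block_alg E" for z using that by (simp add: block_alg_iff)
  have 1: "block_alg E \<subseteq> {z. z \<in> bops \<and> of_matrix (z o\<^sub>L matunit t u) = of_matrix z o\<^sub>L of_matrix (matunit t u)}"
    if tu: "(t, u) \<in> E" for t u
  proof (rule block_alg_subset[OF finite_E])
    show "csubspace {z. z \<in> bops \<and> of_matrix (z o\<^sub>L matunit t u) = of_matrix z o\<^sub>L of_matrix (matunit t u)}"
      by (auto simp: csubspace_def zero lin oL_add_left)
    show "matunit r s \<in> {z. z \<in> bops \<and> of_matrix (z o\<^sub>L matunit t u) = of_matrix z o\<^sub>L of_matrix (matunit t u)}"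
      if rs: "(r, s) \<in> E" for r s
      using unit_at_comp[OF rs tu] E_trans[OF rs] tu
      by (auto simp: matunit_comp of_matrix_matunit[OF rs] of_matrix_matunit[OF tu] of_matrix_matunit zero)
  qed
  have "block_alg E \<subseteq> {w. \<forall>z\<in>block_alg E. of_matrix (z o\<^sub>L w) = of_matrix z o\<^sub>L of_matrix w}"
  proof (rule block_alg_subset[OF finite_E])
    show "csubspace {w. \<forall>z\<in>block_alg E. of_matrix (z o\<^sub>L w) = of_matrix z o\<^sub>L of_matrix w}"
      by (auto simp: csubspace_def zero lin oL_add_right bb ob)
    show "matunit t u \<in> {w. \<forall>z\<in>block_alg E. of_matrix (z o\<^sub>L w) = of_matrix z o\<^sub>L of_matrix w}"
      if "(t, u) \<in> E" for t u
      using 1[OF that] by blast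
  qed
  then show ?thesis using x y by blast
qed

lemma of_matrix_unit: "of_matrix (\<Sum>k\<in>X. matunit k k) = e"
proof -
  have "of_matrix (\<Sum>k\<in>X. matunit k k) = (\<Sum>k\<in>X. of_matrix (matunit k k))"
    by (rule op_linear_on_sum[OF of_matrix_linear[of "block_alg E"] csubspace_block_alg])
      (intro matunit_in_block_alg E_refl)
  also have "\<dots> = (\<Sum>k\<in>X. Q k)"
    by (rule sum.cong) (auto simp: of_matrix_matunit E_refl unit_at_diag)
  finally show ?thesis by (simp add: sum_Q)
qed

lemma to_matrix_unit: "to_matrix e = (\<Sum>k\<in>X. matunit k k)"
proof (rule entry_eqI)
  have eG: "e \<in> G" using e_M M(3) by blast
  show "to_matrix e \<in> bops" using to_matrix_in by (simp add: block_alg_iff)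
  fix r s
  have "entry (to_matrix e) r s = (if r \<in> X \<and> r = s then 1 else 0)"
  proof (cases "(r, s) \<in> E")
    case True
    note X = E_X[OF True]
    have "blinfun_apply e (\<zeta> s) = blinfun_apply (e o\<^sub>L Q s) (\<zeta> s)" using Q_\<zeta>[OF X(2)] by simp
    also have "\<dots> = \<zeta> s" using e_P[OF Q_P[OF X(2)]] Q_\<zeta>[OF X(2)] by simp
    finally show ?thesis
      using entry_to_matrix[OF True] cinner_\<zeta>[OF X(2,1)] X by (auto simp: coeff_def)
  next
    case False
    then show ?thesis using block_alg_entry[OF to_matrix_in False] E_refl by auto
  qed
  moreover have "entry (\<Sum>k\<in>X. matunit k k) r s = (if r \<in> X \<and> r = s then 1 else 0)"
  proof -
    have "entry (\<Sum>k\<in>X. matunit k k) r s = (\<Sum>k\<in>X. if k = r then (if r = s then 1 else 0) else 0)"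
      unfolding entry_sum by (rule sum.cong) (auto simp: entry_matunit)
    then show ?thesis using finite_X by (simp split: if_splits)
  qed
  ultimately show "entry (to_matrix e) r s = entry (\<Sum>k\<in>X. matunit k k) r s" by simp
qed simp

lemma cinner_matunit: "cinner (blinfun_apply (matunit r s) \<xi>) \<eta> = ell2_nth \<xi> s * cnj (ell2_nth \<eta> r)"
proof -
  have "cinner (ell2_basis r) \<eta> = cnj (ell2_nth \<eta> r)"
    by (metis cinner_basis_right cinner_commute)
  then show ?thesis by (simp add: cinner_scaleC_left)
qed

text \<open>Compression to the vectors \<open>\<zeta> r\<close> is visibly completely positive.\<close>

lemma to_matrix_cp: "cp_map G (block_alg E) to_matrix"
  unfolding cp_map_def
proof (intro conjI allI impI)
  show "to_matrix ` G \<subseteq> block_alg E" using to_matrix_in by blast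
  show "op_linear_on G to_matrix" by (rule to_matrix_linear)
  fix n and a :: "nat \<Rightarrow> nat \<Rightarrow> complex ell2 op"
  assume a: "(\<forall>i<n. \<forall>j<n. a i j \<in> G) \<and> pos_matrix n a"
  define W where "W \<xi> = (\<Sum>s\<in>X. ell2_nth \<xi> s *\<^sub>C \<zeta> s)" for \<xi> :: "complex ell2"
  have "cinner (blinfun_apply (to_matrix x) \<xi>) \<eta> = cinner (blinfun_apply x (W \<xi>)) (W \<eta>)" if x: "x \<in> G" for x \<xi> \<eta>
  proof -
    have xb: "x \<in> bops" by (rule GD(1)[OF x])
    have "cinner (blinfun_apply x (W \<xi>)) (W \<eta>)
        = (\<Sum>r\<in>X. \<Sum>s\<in>X. coeff x r s * (ell2_nth \<xi> s * cnj (ell2_nth \<eta> r)))"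
      by (simp add: W_def blinfun.sum_right cinner_sum_left cinner_sum_right bops_scaleC[OF xb]
          cinner_scaleC_left cinner_scaleC_right coeff_def sum_distrib_left ac_simps)
    also have "\<dots> = (\<Sum>p\<in>X \<times> X. coeff x (fst p) (snd p) * (ell2_nth \<xi> (snd p) * cnj (ell2_nth \<eta> (fst p))))"
      by (simp add: sum.cartesian_product case_prod_beta)
    also have "\<dots> = (\<Sum>p\<in>E. coeff x (fst p) (snd p) * (ell2_nth \<xi> (snd p) * cnj (ell2_nth \<eta> (fst p))))"
      using finite_X coeff_outside[OF x] by (intro sum.mono_neutral_right) (auto simp: E_X)
    also have "\<dots> = cinner (blinfun_apply (to_matrix x) \<xi>) \<eta>"
      by (simp add: to_matrix_def blinfun.sum_left cinner_sum_left cinner_scaleC_left cinner_matunit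
          del: matunit_apply)
    finally show ?thesis by simp
  qed
  then show "pos_matrix n (\<lambda>i j. to_matrix (a i j))"
    using a unfolding pos_matrix_def by simp
qed

text \<open>The vector indexed by \<open>s\<close> that collects the \<open>k\<close>-th coordinates of \<open>(isom s)\<^sup>* \<xi>\<close>. Expanding inner
  products in coordinates exhibits \<open>of_matrix\<close> as a convergent sum over \<open>k\<close> of compressions along these
  slices, which makes its complete positivity visible.\<close>

definition slice where
  "slice \<xi> k = (\<Sum>s\<in>X. ell2_nth (blinfun_apply (adj (isom s)) \<xi>) k *\<^sub>C ell2_basis s)"

lemma ell2_nth_slice: "s \<in> X \<Longrightarrow> ell2_nth (slice \<xi> k) s = ell2_nth (blinfun_apply (adj (isom s)) \<xi>) k"
proof -
  assume s: "s \<in> X"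
  have "ell2_nth (c *\<^sub>C ell2_basis t) s = (if t = s then c else 0)" for c t
    by (simp add: ell2_nth_linear)
  then have "ell2_nth (slice \<xi> k) s = (\<Sum>t\<in>X. if t = s then ell2_nth (blinfun_apply (adj (isom s)) \<xi>) k else 0)"
    unfolding slice_def cinner_basis_right[symmetric] cinner_sum_left
    unfolding cinner_basis_right by (intro sum.cong) auto
  then show ?thesis using s finite_X by simp
qed

lemma of_matrix_sums:
  assumes y: "y \<in> block_alg E"
  shows "(\<lambda>k. cinner (blinfun_apply y (slice \<xi> k)) (slice \<eta> k)) sums cinner (blinfun_apply (of_matrix y) \<xi>) \<eta>"
proof -
  have "(\<lambda>k. ell2_nth f k * cnj (ell2_nth g k)) sums cinner f g" for f g :: "complex ell2"
    using summable_sums[OF ell2_summable_cinner[of f g]] by (simp add: cinner_ell2_def cinner_complex_def)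
  then have "(\<lambda>k. \<Sum>p\<in>E. entry y (fst p) (snd p) *
      (ell2_nth (blinfun_apply (adj (isom (snd p))) \<xi>) k * cnj (ell2_nth (blinfun_apply (adj (isom (fst p))) \<eta>) k)))
    sums (\<Sum>p\<in>E. entry y (fst p) (snd p) *
      cinner (blinfun_apply (adj (isom (snd p))) \<xi>) (blinfun_apply (adj (isom (fst p))) \<eta>))"
    by (intro sums_sum sums_mult)
  moreover have "(\<Sum>p\<in>E. entry y (fst p) (snd p) *
      cinner (blinfun_apply (adj (isom (snd p))) \<xi>) (blinfun_apply (adj (isom (fst p))) \<eta>))
    = cinner (blinfun_apply (of_matrix y) \<xi>) \<eta>"
    unfolding of_matrix_def blinfun.sum_left cinner_sum_left
  proof (rule sum.cong)
    fix p assume "p \<in> E"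
    then have "fst p \<in> X" by (auto simp: E_def)
    then show "entry y (fst p) (snd p) *
        cinner (blinfun_apply (adj (isom (snd p))) \<xi>) (blinfun_apply (adj (isom (fst p))) \<eta>)
      = cinner (blinfun_apply (op_scale (entry y (fst p) (snd p)) (unit_at (fst p) (snd p))) \<xi>) \<eta>"
      by (simp add: unit_at_def cinner_scaleC_left cinner_adj_right isom(6))
  qed simp
  moreover have "cinner (blinfun_apply y (slice \<xi> k)) (slice \<eta> k) = (\<Sum>p\<in>E. entry y (fst p) (snd p) *
      (ell2_nth (blinfun_apply (adj (isom (snd p))) \<xi>) k * cnj (ell2_nth (blinfun_apply (adj (isom (fst p))) \<eta>) k)))" for k
  proof -
    have "cinner (blinfun_apply y (slice \<xi> k)) (slice \<eta> k)
        = (\<Sum>p\<in>E. entry y (fst p) (snd p) * (ell2_nth (slice \<xi> k) (snd p) * cnj (ell2_nth (slice \<eta> k) (fst p))))"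
      by (subst (1) block_expand[OF finite_E y])
        (simp add: case_prod_beta blinfun.sum_left cinner_sum_left cinner_scaleC_left cinner_matunit del: matunit_apply)
    also have "\<dots> = (\<Sum>p\<in>E. entry y (fst p) (snd p) *
      (ell2_nth (blinfun_apply (adj (isom (snd p))) \<xi>) k * cnj (ell2_nth (blinfun_apply (adj (isom (fst p))) \<eta>) k)))"
      by (rule sum.cong) (auto simp: E_def ell2_nth_slice)
    finally show ?thesis .
  qed
  ultimately show ?thesis by simp
qed

lemma of_matrix_cp: "cp_map (block_alg E) G of_matrix"
  unfolding cp_map_def
proof (intro conjI allI impI)
  show "of_matrix ` block_alg E \<subseteq> G" using of_matrix_in by blast
  show "op_linear_on (block_alg E) of_matrix" by (rule of_matrix_linear)
  fix n and a :: "nat \<Rightarrow> nat \<Rightarrow> complex ell2 op"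
  assume a: "(\<forall>i<n. \<forall>j<n. a i j \<in> block_alg E) \<and> pos_matrix n a"
  show "pos_matrix n (\<lambda>i j. of_matrix (a i j))"
    unfolding pos_matrix_def
  proof (intro allI)
    fix \<xi> :: "nat \<Rightarrow> complex ell2"
    have s: "(\<lambda>k. \<Sum>i<n. \<Sum>j<n. cinner (blinfun_apply (a i j) (slice (\<xi> j) k)) (slice (\<xi> i) k))
      sums (\<Sum>i<n. \<Sum>j<n. cinner (blinfun_apply (of_matrix (a i j)) (\<xi> j)) (\<xi> i))"
      using a by (intro sums_sum of_matrix_sums) simp
    have pos: "(\<Sum>i<n. \<Sum>j<n. cinner (blinfun_apply (a i j) (slice (\<xi> j) k)) (slice (\<xi> i) k)) \<in> \<real>\<^sub>\<ge>\<^sub>0" for k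
      using a unfolding pos_matrix_def by (elim conjE allE[of _ "\<lambda>j. slice (\<xi> j) k"])
    have "0 \<le> Re (\<Sum>i<n. \<Sum>j<n. cinner (blinfun_apply (of_matrix (a i j)) (\<xi> j)) (\<xi> i))"
      by (rule sums_le[OF _ sums_zero sums_Re[OF s]]) (use pos in \<open>simp only: nonneg_Reals_complex_iff\<close>)
    moreover have "(\<lambda>k::nat. 0) sums Im (\<Sum>i<n. \<Sum>j<n. cinner (blinfun_apply (of_matrix (a i j)) (\<xi> j)) (\<xi> i))"
      using sums_Im[OF s] pos by (simp only: nonneg_Reals_complex_iff)
    then have "Im (\<Sum>i<n. \<Sum>j<n. cinner (blinfun_apply (of_matrix (a i j)) (\<xi> j)) (\<xi> i)) = 0"
      by (rule sums_unique2[OF _ sums_zero])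
    ultimately show "(\<Sum>i<n. \<Sum>j<n. cinner (blinfun_apply (of_matrix (a i j)) (\<xi> j)) (\<xi> i)) \<in> \<real>\<^sub>\<ge>\<^sub>0"
      by (simp only: nonneg_Reals_complex_iff)
  qed
qed

lemma to_matrix_contractive: "contractive_on G to_matrix"
  unfolding contractive_on_def
proof
  fix x assume x: "x \<in> G"
  interpret unital_cp_map G "block_alg E" to_matrix e
    using G e_M M(3) e_unit_left e_unit_right to_matrix_cp
    by unfold_locales (auto simp: block_alg_iff)
  have "projection (\<Sum>k\<in>X. matunit k k)"
    using block_alg_unit(2)[OF finite_X equiv_E block_alg_unit(1)[OF finite_X equiv_E]]
    by (simp add: projection_def adj_sum)
  then have "norm (to_matrix e) \<le> 1" unfolding to_matrix_unit by (rule projection_norm_le)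
  then have "norm x * norm (to_matrix e) \<le> norm x" by (simp add: mult_left_le)
  then show "norm (to_matrix x) \<le> norm x" using norm_le_unit[OF x] by linarith
qed

lemma of_matrix_contractive: "contractive_on (block_alg E) of_matrix"
  unfolding contractive_on_def
proof
  fix x assume x: "x \<in> block_alg E"
  interpret unital_cp_map "block_alg E" G of_matrix "\<Sum>k\<in>X. matunit k k"
    using star_algebra_block_alg[OF finite_X equiv_E] block_alg_unit[OF finite_X equiv_E] of_matrix_cp GD(1)
    by unfold_locales auto
  have "norm (of_matrix (\<Sum>k\<in>X. matunit k k)) \<le> 1"
    unfolding of_matrix_unit by (rule projection_norm_le[OF e_projection])
  then have "norm x * norm (of_matrix (\<Sum>k\<in>X. matunit k k)) \<le> norm x" by (simp add: mult_left_le)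
  then show "norm (of_matrix x) \<le> norm x" using norm_le_unit[OF x] by linarith
qed

text \<open>\<open>m \<zeta>\<^sub>s\<close> is a multiple of \<open>\<zeta>\<^sub>s\<close>, and the vectors \<open>\<zeta>\<^sub>r\<close> are orthonormal.\<close>

lemma to_matrix_diagonal:
  assumes m: "m \<in> M"
  shows "to_matrix m \<in> block_alg (Id_on X)"
  unfolding block_alg_iff
proof (intro conjI allI impI)
  show "to_matrix m \<in> bops" using to_matrix_in by (simp add: block_alg_iff)
  fix r s assume rs: "(r, s) \<notin> Id_on X"
  show "entry (to_matrix m) r s = 0"
  proof (cases "(r, s) \<in> E")
    case True
    note X = E_X[OF True]
    obtain z where z: "Q s o\<^sub>L m = op_scale z (Q s)" using PD(8)[OF Q_P[OF X(2)] m] by blast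
    have "blinfun_apply m (\<zeta> s) = blinfun_apply (m o\<^sub>L Q s) (\<zeta> s)" using Q_\<zeta>[OF X(2)] by simp
    also have "m o\<^sub>L Q s = op_scale z (Q s)" using z M_comm[OF m PD(1)[OF Q_P[OF X(2)]]] by simp
    also have "blinfun_apply (op_scale z (Q s)) (\<zeta> s) = z *\<^sub>C \<zeta> s" using Q_\<zeta>[OF X(2)] by simp
    finally show ?thesis
      using entry_to_matrix[OF True] cinner_\<zeta>[OF X(2,1)] rs X by (auto simp: coeff_def cinner_scaleC_left)
  qed (rule block_alg_entry[OF to_matrix_in])
qed

end

section \<open>Supporting homomorphisms and the diagonal\<close>

text \<open>For an approximate unit \<open>u\<close> of \<open>A\<close> in \<open>D\<close>, the elements \<open>a u a\<^sup>*\<close> of \<open>D\<close> converge to \<open>a a\<^sup>*\<close>.\<close>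

lemma nondegenerate_comp_adj:
  assumes nd: "nondegenerate D A" and D: "closed D" and a: "a \<in> normalisers A D"
  shows "a o\<^sub>L adj a \<in> D"
proof -
  obtain U where U: "approx_unit U A" "\<forall>\<^sub>F u in U. u \<in> D" using nd by (auto simp: nondegenerate_def)
  have "a \<in> A" using a by (simp add: normalisers_def)
  then have "((\<lambda>u. a o\<^sub>L u) \<longlongrightarrow> a) U" "U \<noteq> bot" using U(1) by (auto simp: approx_unit_def)
  moreover have "\<forall>\<^sub>F u in U. a o\<^sub>L u o\<^sub>L adj a \<in> D"
    using U(2) by eventually_elim (use a in \<open>simp add: normalisers_def\<close>)
  ultimately show ?thesis
    using Lim_in_closed_set[OF D, of "\<lambda>u. a o\<^sub>L u o\<^sub>L adj a" U "a o\<^sub>L adj a"]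
      tendsto_oL[OF _ tendsto_const, of "\<lambda>u. a o\<^sub>L u" a U "adj a"] by blast
qed

text \<open>The operators that vanish on the kernel of \<open>h\<close> together with their adjoints form a C*-algebra. The
  condition on the adjoint is expressed by inner products, which makes closedness evident.\<close>

lemma cstar_generated_kernel:
  assumes h: "h \<in> bops" "adj h = h" and S: "S \<subseteq> bops"
    and ker: "\<And>c \<xi> \<eta>. c \<in> S \<Longrightarrow> blinfun_apply h \<xi> = 0 \<Longrightarrow> blinfun_apply c \<xi> = 0 \<and> cinner (blinfun_apply c \<eta>) \<xi> = 0"
    and c: "c \<in> cstar_generated S" and \<xi>: "blinfun_apply h \<xi> = 0"
  shows "blinfun_apply c \<xi> = 0"
proof -
  define K where "K = {c \<in> bops. \<forall>\<xi>. blinfun_apply h \<xi> = 0 \<longrightarrow>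
    blinfun_apply c \<xi> = 0 \<and> (\<forall>\<eta>. cinner (blinfun_apply c \<eta>) \<xi> = 0)}"
  have "star_algebra K"
    unfolding star_algebra_def
  proof (intro conjI ballI allI)
    fix a b assume ab: "a \<in> K" "b \<in> K"
    then show "a + b \<in> K" "a o\<^sub>L b \<in> K"
      by (auto simp: K_def blinfun.add_left cinner_add_left)
  next
    fix a assume a: "a \<in> K"
    then have ab: "a \<in> bops" by (simp add: K_def)
    show "adj a \<in> K"
      unfolding K_def
    proof (intro CollectI conjI allI impI)
      fix \<xi> \<eta> assume "blinfun_apply h \<xi> = 0"
      then have z: "blinfun_apply a \<xi> = 0" "\<And>\<eta>. cinner (blinfun_apply a \<eta>) \<xi> = 0" using a by (auto simp: K_def)
      show "blinfun_apply (adj a) \<xi> = 0"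
        by (rule cinner_extI) (simp add: z(2) flip: cinner_adj_right[OF ab])
      show "cinner (blinfun_apply (adj a) \<eta>) \<xi> = 0" using z(1) by (simp add: cinner_adj_left[OF ab])
    qed (use ab in simp)
    show "op_scale z a \<in> K" for z using a by (auto simp: K_def cinner_scaleC_left)
  qed (auto simp: K_def)
  moreover have "closed K"
  proof -
    have "K = bops \<inter> (\<Inter>\<xi>\<in>{\<xi>. blinfun_apply h \<xi> = 0}. {c. blinfun_apply c \<xi> = 0} \<inter>
        (\<Inter>\<eta>. {c. cinner (blinfun_apply c \<eta>) \<xi> = 0}))"
      by (auto simp: K_def)
    also have "closed \<dots>"
      by (intro closed_Int closed_bops closed_INT ballI closed_Collect_eq
          bounded_bilinear.continuous_on[OF bounded_bilinear_cinner] blinfun.continuous_on continuous_intros)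
    finally show ?thesis .
  qed
  moreover have "S \<subseteq> K" using S ker by (auto simp: K_def)
  ultimately have "cstar_generated S \<subseteq> K" by (intro cstar_generated_least) (simp_all add: cstar_algebra_def)
  then show ?thesis using c \<xi> by (auto simp: K_def)
qed

text \<open>If \<open>p\<close> is a projection and \<open>\<phi> p = h \<pi> p\<close> normalises \<open>D\<close>, then nondegeneracy puts
  \<open>k = \<phi> p (\<phi> p)\<^sup>*\<close> into \<open>D\<close>, so \<open>k\<close> commutes with \<open>D\<close>; and \<open>\<pi> p\<close> is the support projection of \<open>k\<close>.\<close>

lemma supporting_hom_commutes:
  fixes \<phi> :: "'k::chilbert_space op \<Rightarrow> 'h::chilbert_space op"
  assumes supp: "supporting_hom F \<phi> \<pi>" and F: "\<phi> ` F \<subseteq> bops" and p: "p \<in> F" "projection p"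
    and D: "cstar_algebra D" "abelian D" and nd: "nondegenerate D A" and nor: "\<phi> p \<in> normalisers A D"
  shows "\<pi> p \<in> commutant D"
proof -
  obtain h C where C: "C = cstar_generated (\<phi> ` F)" and h: "h \<in> multipliers C \<inter> commutant C" "pos_op h"
    and hom: "star_hom F (multipliers C \<inter> commutant {h}) \<pi>" and \<phi>: "\<forall>a\<in>F. \<phi> a = h o\<^sub>L \<pi> a"
    using supp unfolding supporting_hom_def by blast
  have hb: "h \<in> bops" "adj h = h" using h(2) pos_op_bops pos_op_adj by auto
  have pa: "adj p = p" "p o\<^sub>L p = p" using p(2) by (auto simp: projection_def)
  have pib: "\<pi> b \<in> bops" "h o\<^sub>L \<pi> b = \<pi> b o\<^sub>L h" "\<pi> b \<in> multipliers C" if "b \<in> F" for b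
    using hom that by (auto simp: star_hom_def commutant_def)
  have ker_C: "blinfun_apply c \<xi> = 0" if "c \<in> C" "blinfun_apply h \<xi> = 0" for c \<xi>
  proof (rule cstar_generated_kernel[OF hb F _ _ that(2)])
    show "c \<in> cstar_generated (\<phi> ` F)" using that(1) C by simp
    fix c \<xi> \<eta> assume "c \<in> \<phi> ` F" and \<xi>: "blinfun_apply h \<xi> = 0"
    then obtain b where b: "b \<in> F" "c = \<phi> b" by blast
    have "c = \<pi> b o\<^sub>L h" using \<phi> b pib(2)[OF b(1)] by simp
    then have "blinfun_apply c \<xi> = 0" using \<xi> by simp
    moreover have "cinner (blinfun_apply c \<eta>) \<xi> = 0"
      using \<phi> b cinner_adj_right[OF hb(1)] hb(2) \<xi> by simp
    ultimately show "blinfun_apply c \<xi> = 0 \<and> cinner (blinfun_apply c \<eta>) \<xi> = 0" by blast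
  qed
  define q where "q = \<pi> p"
  have q: "q \<in> bops" "h o\<^sub>L q = q o\<^sub>L h" "q \<in> multipliers C" using pib[OF p(1)] by (auto simp: q_def)
  have qq: "adj q = q" "q o\<^sub>L q = q"
    using hom p(1) pa unfolding star_hom_def q_def by metis+
  define a where "a = \<phi> p"
  have a: "a = h o\<^sub>L q" using \<phi> p(1) by (simp add: a_def q_def)
  have ab: "a \<in> bops" using a hb q by simp
  have aa: "adj a = a" using a hb q qq by (simp add: adj_comp)
  define k where "k = a o\<^sub>L a"
  have kD: "k \<in> D"
    using nondegenerate_comp_adj[OF nd _ nor] D(1) aa by (simp add: cstar_algebra_def k_def a_def)
  have aq: "a o\<^sub>L q = a" using a qq by (simp add: oL_assoc)
  have kq: "k o\<^sub>L q = k" using aq by (simp add: k_def oL_assoc)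
  have ker_k: "blinfun_apply q \<xi> = 0" if "blinfun_apply k \<xi> = 0" for \<xi>
  proof -
    have "cinner (blinfun_apply a \<xi>) (blinfun_apply a \<xi>) = 0"
      using adj_comp_self_apply[OF ab, of \<xi>] that aa by (simp add: k_def)
    then have "blinfun_apply h (blinfun_apply q \<xi>) = 0" using a by simp
    then have "\<forall>c\<in>C. blinfun_apply c (blinfun_apply q \<xi>) = 0" using ker_C by blast
    then have "blinfun_apply q (blinfun_apply q \<xi>) = 0" using q(3) by (simp add: multipliers_def)
    then show ?thesis using qq(2) by (metis blinfun_apply_blinfun_compose)
  qed
  note DD = star_algebraD[of D]
  have Ds: "star_algebra D" using D(1) by (simp add: cstar_algebra_def)
  have corner: "q o\<^sub>L x = q o\<^sub>L x o\<^sub>L q" if x: "x \<in> D" for x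
  proof (rule blinfun_eqI)
    fix \<zeta>
    define \<xi> where "\<xi> = \<zeta> - blinfun_apply q \<zeta>"
    have "blinfun_apply k \<xi> = 0"
      unfolding \<xi>_def blinfun.diff_right using kq by (metis blinfun_apply_blinfun_compose diff_self)
    moreover have "k o\<^sub>L x = x o\<^sub>L k" using D(2) kD x by (auto simp: abelian_def)
    ultimately have "blinfun_apply k (blinfun_apply x \<xi>) = 0"
      by (metis blinfun_apply_blinfun_compose blinfun.zero_right)
    then have "blinfun_apply q (blinfun_apply x \<xi>) = 0" by (rule ker_k)
    then show "blinfun_apply (q o\<^sub>L x) \<zeta> = blinfun_apply (q o\<^sub>L x o\<^sub>L q) \<zeta>"
      by (simp add: \<xi>_def blinfun.diff_right)
  qed
  have "q o\<^sub>L x = x o\<^sub>L q" if x: "x \<in> D" for x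
  proof -
    have xb: "x \<in> bops" "adj x \<in> D" using DD[OF Ds] x by auto
    have "adj (q o\<^sub>L adj x) = adj (q o\<^sub>L adj x o\<^sub>L q)" using corner[OF xb(2)] by simp
    then have "x o\<^sub>L q = q o\<^sub>L x o\<^sub>L q" using xb q qq by (simp add: adj_comp oL_assoc)
    then show ?thesis using corner[OF x] by simp
  qed
  then show ?thesis using q(1) by (simp add: commutant_def q_def)
qed

section \<open>Orthogonal sums of algebras\<close>

lemma dsum_mem:
  assumes "\<And>i. i \<le> d \<Longrightarrow> 0 \<in> F i" "i \<le> d" "x \<in> F i"
  shows "x \<in> dsum d F"
proof -
  define y where "y j = (if j = i then x else 0)" for j
  have "x = (\<Sum>j\<le>d. y j)" using assms(2) by (simp add: y_def)
  moreover have "\<forall>j\<le>d. y j \<in> F j" using assms by (simp add: y_def)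
  ultimately show ?thesis by (auto simp: dsum_def)
qed

lemma dsum_comp_component:
  assumes orth: "orthogonal_algs d F" and i: "i \<le> d" "x \<in> F i" and y: "\<And>j. j \<le> d \<Longrightarrow> y j \<in> F j"
  shows "x o\<^sub>L (\<Sum>j\<le>d. y j) = x o\<^sub>L y i" "(\<Sum>j\<le>d. y j) o\<^sub>L x = y i o\<^sub>L x"
proof -
  have zero: "x o\<^sub>L y j = 0" "y j o\<^sub>L x = 0" if "j \<le> d" "j \<noteq> i" for j
    using orth i y[OF that(1)] that by (auto simp: orthogonal_algs_def)
  have "x o\<^sub>L (\<Sum>j\<le>d. y j) = (\<Sum>j\<le>d. if j = i then x o\<^sub>L y i else 0)"
    unfolding oL_sum_right by (rule sum.cong) (auto simp: zero)
  then show "x o\<^sub>L (\<Sum>j\<le>d. y j) = x o\<^sub>L y i" using i by simp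
  have "(\<Sum>j\<le>d. y j) o\<^sub>L x = (\<Sum>j\<le>d. if j = i then y i o\<^sub>L x else 0)"
    unfolding oL_sum_left by (rule sum.cong) (auto simp: zero)
  then show "(\<Sum>j\<le>d. y j) o\<^sub>L x = y i o\<^sub>L x" using i by simp
qed

lemma star_algebra_dsum:
  assumes F: "\<And>i. i \<le> d \<Longrightarrow> star_algebra (F i)" and orth: "orthogonal_algs d F"
  shows "star_algebra (dsum d F)"
proof -
  note FD = star_algebraD[OF F]
  have mem: "(\<Sum>i\<le>d. x i) \<in> dsum d F" if "\<And>i. i \<le> d \<Longrightarrow> x i \<in> F i" for x
    using that by (auto simp: dsum_def)
  have get: "\<exists>x. a = (\<Sum>i\<le>d. x i) \<and> (\<forall>i\<le>d. x i \<in> F i)" if "a \<in> dsum d F" for a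
    using that by (auto simp: dsum_def)
  show ?thesis
    unfolding star_algebra_def
  proof (intro conjI ballI allI)
    show "dsum d F \<subseteq> bops" using FD(1) by (fastforce simp: dsum_def intro!: bops_sum)
    show "0 \<in> dsum d F" using dsum_mem[of d F 0 0] FD(2) by simp
  next
    fix a b assume "a \<in> dsum d F" "b \<in> dsum d F"
    then obtain x y where x: "a = (\<Sum>i\<le>d. x i)" "\<forall>i\<le>d. x i \<in> F i" and y: "b = (\<Sum>i\<le>d. y i)" "\<forall>i\<le>d. y i \<in> F i"
      using get by metis
    have "a + b = (\<Sum>i\<le>d. x i + y i)" by (simp add: x y sum.distrib)
    also have "\<dots> \<in> dsum d F" by (rule mem) (use FD(3) x y in auto)
    finally show "a + b \<in> dsum d F" .
    have "a o\<^sub>L b = (\<Sum>i\<le>d. x i o\<^sub>L (\<Sum>j\<le>d. y j))" by (simp add: x(1) y(1) oL_sum_left)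
    also have "\<dots> = (\<Sum>i\<le>d. x i o\<^sub>L y i)"
      using x y by (intro sum.cong dsum_comp_component(1)[OF orth]) auto
    also have "\<dots> \<in> dsum d F" by (rule mem) (use FD(4) x y in auto)
    finally show "a o\<^sub>L b \<in> dsum d F" .
  next
    fix a assume "a \<in> dsum d F"
    then obtain x where x: "a = (\<Sum>i\<le>d. x i)" "\<forall>i\<le>d. x i \<in> F i" using get by metis
    have "adj a = (\<Sum>i\<le>d. adj (x i))" unfolding x(1) by (rule adj_sum) (use x(2) FD(1) in auto)
    also have "\<dots> \<in> dsum d F" by (rule mem) (use FD(5) x in auto)
    finally show "adj a \<in> dsum d F" .
    fix c
    have "op_scale c a = (\<Sum>i\<le>d. op_scale c (x i))" by (simp add: x(1) op_scale_sum)
    also have "\<dots> \<in> dsum d F" by (rule mem) (use FD(6) x in auto)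
    finally show "op_scale c a \<in> dsum d F" .
  qed
qed

lemma finite_dim_dsum:
  assumes "\<And>i. i \<le> d \<Longrightarrow> finite_dim (F i)"
  shows "finite_dim (dsum d F)"
proof -
  obtain S where S: "\<And>i. i \<le> d \<Longrightarrow> finite (S i) \<and> F i \<subseteq> span (S i)"
    using assms unfolding finite_dim_def by metis
  have "dsum d F \<subseteq> span (\<Union>i\<le>d. S i)"
  proof
    fix a assume "a \<in> dsum d F"
    then obtain x where x: "a = (\<Sum>i\<le>d. x i)" "\<forall>i\<le>d. x i \<in> F i" by (auto simp: dsum_def)
    have "x i \<in> span (\<Union>i\<le>d. S i)" if "i \<le> d" for i
      using S[OF that] x(2) that span_mono[of "S i" "\<Union>i\<le>d. S i"] by blast
    then show "a \<in> span (\<Union>i\<le>d. S i)" unfolding x(1) by (intro span_sum) simp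
  qed
  then show ?thesis using S unfolding finite_dim_def by (intro exI[of _ "\<Union>i\<le>d. S i"]) auto
qed

lemma cp_map_compose:
  assumes "cp_map A B \<psi>" "cp_map B C \<phi>"
  shows "cp_map A C (\<lambda>a. \<phi> (\<psi> a))"
  unfolding cp_map_def
proof (intro conjI allI impI)
  have B: "\<psi> a \<in> B" if "a \<in> A" for a using assms(1) that by (auto simp: cp_map_def)
  show "(\<lambda>a. \<phi> (\<psi> a)) ` A \<subseteq> C" using assms(2) B by (auto simp: cp_map_def)
  show "op_linear_on A (\<lambda>a. \<phi> (\<psi> a))" using assms B by (simp add: cp_map_def op_linear_on_def)
  fix n a assume a: "(\<forall>i<n. \<forall>j<n. a i j \<in> A) \<and> pos_matrix n a"
  have "pos_matrix n (\<lambda>i j. \<psi> (a i j))" by (rule cp_mapD[OF assms(1)]) (use a in auto)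
  then show "pos_matrix n (\<lambda>i j. \<phi> (\<psi> (a i j)))"
    by (rule cp_mapD[OF assms(2), rotated]) (use a B in auto)
qed

lemma cp_map_restrict:
  assumes "cp_map A B \<phi>" "A' \<subseteq> A"
  shows "cp_map A' B \<phi>"
  using assms by (auto simp: cp_map_def op_linear_on_def subset_iff)

section \<open>From diagonal dimension to generalised diagonal dimension\<close>

lemma tendsto_scaleC_left:
  fixes w :: "'h::chilbert_space"
  assumes "(f \<longlongrightarrow> c) U"
  shows "((\<lambda>u. f u *\<^sub>C w) \<longlongrightarrow> c *\<^sub>C w) U"
proof -
  have "bounded_linear (\<lambda>z. z *\<^sub>C w)"
    by (rule bounded_linear_intro[where K = "norm w"])
      (simp_all add: scaleC_add_left norm_scaleC scaleR_conv_of_real scaleC_scaleC[symmetric] scaleC_of_real)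
  then show ?thesis using assms by (rule bounded_linear.tendsto)
qed

lemma approx_unit_complex_tendsto:
  assumes "approx_unit U complex_alg"
  shows "((\<lambda>u. blinfun_apply u 1) \<longlongrightarrow> (1 :: complex)) U"
proof -
  have "id_blinfun \<in> complex_alg"
    using mult_right_one by (auto simp: complex_alg_def intro: range_eqI[of _ _ 1])
  then have "((\<lambda>u. u o\<^sub>L id_blinfun) \<longlongrightarrow> (id_blinfun :: complex op)) U" using assms by (simp add: approx_unit_def)
  then have "((\<lambda>u. blinfun_apply (u o\<^sub>L id_blinfun) 1) \<longlongrightarrow> blinfun_apply (id_blinfun :: complex op) 1) U"
    by (intro blinfun.tendsto tendsto_const)
  then show ?thesis by simp
qed

locale diagonal_decomposition =
  fixes d :: nat and F DF :: "nat \<Rightarrow> complex ell2 op set"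
  assumes F: "\<And>i. i \<le> d \<Longrightarrow> star_algebra (F i)" and F_fd: "\<And>i. i \<le> d \<Longrightarrow> finite_dim (F i)"
    and orth: "orthogonal_algs d F"
    and DF: "\<And>i. i \<le> d \<Longrightarrow> star_algebra (DF i)" "\<And>i. i \<le> d \<Longrightarrow> DF i \<subseteq> F i"
    and masa_dsum: "masa (dsum d DF) (dsum d F)"
begin

sublocale finite_dim_masa "dsum d F" "dsum d DF"
  using star_algebra_dsum[OF F orth] finite_dim_dsum[OF F_fd] masa_dsum by unfold_locales

lemma orth_DF: "orthogonal_algs d DF"
  using orth DF(2) unfolding orthogonal_algs_def by blast

lemma DF_dsum: "i \<le> d \<Longrightarrow> x \<in> DF i \<Longrightarrow> x \<in> dsum d DF"
  using dsum_mem[of d DF] star_algebraD(2)[OF DF(1)] by blast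

lemma F_ideal:
  assumes "i \<le> d" "x \<in> F i" "g \<in> dsum d F"
  shows "x o\<^sub>L g \<in> F i"
proof -
  obtain y where y: "g = (\<Sum>j\<le>d. y j)" "\<And>j. j \<le> d \<Longrightarrow> y j \<in> F j" using assms(3) by (auto simp: dsum_def)
  then have "x o\<^sub>L g = x o\<^sub>L y i" using dsum_comp_component(1)[OF orth assms(1,2)] by simp
  then show ?thesis using star_algebraD(4)[OF F[OF assms(1)] assms(2) y(2)[OF assms(1)]] by simp
qed

text \<open>If \<open>p\<close> is the sum of the \<open>x\<^sub>i\<close>, then \<open>p x\<^sub>i = x\<^sub>i\<^sup>2\<close> is a multiple of \<open>p\<close>, and it is nonzero for
  some \<open>i\<close>.\<close>

lemma P_component:
  assumes p: "p \<in> P"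
  shows "\<exists>i\<le>d. p \<in> DF i"
proof -
  obtain x where x: "p = (\<Sum>i\<le>d. x i)" "\<And>i. i \<le> d \<Longrightarrow> x i \<in> DF i" using PD(1)[OF p] by (auto simp: dsum_def)
  have xx: "p o\<^sub>L x i = x i o\<^sub>L x i" if "i \<le> d" for i
    using dsum_comp_component(2)[OF orth_DF that x(2)[OF that] x(2)] x(1) by simp
  have "\<exists>i\<le>d. p o\<^sub>L x i \<noteq> 0"
  proof (rule ccontr)
    assume "\<not> ?thesis"
    then have "p o\<^sub>L p = 0" by (subst (2) x(1)) (simp add: oL_sum_right)
    then show False using PD(3,6)[OF p] by simp
  qed
  then obtain i where i: "i \<le> d" "p o\<^sub>L x i \<noteq> 0" by blast
  obtain z where z: "p o\<^sub>L x i = op_scale z p" using PD(8)[OF p DF_dsum[OF i(1) x(2)[OF i(1)]]] by blast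
  then have "z \<noteq> 0" using i(2) by auto
  then have "p = op_scale (1 / z) (x i o\<^sub>L x i)" using z xx[OF i(1)] by simp
  moreover have "op_scale (1 / z) (x i o\<^sub>L x i) \<in> DF i"
    using star_algebraD(4,6)[OF DF(1)[OF i(1)]] x(2)[OF i(1)] by blast
  ultimately show ?thesis using i(1) by metis
qed

lemma P_component_unique:
  assumes "p \<in> P" "i \<le> d" "j \<le> d" "p \<in> F i" "p \<in> F j"
  shows "i = j"
  using assms orth PD(3,6)[OF assms(1)] unfolding orthogonal_algs_def by metis

lemma P_component_diagonal: "p \<in> P \<Longrightarrow> i \<le> d \<Longrightarrow> p \<in> F i \<Longrightarrow> p \<in> DF i"
  using P_component P_component_unique DF(2) by blast

end

locale diagonal_model = diagonal_decomposition d F DF + matrix_model "dsum d F" "dsum d DF" Q X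
  for d F DF Q X
begin

definition XX where "XX i = {r \<in> X. Q r \<in> F i}"
definition EE where "EE i = {(r, s) \<in> E. r \<in> XX i \<and> s \<in> XX i}"

lemma XX_subset: "XX i \<subseteq> X" by (auto simp: XX_def)

lemma Union_XX: "(\<Union>i\<le>d. XX i) = X"
  using P_component[OF Q_P] DF(2) by (fastforce simp: XX_def)

lemma XX_disjoint: "i \<le> d \<Longrightarrow> j \<le> d \<Longrightarrow> i \<noteq> j \<Longrightarrow> XX i \<inter> XX j = {}"
  using P_component_unique[OF Q_P] by (auto simp: XX_def)

lemma equiv_EE: "equiv (XX i) (EE i)"
proof (rule equivI)
  show "refl_on (XX i) (EE i)" using E_refl XX_subset by (auto simp: EE_def refl_on_def)
  show "sym (EE i)" using E_sym by (auto simp: EE_def sym_def)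
  show "trans (EE i)" using E_trans unfolding EE_def trans_def by blast
qed (auto simp: EE_def)

text \<open>\<open>Q r G Q s\<close> is nonzero only if \<open>Q r\<close> and \<open>Q s\<close> lie in the same summand.\<close>

lemma E_component:
  assumes rs: "(r, s) \<in> E" and i: "i \<le> d" "r \<in> XX i"
  shows "s \<in> XX i"
proof -
  note X = E_X[OF rs]
  obtain j where j: "j \<le> d" "Q s \<in> F j" using P_component[OF Q_P[OF X(2)]] DF(2) by blast
  obtain g where g: "g \<in> dsum d F" "Q r o\<^sub>L g o\<^sub>L Q s \<noteq> 0" using rs by (auto simp: E_def linked_def)
  have "Q r o\<^sub>L g \<in> F i" using F_ideal[OF i(1) _ g(1)] i(2) by (simp add: XX_def)
  then have "i = j" using orth i(1) j g(2) unfolding orthogonal_algs_def by blast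
  then show ?thesis using j X by (simp add: XX_def)
qed

lemma Union_EE: "(\<Union>i\<le>d. EE i) = E"
proof
  show "E \<subseteq> (\<Union>i\<le>d. EE i)"
  proof (rule subrelI)
    fix r s assume rs: "(r, s) \<in> E"
    then have "r \<in> (\<Union>i\<le>d. XX i)" using E_X Union_XX by blast
    then obtain i where "i \<le> d" "r \<in> XX i" by blast
    then show "(r, s) \<in> (\<Union>i\<le>d. EE i)" using rs E_component[OF rs] by (auto simp: EE_def)
  qed
qed (auto simp: EE_def)

lemma EE_E: "(r, s) \<in> EE i \<Longrightarrow> (r, s) \<in> E" "(r, s) \<in> EE i \<Longrightarrow> r \<in> XX i" "(r, s) \<in> EE i \<Longrightarrow> s \<in> XX i"
  by (auto simp: EE_def)

lemma finite_XX: "finite (XX i)"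
  using finite_X XX_subset by (rule finite_subset[rotated])

lemma finite_EE: "finite (EE i)"
  by (rule finite_equiv[OF finite_XX equiv_EE])

lemma block_EE_subset: "block_alg (EE i) \<subseteq> block_alg E"
  by (rule block_alg_mono) (auto simp: EE_def)

lemma dsum_block_EE: "dsum d (\<lambda>i. block_alg (EE i)) = block_alg E"
proof -
  have "dsum d (\<lambda>i. block_alg (EE i)) = block_alg (\<Union>i\<le>d. EE i)"
    by (rule dsum_block_alg) (use finite_EE XX_disjoint in \<open>auto dest!: EE_E\<close>)
  then show ?thesis by (simp only: Union_EE)
qed

lemma dsum_diagonal_XX: "dsum d (\<lambda>i. block_alg (Id_on (XX i))) = block_alg (Id_on X)"
proof -
  have "dsum d (\<lambda>i. block_alg (Id_on (XX i))) = block_alg (\<Union>i\<le>d. Id_on (XX i))"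
    by (rule dsum_block_alg) (use finite_equiv[OF finite_XX equiv_Id_on] XX_disjoint in auto)
  also have "(\<Union>i\<le>d. Id_on (XX i)) = Id_on X" using Union_XX by auto
  finally show ?thesis .
qed

lemma unit_at_component:
  assumes "i \<le> d" "(r, s) \<in> EE i"
  shows "unit_at r s \<in> F i"
proof -
  note E = EE_E[OF assms(2)]
  note X = E_X[OF E(1)]
  have "Q r o\<^sub>L unit_at r s = unit_at r s" using isom(2)[OF X(1)] by (simp add: unit_at_def oL_assoc[symmetric])
  moreover have "Q r o\<^sub>L unit_at r s \<in> F i"
    using E(2) by (intro F_ideal[OF assms(1)] unit_at_G X) (simp add: XX_def)
  ultimately show ?thesis by simp
qed

lemma of_matrix_component:
  assumes i: "i \<le> d" and y: "y \<in> block_alg (EE i)"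
  shows "of_matrix y \<in> F i"
proof -
  note lin = of_matrix_linear[of UNIV, unfolded op_linear_on_def, simplified]
  note FD = star_algebraD[OF F[OF i]]
  have "block_alg (EE i) \<subseteq> {y. of_matrix y \<in> F i}"
  proof (rule block_alg_subset[OF finite_EE])
    show "csubspace {y. of_matrix y \<in> F i}"
      using FD by (auto simp: csubspace_def lin op_linear_on_zero[OF of_matrix_linear[of UNIV]])
    show "matunit r s \<in> {y. of_matrix y \<in> F i}" if "(r, s) \<in> EE i" for r s
      using unit_at_component[OF i that] of_matrix_matunit[OF EE_E(1)[OF that]] by simp
  qed
  then show ?thesis using y by blast
qed

lemma of_matrix_diagonal:
  assumes i: "i \<le> d" and y: "y \<in> block_alg (Id_on (XX i))"
  shows "of_matrix y \<in> DF i"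
proof -
  note lin = of_matrix_linear[of UNIV, unfolded op_linear_on_def, simplified]
  note FD = star_algebraD[OF DF(1)[OF i]]
  have "block_alg (Id_on (XX i)) \<subseteq> {y. of_matrix y \<in> DF i}"
  proof (rule block_alg_subset)
    show "finite (Id_on (XX i))" by (rule finite_equiv[OF finite_XX equiv_Id_on])
    show "csubspace {y. of_matrix y \<in> DF i}"
      using FD by (auto simp: csubspace_def lin op_linear_on_zero[OF of_matrix_linear[of UNIV]])
    show "matunit r s \<in> {y. of_matrix y \<in> DF i}" if "(r, s) \<in> Id_on (XX i)" for r s
    proof -
      have rs: "r = s" "r \<in> X" "Q r \<in> F i" using that by (auto simp: XX_def)
      then have "of_matrix (matunit r s) = Q r" using of_matrix_matunit[OF E_refl[OF rs(2)]] unit_at_diag by simp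
      then show ?thesis using P_component_diagonal[OF Q_P[OF rs(2)] i rs(3)] by simp
    qed
  qed
  then show ?thesis using y by blast
qed

text \<open>For \<open>x\<close> in the diagonal \<open>Q l x\<close> is a multiple of \<open>Q l\<close>, so conjugation by \<open>unit_at k l\<close> sends \<open>x\<close> to a
  multiple of \<open>Q k\<close>.\<close>

lemma unit_at_normaliser:
  assumes i: "i \<le> d" and kl: "(k, l) \<in> EE i"
  shows "unit_at k l \<in> normalisers (F i) (DF i)"
proof -
  have half: "unit_at k l o\<^sub>L x o\<^sub>L adj (unit_at k l) \<in> DF i" if kl: "(k, l) \<in> EE i" and x: "x \<in> DF i" for k l x
  proof -
    note E = EE_E[OF kl]
    note X = E_X[OF E(1)]
    obtain z where z: "Q l o\<^sub>L x = op_scale z (Q l)" using PD(8)[OF Q_P[OF X(2)] DF_dsum[OF i x]] by blast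
    have ul: "unit_at k l o\<^sub>L Q l = unit_at k l"
      using unit_at_comp[OF E(1) E_refl[OF X(2)]] unit_at_diag[OF X(2)] by simp
    have "unit_at k l o\<^sub>L x = unit_at k l o\<^sub>L (Q l o\<^sub>L x)" using ul by (simp add: oL_assoc[symmetric])
    also have "\<dots> = op_scale z (unit_at k l)" using z ul unit_at_bops[OF X] by simp
    finally have "unit_at k l o\<^sub>L x o\<^sub>L adj (unit_at k l) = op_scale z (unit_at k l o\<^sub>L unit_at l k)"
      using adj_unit_at[OF X] by simp
    also have "\<dots> = op_scale z (Q k)"
      using unit_at_comp[OF E(1) E_sym[OF E(1)]] unit_at_diag[OF X(1)] by simp
    also have "\<dots> \<in> DF i"
      using star_algebraD(6)[OF DF(1)[OF i] P_component_diagonal[OF Q_P[OF X(1)] i]] E(2) by (simp add: XX_def)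
    finally show ?thesis .
  qed
  have lk: "(l, k) \<in> EE i" using kl E_sym by (auto simp: EE_def)
  note X = E_X[OF EE_E(1)[OF kl]]
  have "adj (unit_at k l) o\<^sub>L x o\<^sub>L unit_at k l \<in> DF i" if "x \<in> DF i" for x
    using half[OF lk that] adj_unit_at[OF X] adj_unit_at[OF X(2,1)] by simp
  then show ?thesis
    using unit_at_component[OF i kl] half[OF kl] by (simp add: normalisers_def)
qed

end

lemma diagonal_normalises:
  assumes "star_algebra DF" "DF \<subseteq> F"
  shows "DF \<subseteq> normalisers F DF"
  using star_algebraD[OF assms(1)] assms(2) by (auto simp: normalisers_def)

text \<open>The given approximation is composed with the isomorphism of its finite-dimensional algebra with block
  diagonal matrices and with the inverse of that isomorphism.\<close>

lemma diag_dim_le_imp_gen_diag_dim_le: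
  fixes A D :: "'h::chilbert_space op set"
  assumes A: "cstar_algebra A" and D: "cstar_algebra D" "abelian D" and nd: "nondegenerate D A"
    and diag: "diag_dim_le D A d"
  shows "gen_diag_dim_le D A complex_alg d"
  unfolding gen_diag_dim_le_def
proof (intro allI impI)
  fix \<F> :: "'h op set" and \<epsilon> :: real
  assume fe: "finite \<F> \<and> \<F> \<subseteq> A \<and> 0 < \<epsilon>"
  have As: "star_algebra A" and Ds: "star_algebra D" using A D by (auto simp: cstar_algebra_def)
  have Ab: "A \<subseteq> bops" "csubspace A" and Db: "D \<subseteq> bops" "csubspace D"
    using As Ds star_algebra_csubspace by (auto simp: star_algebra_def)
  from diag fe obtain F DF :: "nat \<Rightarrow> complex ell2 op set" and \<psi> \<phi> where
    F: "\<forall>i\<le>d. cstar_algebra (F i) \<and> finite_dim (F i)" and orth: "orthogonal_algs d F"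
    and DF: "\<forall>i\<le>d. star_algebra (DF i) \<and> DF i \<subseteq> F i" and masa: "masa (dsum d DF) (dsum d F)"
    and cp: "cp_map A (dsum d F) \<psi>" "cp_map (dsum d F) A \<phi>" and psi: "contractive_on A \<psi>"
    and approx: "\<forall>a\<in>\<F>. norm (\<phi> (\<psi> a) - a) < \<epsilon>"
    and oz: "\<forall>i\<le>d. contractive_on (F i) \<phi> \<and> order_zero (F i) A \<phi>"
    and psiD: "\<psi> ` D \<subseteq> dsum d DF"
    and nor: "\<forall>i\<le>d. \<phi> ` normalisers (F i) (DF i) \<subseteq> normalisers A D"
    unfolding diag_dim_le_def by (elim allE[of _ \<F>] allE[of _ \<epsilon>] impE exE conjE) blast
  interpret diagonal_decomposition d F DF
    using F orth DF masa by unfold_locales (auto simp: cstar_algebra_def)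
  obtain Q and X :: "nat set" where QX: "bij_betw Q X P"
    using ex_bij_betw_nat_finite[OF finite_P] by blast
  interpret diagonal_model d F DF Q X by unfold_locales (rule QX)
  define F' where "F' i = block_alg (EE i)" for i
  define DF' where "DF' i = block_alg (Id_on (XX i))" for i
  define \<psi>' where "\<psi>' a = to_matrix (\<psi> a)" for a
  define \<phi>' where "\<phi>' y = \<phi> (of_matrix y)" for y
  have dF': "dsum d F' = block_alg E" unfolding F'_def by (rule dsum_block_EE)
  have dDF': "dsum d DF' = block_alg (Id_on X)" unfolding DF'_def by (rule dsum_diagonal_XX)
  have t: "tensor_alg (dsum d F') complex_alg = block_alg E" "tensor_alg (dsum d DF') complex_alg = block_alg (Id_on X)"
    by (simp_all add: dF' dDF' tensor_alg_block_alg)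
  have ti: "tensor_alg (F' i) complex_alg = F' i" "tensor_alg (DF' i) complex_alg = DF' i" for i
    by (simp_all add: F'_def DF'_def tensor_alg_block_alg)
  have psiA: "\<psi> a \<in> dsum d F" if "a \<in> A" for a using cp(1) that by (auto simp: cp_map_def)
  have cp': "cp_map A (block_alg E) \<psi>'" "cp_map (block_alg E) A \<phi>'"
    unfolding \<psi>'_def \<phi>'_def
    using cp_map_compose[OF cp(1) to_matrix_cp] cp_map_compose[OF of_matrix_cp cp(2)] by auto
  have F'E: "F' i \<subseteq> block_alg E" for i unfolding F'_def by (rule block_EE_subset)
  have F'b: "F' i \<subseteq> bops" for i by (auto simp: F'_def block_alg_iff)
  have cpi: "cp_map (F' i) A \<phi>'" for i by (rule cp_map_restrict[OF cp'(2) F'E])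
  have lin: "op_linear_on (F' i) \<phi>'" for i using cpi by (simp add: cp_map_def)
  have F'F: "of_matrix y \<in> F i" if "i \<le> d" "y \<in> F' i" for i y
    using of_matrix_component that by (simp add: F'_def)
  have con': "contractive_on (F' i) \<phi>'" if i: "i \<le> d" for i
    unfolding contractive_on_def
  proof
    fix y assume y: "y \<in> F' i"
    have "norm (\<phi>' y) \<le> norm (of_matrix y)"
      using oz i F'F[OF i y] by (simp add: contractive_on_def \<phi>'_def)
    also have "\<dots> \<le> norm y" using of_matrix_contractive y F'E by (auto simp: contractive_on_def)
    finally show "norm (\<phi>' y) \<le> norm y" .
  qed
  have oz': "order_zero (F' i) A \<phi>'" if i: "i \<le> d" for i
    unfolding order_zero_def
  proof (intro conjI ballI impI cpi)
    fix a b assume ab: "a \<in> F' i" "b \<in> F' i" "pos_op a \<and> pos_op b \<and> a o\<^sub>L b = 0"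
    have abE: "a \<in> block_alg E" "b \<in> block_alg E" using ab F'E by auto
    have "pos_op (of_matrix a)" "pos_op (of_matrix b)"
      using ab abE GD(1) by (auto intro!: cp_pos_op[OF of_matrix_cp])
    moreover have "of_matrix a o\<^sub>L of_matrix b = 0"
      using of_matrix_mult[OF abE] ab(3) op_linear_on_zero[OF of_matrix_linear[of UNIV]] by simp
    ultimately show "\<phi>' a o\<^sub>L \<phi>' b = 0"
      using oz i F'F[OF i ab(1)] F'F[OF i ab(2)] unfolding order_zero_def \<phi>'_def by blast
  qed
  have diag': "\<phi>' ` DF' i \<subseteq> normalisers A D" if i: "i \<le> d" for i
  proof -
    have "of_matrix y \<in> normalisers (F i) (DF i)" if "y \<in> DF' i" for y
      using of_matrix_diagonal[OF i] that diagonal_normalises[of "DF i" "F i"] DF i by (auto simp: DF'_def)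
    then show ?thesis using nor i by (auto simp: \<phi>'_def)
  qed
  have unit': "\<phi>' (tensor_op v b) \<in> normalisers A D"
    if i: "i \<le> d" and v: "matrix_unit (F' i) (DF' i) v" and b: "b \<in> complex_alg" for i v b
  proof -
    obtain k l c where kl: "(k, l) \<in> EE i" "v = op_scale c (matunit k l)"
      using matrix_unitD[OF finite_XX equiv_EE v[unfolded F'_def DF'_def]] by blast
    obtain z where z: "b = blinfun_mult_right z" using b by (auto simp: complex_alg_def)
    have "matunit k l \<in> F' i" using kl(1) by (simp add: F'_def matunit_in_block_alg)
    then have "\<phi>' (tensor_op v b) = op_scale (z * c) (\<phi>' (matunit k l))"
      using kl(2) z by (simp add: tensor_op_complex op_linear_onD(2)[OF lin])
    moreover have "\<phi>' (matunit k l) \<in> normalisers A D"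
      using nor i unit_at_normaliser[OF i kl(1)] of_matrix_matunit[OF EE_E(1)[OF kl(1)]]
      by (auto simp: \<phi>'_def)
    ultimately show ?thesis using normaliser_scale[OF Ab(2,1) Db(2,1)] by simp
  qed
  have comm': "\<exists>T\<in>commutant D. \<forall>\<xi>. ((\<lambda>u. blinfun_apply (\<pi> (tensor_op v u)) \<xi>) \<longlongrightarrow> blinfun_apply T \<xi>) U"
    if i: "i \<le> d" and pi: "supporting_hom (F' i) \<phi>' \<pi>" and U: "approx_unit U complex_alg"
      and v: "min_projection (DF' i) v" for i \<pi> U v
  proof (intro bexI[of _ "\<pi> v"] allI)
    obtain k where k: "k \<in> XX i" "v = matunit k k"
      using min_projection_diagonalD[OF finite_XX v[unfolded DF'_def]] by blast
    have "(k, k) \<in> EE i" using k(1) E_refl XX_subset by (auto simp: EE_def)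
    then have vF: "v \<in> F' i" "v \<in> DF' i"
      using k by (auto simp: F'_def DF'_def intro!: matunit_in_block_alg)
    have img: "\<phi>' ` F' i \<subseteq> bops" using cpi[of i] Ab(1) by (auto simp: cp_map_def)
    show "\<pi> v \<in> commutant D"
      by (rule supporting_hom_commutes[OF pi img vF(1) _ D nd])
        (use diag'[OF i] vF(2) k projection_matunit in auto)
    fix \<xi>
    have pl: "op_linear_on (F' i) \<pi>"
      using pi unfolding supporting_hom_def star_hom_def by blast
    have "\<forall>\<^sub>F u in U. u \<in> complex_alg" using U by (auto simp: approx_unit_def elim: eventually_mono)
    then have "\<forall>\<^sub>F u in U. blinfun_apply u 1 *\<^sub>C blinfun_apply (\<pi> v) \<xi> = blinfun_apply (\<pi> (tensor_op v u)) \<xi>"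
    proof eventually_elim
      case (elim u)
      then obtain z where z: "u = blinfun_mult_right z" by (auto simp: complex_alg_def)
      have "tensor_op v u = op_scale z v" unfolding z using vF(1) F'b by (intro tensor_op_complex) auto
      then show ?case using op_linear_onD(2)[OF pl vF(1)] z by simp
    qed
    then show "((\<lambda>u. blinfun_apply (\<pi> (tensor_op v u)) \<xi>) \<longlongrightarrow> blinfun_apply (\<pi> v) \<xi>) U"
      using tendsto_scaleC_left[OF approx_unit_complex_tendsto[OF U], of "blinfun_apply (\<pi> v) \<xi>"]
      by (simp add: tendsto_cong)
  qed
  have psi': "contractive_on A \<psi>'"
    unfolding contractive_on_def
  proof
    fix a assume a: "a \<in> A"
    have "norm (\<psi>' a) \<le> norm (\<psi> a)"
      using to_matrix_contractive psiA[OF a] by (simp add: contractive_on_def \<psi>'_def)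
    also have "\<dots> \<le> norm a" using psi a by (simp add: contractive_on_def)
    finally show "norm (\<psi>' a) \<le> norm a" .
  qed
  have approx': "\<forall>a\<in>\<F>. norm (\<phi>' (\<psi>' a) - a) < \<epsilon>"
    using approx fe psiA by (auto simp: \<phi>'_def \<psi>'_def of_to_matrix subset_iff)
  have psiD': "\<psi>' ` D \<subseteq> block_alg (Id_on X)"
    using psiD to_matrix_diagonal by (auto simp: \<psi>'_def)
  show "\<exists>X E F DF \<psi> \<phi>.
      (\<forall>i\<le>d. finite (X i) \<and> equiv (X i) (E i) \<and>
        F i = block_alg (E i) \<and> DF i = block_alg (Id_on (X i))) \<and>
      (\<forall>i\<le>d. \<forall>j\<le>d. i \<noteq> j \<longrightarrow> X i \<inter> X j = {}) \<and>
      cp_map A (tensor_alg (dsum d F) complex_alg) \<psi> \<and> cp_map (tensor_alg (dsum d F) complex_alg) A \<phi> \<and>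
      contractive_on A \<psi> \<and>
      (\<forall>a\<in>\<F>. norm (\<phi> (\<psi> a) - a) < \<epsilon>) \<and>
      (\<forall>i\<le>d. contractive_on (tensor_alg (F i) complex_alg) \<phi> \<and> order_zero (tensor_alg (F i) complex_alg) A \<phi>) \<and>
      \<psi> ` D \<subseteq> tensor_alg (dsum d DF) complex_alg \<and>
      (\<forall>i\<le>d. \<phi> ` tensor_alg (DF i) complex_alg \<subseteq> normalisers A D \<and>
        (\<forall>v. matrix_unit (F i) (DF i) v \<longrightarrow> (\<forall>b\<in>complex_alg. \<phi> (tensor_op v b) \<in> normalisers A D))) \<and>
      (\<forall>i\<le>d. \<forall>\<pi> U v.
        supporting_hom (tensor_alg (F i) complex_alg) \<phi> \<pi> \<and> approx_unit U complex_alg \<and> min_projection (DF i) v \<longrightarrow>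
        (\<exists>T\<in>commutant D. \<forall>\<xi>.
          ((\<lambda>u. blinfun_apply (\<pi> (tensor_op v u)) \<xi>) \<longlongrightarrow> blinfun_apply T \<xi>) U))"
  proof (rule exI[of _ XX], rule exI[of _ EE], rule exI[of _ F'], rule exI[of _ DF'], rule exI[of _ \<psi>'],
      rule exI[of _ \<phi>'], intro conjI)
    show "\<forall>i\<le>d. finite (XX i) \<and> equiv (XX i) (EE i) \<and> F' i = block_alg (EE i) \<and> DF' i = block_alg (Id_on (XX i))"
      using finite_XX equiv_EE by (simp add: F'_def DF'_def)
    show "\<forall>i\<le>d. \<forall>j\<le>d. i \<noteq> j \<longrightarrow> XX i \<inter> XX j = {}" using XX_disjoint by blast
  qed (use t ti cp' psi' approx' con' oz' psiD' diag' unit' comm' in auto)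
qed

theorem propositionE:
  fixes A D :: "'h::chilbert_space op set"
  assumes "cstar_algebra A"
    and "cstar_algebra D"
    and "D \<subseteq> A"
    and "abelian D"
    and "nondegenerate D A"
  shows "diag_dim D A = gen_diag_dim D A complex_alg"
proof -
  have "diag_dim_le D A d \<longleftrightarrow> gen_diag_dim_le D A complex_alg d" for d
    using diag_dim_le_imp_gen_diag_dim_le[OF assms(1,2,4,5)] gen_diag_dim_le_imp_diag_dim_le[OF assms(1,2)]
    by blast
  then show ?thesis by (simp add: diag_dim_def gen_diag_dim_def)
qed

end
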